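(* Let $P\colon\mathcal E\to\mathcal B$ be a monoidal fibred category. 1. The projection $\mathrm{Mod}(\mathcal E)\to\mathrm{Mon}(\mathcal E)$, $(R,M)\mapsto R$, is a fibration. A Cartesian lift of a morphism $\phi\colon R\to S$ of $\mathrm{Mon}(\mathcal E)$ lying over $f\colon A\to B$, at a module $(S,N)$, is given by the composite of a vertical lift and a horizontal lift $$(R,\bar\phi^{\sharp}f^*N)\xrightarrow{(\bar\phi,1)}(f^*S,f^*N)\xrightarrow{(\bar f_S,\bar f_N)}(S,N),$$ where $\bar f_S\colon f^*S\to S$ and $\bar f_N\colon f^*N\to N$ are $P$-Cartesian lifts of $f$ with their induced monoid and module structures, $\bar\phi\colon R\to f^*S$ is the unique arrow over $1_A$ with $\bar f_S\circ\bar\phi=\phi$, and $\bar\phi^\sharp$ is restriction of scalars along $\bar\phi$ in $\mathcal E_A$. 2. For each $A\in\mathcal B$, the fibre fibration $\mathrm{Mod}(\mathcal E)_A\to\mathrm{Mon}(\mathcal E)_A$ is isomorphic to the fibration $\mathrm{Mod}(\mathcal E_A)\to\mathrm{Mon}(\mathcal E_A)$ of modules over monoids in the monoidal category $\mathcal E_A$. 3. Let $\Phi_P\colon\mathcal B^{op}\to\mathit{MONCAT}$ be the monoidal indexed category determined by a cleavage of $P$, and let $\mathrm{Mod}(\Phi_P)\to\mathrm{Mon}(\Phi_P)\to\mathcal B$ be the fibration of modules over the fibration of monoids in $\Phi_P$. There is an isomorphism of fibrations over fibrations over $\mathcal B$, i.e. there are isomorphisms of categories $\mathrm{Mod}(\Phi_P)\cong\mathrm{Mod}(\mathcal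 E)$ and $\mathrm{Mon}(\Phi_P)\cong\mathrm{Mon}(\mathcal E)$ commuting with the projections $\mathrm{Mod}(\Phi_P)\to\mathrm{Mon}(\Phi_P)$, $\mathrm{Mod}(\mathcal E)\to\mathrm{Mon}(\mathcal E)$ and with the projections to $\mathcal B$.
   Context: A monoidal fibred category over $\mathcal B$ is a fibration $P\colon\mathcal E\to\mathcal B$ with functors over $\mathcal B$, $\otimes\colon\mathcal E\times_{\mathcal B}\mathcal E\to\mathcal E$ and $u\colon\mathcal B\to\mathcal E$, and natural isomorphisms over $\mathcal B$ (associator and unitors) satisfying the usual coherence axioms in each fibre; so each fibre $\mathcal E_A$ is a monoidal category with unit $I_A=u(A)$. $\mathrm{Mon}(\mathcal E)$: objects are monoids in the fibre monoidal categories $\mathcal E_B$, $B\in\mathcal B$; a morphism $(R,\mu,\eta)\to(S,\nu,\lambda)$ is an arrow $\phi\colon R\to S$ of $\mathcal E$ with $\phi\circ\mu=\nu\circ(\phi\otimes\phi)$ and $\phi\circ\eta=\lambda\circ u(P(\phi))$. $\mathrm{Mod}(\mathcal E)$: objects are pairs $(R,M)$ with $R$ a monoid in $\mathcal E$ and $M=(M,\kappa)$ a right $R$-module in $\mathcal E_{P(R)}$; a morphism $(R,(M,\kappa))\to(S,(N,\sigma))$ is a pair $(\phi,\alpha)$ with $\phi\colon R\to S$ in $\mathrm{Mon}(\mathcal E)$ and $\alpha\colon M\to N$ in $\mathcal E$ such that $P(\phi)=P(\alpha)$ and $\alpha\circ\kappa=\sigma\circ(\alpha\otimes\phi)$. Composition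 is that of $\mathcal E$, resp. $\mathcal E\times\mathcal E$. Induced structures: for a Cartesian lift $\bar f_S\colon f^*S\to S$ of $f\colon A\to B$ at a monoid $S$ in $\mathcal E_B$, $f^*S$ has a unique monoid structure in $\mathcal E_A$ making $\bar f_S$ a morphism of $\mathrm{Mon}(\mathcal E)$; for an $S$-module $N$ in $\mathcal E_B$ and a Cartesian lift $\bar f_N\colon f^*N\to N$, $f^*N$ has a unique $f^*S$-module structure making $(\bar f_S,\bar f_N)$ a morphism of $\mathrm{Mod}(\mathcal E)$. For a monoidal category $\mathcal V$, $\mathrm{Mod}(\mathcal V)$ has objects pairs $(R,M)$ of a monoid and a right module over it, and morphisms pairs $(f,\alpha)$ with $f$ a morphism of monoids and $\alpha$ an arrow of $\mathcal V$ commuting with the actions; it is fibred over the category $\mathrm{Mon}(\mathcal V)$ of monoids. Restriction of scalars along a morphism of monoids $f\colon R\to S$ sends $(M,\kappa)$ to $(M,\kappa\circ(1_M\otimes f))$. $\mathit{MONCAT}$ is the 2-category of monoidal categories, lax monoidal functors and monoidal transformations. $\Phi_P$ sends $A$ to $\mathcal E_A$ and $f$ to the inverse image functor $f^*$ with monoidal structure defined by Cartesianness. For $\Phi\colon\mathcal B^{op}\to\mathit{MONCAT}$, the pseudo-functors $A\mapsto\mathrm{Mod}(\Phi(A))$ and $A\mapsto\mathrm{Mon}(\Phi(A))$ into $\mathit{CAT}$ (using that lax monoidal functors preserve monoids and modules), together with the strict transformation with components $\mathrm{Mod}(\Phi(A))\to\mathrm{Mon}(\Phi(A))$, give by Grothendieck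 construction $\mathrm{Mod}(\Phi)\to\mathrm{Mon}(\Phi)\to\mathcal B$. *)

theory Defs
  imports Main
begin

section \<open>Categories, functors, natural isomorphisms\<close>

text \<open>All structure is relativised to the carriers \<open>Ob\<close> and \<open>Ar\<close>; the values of the operations
  elsewhere are irrelevant. Composition is written in the usual order, \<open>g \<cdot> f\<close> being \<open>f\<close> first.\<close>

record ('o, 'm) cat =
  Ob :: "'o set"
  Ar :: "'m set"
  Dom :: "'m \<Rightarrow> 'o"
  Cod :: "'m \<Rightarrow> 'o"
  Idn :: "'o \<Rightarrow> 'm"
  Comp :: "'m \<Rightarrow> 'm \<Rightarrow> 'm"  (infixl "\<cdot>\<index>" 70)

definition hom :: "('o, 'm, 'z) cat_scheme \<Rightarrow> 'o \<Rightarrow> 'o \<Rightarrow> 'm set" where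
  "hom C X Y = {f \<in> Ar C. Dom C f = X \<and> Cod C f = Y}"

definition category :: "('o, 'm, 'z) cat_scheme \<Rightarrow> bool" where
  "category C \<longleftrightarrow>
    (\<forall>f \<in> Ar C. Dom C f \<in> Ob C \<and> Cod C f \<in> Ob C) \<and>
    (\<forall>X \<in> Ob C. Idn C X \<in> hom C X X) \<and>
    (\<forall>f \<in> Ar C. \<forall>g \<in> Ar C. Cod C f = Dom C g \<longrightarrow> g \<cdot>\<^bsub>C\<^esub> f \<in> hom C (Dom C f) (Cod C g)) \<and>
    (\<forall>f \<in> Ar C. f \<cdot>\<^bsub>C\<^esub> Idn C (Dom C f) = f \<and> Idn C (Cod C f) \<cdot>\<^bsub>C\<^esub> f = f) \<and>
    (\<forall>f \<in> Ar C. \<forall>g \<in> Ar C. \<forall>h \<in> Ar C. Cod C f = Dom C g \<longrightarrow> Cod C g = Dom C h \<longrightarrow>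
      (h \<cdot>\<^bsub>C\<^esub> g) \<cdot>\<^bsub>C\<^esub> f = h \<cdot>\<^bsub>C\<^esub> (g \<cdot>\<^bsub>C\<^esub> f))"

text \<open>A category given by its objects and hom-sets. As the hom-sets need not be disjoint, an arrow
  is recorded together with its source and target.\<close>

definition hom_cat :: "'o set \<Rightarrow> ('o \<Rightarrow> 'o \<Rightarrow> 'h set) \<Rightarrow> ('o \<Rightarrow> 'h) \<Rightarrow>
    ('o \<Rightarrow> 'o \<Rightarrow> 'o \<Rightarrow> 'h \<Rightarrow> 'h \<Rightarrow> 'h) \<Rightarrow> ('o, 'o \<times> 'h \<times> 'o) cat" where
  "hom_cat obs H i c =
    \<lparr>Ob = obs,
     Ar = {(X, f, Y). X \<in> obs \<and> Y \<in> obs \<and> f \<in> H X Y},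
     Dom = (\<lambda>(X, f, Y). X),
     Cod = (\<lambda>(X, f, Y). Y),
     Idn = (\<lambda>X. (X, i X, X)),
     Comp = (\<lambda>(Y', g, Z) (X, f, Y). (X, c X Y Z g f, Z))\<rparr>"

record ('o, 'm, 'p, 'n) func =
  FO :: "'o \<Rightarrow> 'p"
  FA :: "'m \<Rightarrow> 'n"

definition is_functor :: "('o, 'm, 'z) cat_scheme \<Rightarrow> ('p, 'n, 'y) cat_scheme \<Rightarrow>
    ('o, 'm, 'p, 'n, 'w) func_scheme \<Rightarrow> bool" where
  "is_functor C D F \<longleftrightarrow> category C \<and> category D \<and>
    (\<forall>X \<in> Ob C. FO F X \<in> Ob D) \<and>
    (\<forall>f \<in> Ar C. FA F f \<in> hom D (FO F (Dom C f)) (FO F (Cod C f))) \<and>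
    (\<forall>X \<in> Ob C. FA F (Idn C X) = Idn D (FO F X)) \<and>
    (\<forall>f \<in> Ar C. \<forall>g \<in> Ar C. Cod C f = Dom C g \<longrightarrow>
      FA F (g \<cdot>\<^bsub>C\<^esub> f) = FA F g \<cdot>\<^bsub>D\<^esub> FA F f)"

definition id_func :: "('o, 'm, 'o, 'm) func" where
  "id_func = \<lparr>FO = (\<lambda>X. X), FA = (\<lambda>f. f)\<rparr>"

definition comp_func :: "('p, 'n, 'q, 'k, 'w) func_scheme \<Rightarrow> ('o, 'm, 'p, 'n, 'v) func_scheme \<Rightarrow>
    ('o, 'm, 'q, 'k) func" where
  "comp_func G F = \<lparr>FO = (\<lambda>X. FO G (FO F X)), FA = (\<lambda>f. FA G (FA F f))\<rparr>"

definition func_eq :: "('o, 'm, 'z) cat_scheme \<Rightarrow> ('o, 'm, 'p, 'n, 'w) func_scheme \<Rightarrow>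
    ('o, 'm, 'p, 'n, 'v) func_scheme \<Rightarrow> bool" where
  "func_eq C F G \<longleftrightarrow> (\<forall>X \<in> Ob C. FO F X = FO G X) \<and> (\<forall>f \<in> Ar C. FA F f = FA G f)"

definition cat_isomorphism :: "('o, 'm, 'z) cat_scheme \<Rightarrow> ('p, 'n, 'y) cat_scheme \<Rightarrow>
    ('o, 'm, 'p, 'n) func \<Rightarrow> bool" where
  "cat_isomorphism C D F \<longleftrightarrow> is_functor C D F \<and>
    (\<exists>G :: ('p, 'n, 'o, 'm) func. is_functor D C G \<and>
      func_eq C (comp_func G F) id_func \<and> func_eq D (comp_func F G) id_func)"

definition is_iso :: "('o, 'm, 'z) cat_scheme \<Rightarrow> 'm \<Rightarrow> bool" where
  "is_iso C f \<longleftrightarrow> f \<in> Ar C \<and> (\<exists>g \<in> hom C (Cod C f) (Dom C f).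
     g \<cdot>\<^bsub>C\<^esub> f = Idn C (Dom C f) \<and> f \<cdot>\<^bsub>C\<^esub> g = Idn C (Cod C f))"

definition nat_trans :: "('o, 'm, 'z) cat_scheme \<Rightarrow> ('p, 'n, 'y) cat_scheme \<Rightarrow>
    ('o, 'm, 'p, 'n, 'w) func_scheme \<Rightarrow> ('o, 'm, 'p, 'n, 'v) func_scheme \<Rightarrow> ('o \<Rightarrow> 'n) \<Rightarrow> bool" where
  "nat_trans C D F G t \<longleftrightarrow> is_functor C D F \<and> is_functor C D G \<and>
    (\<forall>X \<in> Ob C. t X \<in> hom D (FO F X) (FO G X)) \<and>
    (\<forall>f \<in> Ar C. FA G f \<cdot>\<^bsub>D\<^esub> t (Dom C f) = t (Cod C f) \<cdot>\<^bsub>D\<^esub> FA F f)"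

definition nat_iso :: "('o, 'm, 'z) cat_scheme \<Rightarrow> ('p, 'n, 'y) cat_scheme \<Rightarrow>
    ('o, 'm, 'p, 'n, 'w) func_scheme \<Rightarrow> ('o, 'm, 'p, 'n, 'v) func_scheme \<Rightarrow> ('o \<Rightarrow> 'n) \<Rightarrow> bool" where
  "nat_iso C D F G t \<longleftrightarrow> nat_trans C D F G t \<and> (\<forall>X \<in> Ob C. is_iso D (t X))"

definition prod_cat :: "('o, 'm, 'z) cat_scheme \<Rightarrow> ('p, 'n, 'y) cat_scheme \<Rightarrow> ('o \<times> 'p, 'm \<times> 'n) cat" where
  "prod_cat C D =
    \<lparr>Ob = Ob C \<times> Ob D,
     Ar = Ar C \<times> Ar D,
     Dom = (\<lambda>(f, g). (Dom C f, Dom D g)),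
     Cod = (\<lambda>(f, g). (Cod C f, Cod D g)),
     Idn = (\<lambda>(X, Y). (Idn C X, Idn D Y)),
     Comp = (\<lambda>(f', g') (f, g). (f' \<cdot>\<^bsub>C\<^esub> f, g' \<cdot>\<^bsub>D\<^esub> g))\<rparr>"

definition fprod_cat :: "('o, 'm, 'z) cat_scheme \<Rightarrow> ('p, 'n, 'y) cat_scheme \<Rightarrow>
    ('o, 'm, 'b, 'f, 'w) func_scheme \<Rightarrow> ('p, 'n, 'b, 'f, 'v) func_scheme \<Rightarrow> ('o \<times> 'p, 'm \<times> 'n) cat" where
  "fprod_cat C D P Q = (prod_cat C D)
    \<lparr>Ob := {(X, Y). X \<in> Ob C \<and> Y \<in> Ob D \<and> FO P X = FO Q Y},
     Ar := {(f, g). f \<in> Ar C \<and> g \<in> Ar D \<and> FA P f = FA Q g}\<rparr>"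

definition fst_func :: "('o \<times> 'p, 'm \<times> 'n, 'o, 'm) func" where
  "fst_func = \<lparr>FO = fst, FA = fst\<rparr>"


section \<open>Fibrations\<close>

definition cartesian :: "('o, 'm, 'z) cat_scheme \<Rightarrow> ('b, 'f, 'y) cat_scheme \<Rightarrow>
    ('o, 'm, 'b, 'f, 'w) func_scheme \<Rightarrow> 'm \<Rightarrow> bool" where
  "cartesian E B P k \<longleftrightarrow> k \<in> Ar E \<and>
    (\<forall>h \<in> Ar E. \<forall>w \<in> hom B (FO P (Dom E h)) (FO P (Dom E k)).
      Cod E h = Cod E k \<longrightarrow> FA P k \<cdot>\<^bsub>B\<^esub> w = FA P h \<longrightarrow>
      (\<exists>!v. v \<in> hom E (Dom E h) (Dom E k) \<and> FA P v = w \<and> k \<cdot>\<^bsub>E\<^esub> v = h))"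

definition cartesian_lift :: "('o, 'm, 'z) cat_scheme \<Rightarrow> ('b, 'f, 'y) cat_scheme \<Rightarrow>
    ('o, 'm, 'b, 'f, 'w) func_scheme \<Rightarrow> 'f \<Rightarrow> 'o \<Rightarrow> 'm \<Rightarrow> bool" where
  "cartesian_lift E B P f Y k \<longleftrightarrow> cartesian E B P k \<and> FA P k = f \<and> Cod E k = Y"

definition fibration :: "('o, 'm, 'z) cat_scheme \<Rightarrow> ('b, 'f, 'y) cat_scheme \<Rightarrow>
    ('o, 'm, 'b, 'f, 'w) func_scheme \<Rightarrow> bool" where
  "fibration E B P \<longleftrightarrow> is_functor E B P \<and>
    (\<forall>f \<in> Ar B. \<forall>Y \<in> Ob E. FO P Y = Cod B f \<longrightarrow> (\<exists>k. cartesian_lift E B P f Y k))"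

definition cleavage :: "('o, 'm, 'z) cat_scheme \<Rightarrow> ('b, 'f, 'y) cat_scheme \<Rightarrow>
    ('o, 'm, 'b, 'f, 'w) func_scheme \<Rightarrow> ('f \<Rightarrow> 'o \<Rightarrow> 'm) \<Rightarrow> bool" where
  "cleavage E B P c \<longleftrightarrow>
    (\<forall>f \<in> Ar B. \<forall>Y \<in> Ob E. FO P Y = Cod B f \<longrightarrow> cartesian_lift E B P f Y (c f Y))"

definition fibre_cat :: "('o, 'm) cat \<Rightarrow> ('b, 'f, 'y) cat_scheme \<Rightarrow>
    ('o, 'm, 'b, 'f, 'w) func_scheme \<Rightarrow> 'b \<Rightarrow> ('o, 'm) cat" where
  "fibre_cat E B P A = E
    \<lparr>Ob := {X \<in> Ob E. FO P X = A},
     Ar := {f \<in> Ar E. FO P (Dom E f) = A \<and> FO P (Cod E f) = A \<and> FA P f = Idn B A}\<rparr>"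

definition isomorphic_fibrations :: "('o, 'm, 'z) cat_scheme \<Rightarrow> ('p, 'n, 'y) cat_scheme \<Rightarrow>
    ('o, 'm, 'p, 'n, 'w) func_scheme \<Rightarrow> ('o2, 'm2, 'z2) cat_scheme \<Rightarrow> ('p2, 'n2, 'y2) cat_scheme \<Rightarrow>
    ('o2, 'm2, 'p2, 'n2, 'w2) func_scheme \<Rightarrow> bool" where
  "isomorphic_fibrations M N p M' N' p' \<longleftrightarrow>
    fibration M N p \<and> fibration M' N' p' \<and>
    (\<exists>K L. cat_isomorphism M M' K \<and> cat_isomorphism N N' L \<and>
      func_eq M (comp_func p' K) (comp_func L p))"

text \<open>Fibrations \<open>p\<close>, \<open>p'\<close> over fibrations \<open>q\<close>, \<open>q'\<close> over the same base \<open>B\<close> are isomorphic over \<open>B\<close>.\<close>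

definition isomorphic_fibrations_over :: "('b, 'f, 'x) cat_scheme \<Rightarrow> ('o, 'm, 'z) cat_scheme \<Rightarrow>
    ('p, 'n, 'y) cat_scheme \<Rightarrow> ('o, 'm, 'p, 'n, 'w) func_scheme \<Rightarrow> ('p, 'n, 'b, 'f, 'v) func_scheme \<Rightarrow>
    ('o2, 'm2, 'z2) cat_scheme \<Rightarrow> ('p2, 'n2, 'y2) cat_scheme \<Rightarrow>
    ('o2, 'm2, 'p2, 'n2, 'w2) func_scheme \<Rightarrow> ('p2, 'n2, 'b, 'f, 'v2) func_scheme \<Rightarrow> bool" where
  "isomorphic_fibrations_over B M N p q M' N' p' q' \<longleftrightarrow>
    fibration M N p \<and> fibration N B q \<and> fibration M' N' p' \<and> fibration N' B q' \<and>
    (\<exists>K L. cat_isomorphism M M' K \<and> cat_isomorphism N N' L \<and>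
      func_eq M (comp_func p' K) (comp_func L p) \<and>
      func_eq N (comp_func q' L) q)"


section \<open>Monoidal categories, monoids and modules\<close>

record ('o, 'm) moncat = "('o, 'm) cat" +
  tens :: "('o \<times> 'o, 'm \<times> 'm, 'o, 'm) func"
  munit :: 'o
  massoc :: "'o \<Rightarrow> 'o \<Rightarrow> 'o \<Rightarrow> 'm"
  mlunit :: "'o \<Rightarrow> 'm"
  mrunit :: "'o \<Rightarrow> 'm"

abbreviation tens_ob :: "('o, 'm, 'z) moncat_scheme \<Rightarrow> 'o \<Rightarrow> 'o \<Rightarrow> 'o"  (infixl "\<otimes>\<index>" 75) where
  "X \<otimes>\<^bsub>V\<^esub> Y \<equiv> FO (tens V) (X, Y)"

abbreviation tens_ar :: "('o, 'm, 'z) moncat_scheme \<Rightarrow> 'm \<Rightarrow> 'm \<Rightarrow> 'm"  (infixl "\<odot>\<index>" 75) where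
  "f \<odot>\<^bsub>V\<^esub> g \<equiv> FA (tens V) (f, g)"

definition tens_l :: "('o \<times> 'o, 'm \<times> 'm, 'o, 'm) func \<Rightarrow>
    (('o \<times> 'o) \<times> 'o, ('m \<times> 'm) \<times> 'm, 'o, 'm) func" where
  "tens_l T = \<lparr>FO = (\<lambda>((X, Y), Z). FO T (FO T (X, Y), Z)), FA = (\<lambda>((f, g), h). FA T (FA T (f, g), h))\<rparr>"

definition tens_r :: "('o \<times> 'o, 'm \<times> 'm, 'o, 'm) func \<Rightarrow>
    (('o \<times> 'o) \<times> 'o, ('m \<times> 'm) \<times> 'm, 'o, 'm) func" where
  "tens_r T = \<lparr>FO = (\<lambda>((X, Y), Z). FO T (X, FO T (Y, Z))), FA = (\<lambda>((f, g), h). FA T (f, FA T (g, h)))\<rparr>"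

text \<open>Pentagon and triangle for \<open>\<alpha> : (X \<otimes> Y) \<otimes> Z \<rightarrow> X \<otimes> (Y \<otimes> Z)\<close>, \<open>\<lambda> : I \<otimes> X \<rightarrow> X\<close>, \<open>\<rho> : X \<otimes> I \<rightarrow> X\<close>.\<close>

definition monoidal_coherence :: "('o, 'm, 'z) moncat_scheme \<Rightarrow> bool" where
  "monoidal_coherence V \<longleftrightarrow>
    (\<forall>W \<in> Ob V. \<forall>X \<in> Ob V. \<forall>Y \<in> Ob V. \<forall>Z \<in> Ob V.
      massoc V W X (Y \<otimes>\<^bsub>V\<^esub> Z) \<cdot>\<^bsub>V\<^esub> massoc V (W \<otimes>\<^bsub>V\<^esub> X) Y Z =
      (Idn V W \<odot>\<^bsub>V\<^esub> massoc V X Y Z) \<cdot>\<^bsub>V\<^esub> massoc V W (X \<otimes>\<^bsub>V\<^esub> Y) Z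
        \<cdot>\<^bsub>V\<^esub> (massoc V W X Y \<odot>\<^bsub>V\<^esub> Idn V Z)) \<and>
    (\<forall>X \<in> Ob V. \<forall>Y \<in> Ob V.
      (Idn V X \<odot>\<^bsub>V\<^esub> mlunit V Y) \<cdot>\<^bsub>V\<^esub> massoc V X (munit V) Y = mrunit V X \<odot>\<^bsub>V\<^esub> Idn V Y)"

definition monoidal_category :: "('o, 'm, 'z) moncat_scheme \<Rightarrow> bool" where
  "monoidal_category V \<longleftrightarrow> category V \<and>
    is_functor (prod_cat V V) V (tens V) \<and>
    munit V \<in> Ob V \<and>
    nat_iso (prod_cat (prod_cat V V) V) V (tens_l (tens V)) (tens_r (tens V))
      (\<lambda>((X, Y), Z). massoc V X Y Z) \<and>
    nat_iso V V \<lparr>FO = (\<lambda>X. munit V \<otimes>\<^bsub>V\<^esub> X), FA = (\<lambda>f. Idn V (munit V) \<odot>\<^bsub>V\<^esub> f)\<rparr> id_func (mlunit V) \<and>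
    nat_iso V V \<lparr>FO = (\<lambda>X. X \<otimes>\<^bsub>V\<^esub> munit V), FA = (\<lambda>f. f \<odot>\<^bsub>V\<^esub> Idn V (munit V))\<rparr> id_func (mrunit V) \<and>
    monoidal_coherence V"

type_synonym ('o, 'm) mon = "'o \<times> 'm \<times> 'm"
type_synonym ('o, 'm) modl = "('o, 'm) mon \<times> ('o \<times> 'm)"
type_synonym ('o, 'm) mon_ar = "('o, 'm) mon \<times> 'm \<times> ('o, 'm) mon"
type_synonym ('o, 'm) modl_ar = "('o, 'm) modl \<times> ('m \<times> 'm) \<times> ('o, 'm) modl"

definition monoids :: "('o, 'm, 'z) moncat_scheme \<Rightarrow> ('o, 'm) mon set" where
  "monoids V = {(R, m, e). R \<in> Ob V \<and> m \<in> hom V (R \<otimes>\<^bsub>V\<^esub> R) R \<and> e \<in> hom V (munit V) R \<and>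
     m \<cdot>\<^bsub>V\<^esub> (m \<odot>\<^bsub>V\<^esub> Idn V R) = m \<cdot>\<^bsub>V\<^esub> (Idn V R \<odot>\<^bsub>V\<^esub> m) \<cdot>\<^bsub>V\<^esub> massoc V R R R \<and>
     m \<cdot>\<^bsub>V\<^esub> (e \<odot>\<^bsub>V\<^esub> Idn V R) = mlunit V R \<and>
     m \<cdot>\<^bsub>V\<^esub> (Idn V R \<odot>\<^bsub>V\<^esub> e) = mrunit V R}"

definition right_modules :: "('o, 'm, 'z) moncat_scheme \<Rightarrow> ('o, 'm) mon \<Rightarrow> ('o \<times> 'm) set" where
  "right_modules V = (\<lambda>(R, m, e). {(M, k). M \<in> Ob V \<and> k \<in> hom V (M \<otimes>\<^bsub>V\<^esub> R) M \<and>
     k \<cdot>\<^bsub>V\<^esub> (k \<odot>\<^bsub>V\<^esub> Idn V R) = k \<cdot>\<^bsub>V\<^esub> (Idn V M \<odot>\<^bsub>V\<^esub> m) \<cdot>\<^bsub>V\<^esub> massoc V M R R \<and>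
     k \<cdot>\<^bsub>V\<^esub> (Idn V M \<odot>\<^bsub>V\<^esub> e) = mrunit V M})"

definition Mon_cat :: "('o, 'm, 'z) moncat_scheme \<Rightarrow> (('o, 'm) mon, ('o, 'm) mon_ar) cat" where
  "Mon_cat V = hom_cat (monoids V)
    (\<lambda>(R, m, e) (S, n, l). {h \<in> hom V R S. h \<cdot>\<^bsub>V\<^esub> m = n \<cdot>\<^bsub>V\<^esub> (h \<odot>\<^bsub>V\<^esub> h) \<and> h \<cdot>\<^bsub>V\<^esub> e = l})
    (\<lambda>(R, m, e). Idn V R)
    (\<lambda>R S T h' h. h' \<cdot>\<^bsub>V\<^esub> h)"

definition Mod_cat :: "('o, 'm, 'z) moncat_scheme \<Rightarrow> (('o, 'm) modl, ('o, 'm) modl_ar) cat" where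
  "Mod_cat V = hom_cat {(R, M). R \<in> monoids V \<and> M \<in> right_modules V R}
    (\<lambda>(R, M, k) (S, N, s). {(h, a). (R, h, S) \<in> Ar (Mon_cat V) \<and> a \<in> hom V M N \<and>
       a \<cdot>\<^bsub>V\<^esub> k = s \<cdot>\<^bsub>V\<^esub> (a \<odot>\<^bsub>V\<^esub> h)})
    (\<lambda>((R, m, e), (M, k)). (Idn V R, Idn V M))
    (\<lambda>x y z (h', a') (h, a). (h' \<cdot>\<^bsub>V\<^esub> h, a' \<cdot>\<^bsub>V\<^esub> a))"

text \<open>The projection \<open>(R, M) \<mapsto> R\<close>, both for modules in a monoidal category and for modules in a
  monoidal fibred category.\<close>

definition Mod_proj :: "(('o, 'm) modl, ('o, 'm) modl_ar, ('o, 'm) mon, ('o, 'm) mon_ar) func" where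
  "Mod_proj = \<lparr>FO = fst, FA = (\<lambda>((R, M), (h, a), (S, N)). (R, h, S))\<rparr>"

definition restrict_scalars :: "('o, 'm, 'z) moncat_scheme \<Rightarrow> 'm \<Rightarrow> 'o \<times> 'm \<Rightarrow> 'o \<times> 'm" where
  "restrict_scalars V h = (\<lambda>(M, k). (M, k \<cdot>\<^bsub>V\<^esub> (Idn V M \<odot>\<^bsub>V\<^esub> h)))"


section \<open>Monoidal fibred categories\<close>

record ('b, 'f, 'o, 'm) monfib =
  base :: "('b, 'f) cat"
  tot :: "('o, 'm) cat"
  proj :: "('o, 'm, 'b, 'f) func"
  ftens :: "('o \<times> 'o, 'm \<times> 'm, 'o, 'm) func"
  funit :: "('b, 'f, 'o, 'm) func"
  fassoc :: "'o \<Rightarrow> 'o \<Rightarrow> 'o \<Rightarrow> 'm"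
  flunit :: "'o \<Rightarrow> 'm"
  frunit :: "'o \<Rightarrow> 'm"

definition fibre :: "('b, 'f, 'o, 'm) monfib \<Rightarrow> 'b \<Rightarrow> ('o, 'm) moncat" where
  "fibre F A = cat.extend (fibre_cat (tot F) (base F) (proj F) A)
     (moncat.fields (ftens F) (FO (funit F) A) (fassoc F) (flunit F) (frunit F))"

text \<open>The tensor product and the unit are only required to be functors over the base; they need not
  preserve Cartesian arrows.\<close>

definition monoidal_fibred_category :: "('b, 'f, 'o, 'm) monfib \<Rightarrow> bool" where
  "monoidal_fibred_category F \<longleftrightarrow>
    (let B = base F; E = tot F; P = proj F; T = ftens F; U = funit F;
         E2 = fprod_cat E E P P; E3 = fprod_cat E2 E (comp_func P fst_func) P in
      fibration E B P \<and>
      is_functor E2 E T \<and> func_eq E2 (comp_func P T) (comp_func P fst_func) \<and>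
      is_functor B E U \<and> func_eq B (comp_func P U) id_func \<and>
      nat_iso E3 E (tens_l T) (tens_r T) (\<lambda>((X, Y), Z). fassoc F X Y Z) \<and>
      (\<forall>((X, Y), Z) \<in> Ob E3. FA P (fassoc F X Y Z) = Idn B (FO P X)) \<and>
      nat_iso E E \<lparr>FO = (\<lambda>X. FO T (FO U (FO P X), X)), FA = (\<lambda>f. FA T (FA U (FA P f), f))\<rparr>
        id_func (flunit F) \<and>
      (\<forall>X \<in> Ob E. FA P (flunit F X) = Idn B (FO P X)) \<and>
      nat_iso E E \<lparr>FO = (\<lambda>X. FO T (X, FO U (FO P X))), FA = (\<lambda>f. FA T (f, FA U (FA P f)))\<rparr>
        id_func (frunit F) \<and>
      (\<forall>X \<in> Ob E. FA P (frunit F X) = Idn B (FO P X)) \<and>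
      (\<forall>A \<in> Ob B. monoidal_coherence (fibre F A)))"

definition MonE :: "('b, 'f, 'o, 'm) monfib \<Rightarrow> (('o, 'm) mon, ('o, 'm) mon_ar) cat" where
  "MonE F = hom_cat (\<Union>B \<in> Ob (base F). monoids (fibre F B))
    (\<lambda>(R, m, e) (S, n, l). {h \<in> hom (tot F) R S.
       h \<cdot>\<^bsub>tot F\<^esub> m = n \<cdot>\<^bsub>tot F\<^esub> FA (ftens F) (h, h) \<and>
       h \<cdot>\<^bsub>tot F\<^esub> e = l \<cdot>\<^bsub>tot F\<^esub> FA (funit F) (FA (proj F) h)})
    (\<lambda>(R, m, e). Idn (tot F) R)
    (\<lambda>R S T h' h. h' \<cdot>\<^bsub>tot F\<^esub> h)"

definition ModE :: "('b, 'f, 'o, 'm) monfib \<Rightarrow> (('o, 'm) modl, ('o, 'm) modl_ar) cat" where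
  "ModE F = hom_cat {(R, M). R \<in> Ob (MonE F) \<and> M \<in> right_modules (fibre F (FO (proj F) (fst R))) R}
    (\<lambda>(R, M, k) (S, N, s). {(h, a). (R, h, S) \<in> Ar (MonE F) \<and> a \<in> hom (tot F) M N \<and>
       FA (proj F) h = FA (proj F) a \<and>
       a \<cdot>\<^bsub>tot F\<^esub> k = s \<cdot>\<^bsub>tot F\<^esub> FA (ftens F) (a, h)})
    (\<lambda>((R, m, e), (M, k)). (Idn (tot F) R, Idn (tot F) M))
    (\<lambda>x y z (h', a') (h, a). (h' \<cdot>\<^bsub>tot F\<^esub> h, a' \<cdot>\<^bsub>tot F\<^esub> a))"

definition MonE_proj :: "('b, 'f, 'o, 'm) monfib \<Rightarrow> (('o, 'm) mon, ('o, 'm) mon_ar, 'b, 'f) func" where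
  "MonE_proj F = \<lparr>FO = (\<lambda>R. FO (proj F) (fst R)), FA = (\<lambda>(R, h, S). FA (proj F) h)\<rparr>"

definition ModE_proj :: "('b, 'f, 'o, 'm) monfib \<Rightarrow> (('o, 'm) modl, ('o, 'm) modl_ar, 'b, 'f) func" where
  "ModE_proj F = comp_func (MonE_proj F) Mod_proj"

text \<open>The monoid structure on the source of a Cartesian arrow \<open>k\<close> over a monoid \<open>S\<close>, and the module
  structure on the source of a Cartesian arrow \<open>k'\<close> over an \<open>S\<close>-module \<open>N\<close>.\<close>

definition induced_monoid :: "('b, 'f, 'o, 'm) monfib \<Rightarrow> 'm \<Rightarrow> ('o, 'm) mon \<Rightarrow> ('o, 'm) mon" where
  "induced_monoid F k S = (THE R. fst R = Dom (tot F) k \<and> (R, k, S) \<in> Ar (MonE F))"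

definition induced_module :: "('b, 'f, 'o, 'm) monfib \<Rightarrow> 'm \<Rightarrow> 'm \<Rightarrow> ('o, 'm) mon \<Rightarrow> 'o \<times> 'm \<Rightarrow> 'o \<times> 'm" where
  "induced_module F k k' S N = (THE M. fst M = Dom (tot F) k' \<and>
     ((induced_monoid F k S, M), (k, k'), (S, N)) \<in> Ar (ModE F))"

text \<open>The unique arrow \<open>v\<close> over an identity with \<open>k \<cdot> v = h\<close>, for \<open>k\<close> Cartesian and \<open>h\<close> over the
  same arrow of the base.\<close>

definition vert_fact :: "('b, 'f, 'o, 'm) monfib \<Rightarrow> 'm \<Rightarrow> 'm \<Rightarrow> 'm" where
  "vert_fact F k h = (THE v. v \<in> hom (tot F) (Dom (tot F) h) (Dom (tot F) k) \<and>
     FA (proj F) v = Idn (base F) (FO (proj F) (Dom (tot F) h)) \<and> k \<cdot>\<^bsub>tot F\<^esub> v = h)"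


section \<open>The 2-category of monoidal categories, lax monoidal functors, monoidal transformations\<close>

record ('o, 'm, 'p, 'n) laxfunc = "('o, 'm, 'p, 'n) func" +
  lmul :: "'o \<Rightarrow> 'o \<Rightarrow> 'n"
  lunt :: 'n

definition lax_monoidal_functor :: "('o, 'm, 'z) moncat_scheme \<Rightarrow> ('p, 'n, 'y) moncat_scheme \<Rightarrow>
    ('o, 'm, 'p, 'n, 'w) laxfunc_scheme \<Rightarrow> bool" where
  "lax_monoidal_functor V W F \<longleftrightarrow> monoidal_category V \<and> monoidal_category W \<and> is_functor V W F \<and>
    nat_trans (prod_cat V V) W
      \<lparr>FO = (\<lambda>(X, Y). FO F X \<otimes>\<^bsub>W\<^esub> FO F Y), FA = (\<lambda>(f, g). FA F f \<odot>\<^bsub>W\<^esub> FA F g)\<rparr>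
      (comp_func F (tens V)) (\<lambda>(X, Y). lmul F X Y) \<and>
    lunt F \<in> hom W (munit W) (FO F (munit V)) \<and>
    (\<forall>X \<in> Ob V. \<forall>Y \<in> Ob V. \<forall>Z \<in> Ob V.
      FA F (massoc V X Y Z) \<cdot>\<^bsub>W\<^esub> lmul F (X \<otimes>\<^bsub>V\<^esub> Y) Z \<cdot>\<^bsub>W\<^esub> (lmul F X Y \<odot>\<^bsub>W\<^esub> Idn W (FO F Z)) =
      lmul F X (Y \<otimes>\<^bsub>V\<^esub> Z) \<cdot>\<^bsub>W\<^esub> (Idn W (FO F X) \<odot>\<^bsub>W\<^esub> lmul F Y Z)
        \<cdot>\<^bsub>W\<^esub> massoc W (FO F X) (FO F Y) (FO F Z)) \<and>
    (\<forall>X \<in> Ob V.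
      FA F (mlunit V X) \<cdot>\<^bsub>W\<^esub> lmul F (munit V) X \<cdot>\<^bsub>W\<^esub> (lunt F \<odot>\<^bsub>W\<^esub> Idn W (FO F X)) = mlunit W (FO F X) \<and>
      FA F (mrunit V X) \<cdot>\<^bsub>W\<^esub> lmul F X (munit V) \<cdot>\<^bsub>W\<^esub> (Idn W (FO F X) \<odot>\<^bsub>W\<^esub> lunt F) = mrunit W (FO F X))"

definition id_lax :: "('o, 'm, 'z) moncat_scheme \<Rightarrow> ('o, 'm, 'o, 'm) laxfunc" where
  "id_lax V = \<lparr>FO = (\<lambda>X. X), FA = (\<lambda>f. f), lmul = (\<lambda>X Y. Idn V (X \<otimes>\<^bsub>V\<^esub> Y)), lunt = Idn V (munit V)\<rparr>"

text \<open>The composite \<open>G \<circ> F\<close> of lax monoidal functors, for \<open>G\<close> with codomain \<open>W\<close>.\<close>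

definition comp_lax :: "('q, 'k, 'z) moncat_scheme \<Rightarrow> ('p, 'n, 'q, 'k, 'w) laxfunc_scheme \<Rightarrow>
    ('o, 'm, 'p, 'n, 'v) laxfunc_scheme \<Rightarrow> ('o, 'm, 'q, 'k) laxfunc" where
  "comp_lax W G F =
    \<lparr>FO = (\<lambda>X. FO G (FO F X)),
     FA = (\<lambda>f. FA G (FA F f)),
     lmul = (\<lambda>X Y. FA G (lmul F X Y) \<cdot>\<^bsub>W\<^esub> lmul G (FO F X) (FO F Y)),
     lunt = FA G (lunt F) \<cdot>\<^bsub>W\<^esub> lunt G\<rparr>"

definition monoidal_transformation :: "('o, 'm, 'z) moncat_scheme \<Rightarrow> ('p, 'n, 'y) moncat_scheme \<Rightarrow>
    ('o, 'm, 'p, 'n, 'w) laxfunc_scheme \<Rightarrow> ('o, 'm, 'p, 'n, 'v) laxfunc_scheme \<Rightarrow> ('o \<Rightarrow> 'n) \<Rightarrow> bool" where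
  "monoidal_transformation V W F G t \<longleftrightarrow>
    lax_monoidal_functor V W F \<and> lax_monoidal_functor V W G \<and> nat_trans V W F G t \<and>
    (\<forall>X \<in> Ob V. \<forall>Y \<in> Ob V. t (X \<otimes>\<^bsub>V\<^esub> Y) \<cdot>\<^bsub>W\<^esub> lmul F X Y = lmul G X Y \<cdot>\<^bsub>W\<^esub> (t X \<odot>\<^bsub>W\<^esub> t Y)) \<and>
    t (munit V) \<cdot>\<^bsub>W\<^esub> lunt F = lunt G"


section \<open>Indexed categories and the Grothendieck construction\<close>

text \<open>Data of a pseudo-functor on \<open>B\<^sup>o\<^sup>p\<close>, with values in categories (\<open>'c\<close>, \<open>'r\<close> being a type of
  categories and of functors) or in monoidal categories (\<open>'c\<close>, \<open>'r\<close> being a type of monoidal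
  categories and of lax monoidal functors). For \<open>f : A \<rightarrow> B\<close> and \<open>g : B \<rightarrow> C\<close>, \<open>ipc f g\<close> has type
  \<open>\<Phi>(f) \<circ> \<Phi>(g) \<Rightarrow> \<Phi>(g \<cdot> f)\<close>, and \<open>ipi A\<close> has type \<open>1 \<Rightarrow> \<Phi>(1\<^sub>A)\<close>.\<close>

record ('b, 'f, 'c, 'r, 'o, 'm) idx =
  ifib :: "'b \<Rightarrow> 'c"
  irei :: "'f \<Rightarrow> 'r"
  ipc :: "'f \<Rightarrow> 'f \<Rightarrow> 'o \<Rightarrow> 'm"
  ipi :: "'b \<Rightarrow> 'o \<Rightarrow> 'm"

type_synonym ('b, 'f, 'o, 'm) icat =
  "('b, 'f, ('o, 'm) cat, ('o, 'm, 'o, 'm) func, 'o, 'm) idx"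
type_synonym ('b, 'f, 'o, 'm) moncat_icat =
  "('b, 'f, ('o, 'm) moncat, ('o, 'm, 'o, 'm) laxfunc, 'o, 'm) idx"

definition indexed_category :: "('b, 'f, 'x) cat_scheme \<Rightarrow>
    ('b, 'f, ('o, 'm, 'z) cat_scheme, ('o, 'm, 'o, 'm, 'w) func_scheme, 'o, 'm) idx \<Rightarrow> bool" where
  "indexed_category B \<Phi> \<longleftrightarrow> category B \<and>
    (\<forall>A \<in> Ob B. category (ifib \<Phi> A)) \<and>
    (\<forall>f \<in> Ar B. is_functor (ifib \<Phi> (Cod B f)) (ifib \<Phi> (Dom B f)) (irei \<Phi> f)) \<and>
    (\<forall>f \<in> Ar B. \<forall>g \<in> Ar B. Cod B f = Dom B g \<longrightarrow>
      nat_iso (ifib \<Phi> (Cod B g)) (ifib \<Phi> (Dom B f))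
        (comp_func (irei \<Phi> f) (irei \<Phi> g)) (irei \<Phi> (g \<cdot>\<^bsub>B\<^esub> f)) (ipc \<Phi> f g)) \<and>
    (\<forall>A \<in> Ob B. nat_iso (ifib \<Phi> A) (ifib \<Phi> A) id_func (irei \<Phi> (Idn B A)) (ipi \<Phi> A)) \<and>
    (\<forall>f \<in> Ar B. \<forall>g \<in> Ar B. \<forall>h \<in> Ar B. Cod B f = Dom B g \<longrightarrow> Cod B g = Dom B h \<longrightarrow>
      (\<forall>X \<in> Ob (ifib \<Phi> (Cod B h)).
        ipc \<Phi> f (h \<cdot>\<^bsub>B\<^esub> g) X \<cdot>\<^bsub>ifib \<Phi> (Dom B f)\<^esub> FA (irei \<Phi> f) (ipc \<Phi> g h X) =
        ipc \<Phi> (g \<cdot>\<^bsub>B\<^esub> f) h X \<cdot>\<^bsub>ifib \<Phi> (Dom B f)\<^esub> ipc \<Phi> f g (FO (irei \<Phi> h) X))) \<and>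
    (\<forall>f \<in> Ar B. \<forall>X \<in> Ob (ifib \<Phi> (Cod B f)).
      ipc \<Phi> (Idn B (Dom B f)) f X \<cdot>\<^bsub>ifib \<Phi> (Dom B f)\<^esub> ipi \<Phi> (Dom B f) (FO (irei \<Phi> f) X) =
        Idn (ifib \<Phi> (Dom B f)) (FO (irei \<Phi> f) X) \<and>
      ipc \<Phi> f (Idn B (Cod B f)) X \<cdot>\<^bsub>ifib \<Phi> (Dom B f)\<^esub> FA (irei \<Phi> f) (ipi \<Phi> (Cod B f) X) =
        Idn (ifib \<Phi> (Dom B f)) (FO (irei \<Phi> f) X))"

definition monoidal_indexed_category :: "('b, 'f, 'x) cat_scheme \<Rightarrow> ('b, 'f, 'o, 'm) moncat_icat \<Rightarrow> bool" where
  "monoidal_indexed_category B \<Phi> \<longleftrightarrow> indexed_category B \<Phi> \<and>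
    (\<forall>A \<in> Ob B. monoidal_category (ifib \<Phi> A)) \<and>
    (\<forall>f \<in> Ar B. lax_monoidal_functor (ifib \<Phi> (Cod B f)) (ifib \<Phi> (Dom B f)) (irei \<Phi> f)) \<and>
    (\<forall>f \<in> Ar B. \<forall>g \<in> Ar B. Cod B f = Dom B g \<longrightarrow>
      monoidal_transformation (ifib \<Phi> (Cod B g)) (ifib \<Phi> (Dom B f))
        (comp_lax (ifib \<Phi> (Dom B f)) (irei \<Phi> f) (irei \<Phi> g)) (irei \<Phi> (g \<cdot>\<^bsub>B\<^esub> f)) (ipc \<Phi> f g)) \<and>
    (\<forall>A \<in> Ob B. monoidal_transformation (ifib \<Phi> A) (ifib \<Phi> A)
      (id_lax (ifib \<Phi> A)) (irei \<Phi> (Idn B A)) (ipi \<Phi> A))"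

definition grothendieck :: "('b, 'f, 'x) cat_scheme \<Rightarrow> ('b, 'f, 'o, 'm) icat \<Rightarrow>
    ('b \<times> 'o, ('b \<times> 'o) \<times> ('f \<times> 'm) \<times> ('b \<times> 'o)) cat" where
  "grothendieck B \<Phi> = hom_cat {(A, X). A \<in> Ob B \<and> X \<in> Ob (ifib \<Phi> A)}
    (\<lambda>(A, X) (A', Y). {(f, k). f \<in> hom B A A' \<and> k \<in> hom (ifib \<Phi> A) X (FO (irei \<Phi> f) Y)})
    (\<lambda>(A, X). (Idn B A, ipi \<Phi> A X))
    (\<lambda>(A, X) (A', Y) (A'', Z) (g, l) (f, k).
      (g \<cdot>\<^bsub>B\<^esub> f, ipc \<Phi> f g Z \<cdot>\<^bsub>ifib \<Phi> A\<^esub> FA (irei \<Phi> f) l \<cdot>\<^bsub>ifib \<Phi> A\<^esub> k))"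

definition grothendieck_proj :: "('b \<times> 'o, ('b \<times> 'o) \<times> ('f \<times> 'm) \<times> ('b \<times> 'o), 'b, 'f) func" where
  "grothendieck_proj = \<lparr>FO = fst, FA = (\<lambda>(x, (f, k), y). f)\<rparr>"

text \<open>The functor of Grothendieck constructions induced by a strict transformation with components
  \<open>\<tau> A\<close>.\<close>

definition grothendieck_map :: "('b \<Rightarrow> ('o, 'm, 'p, 'n) func) \<Rightarrow>
    ('b \<times> 'o, ('b \<times> 'o) \<times> ('f \<times> 'm) \<times> ('b \<times> 'o), 'b \<times> 'p, ('b \<times> 'p) \<times> ('f \<times> 'n) \<times> ('b \<times> 'p)) func" where
  "grothendieck_map \<tau> =
    \<lparr>FO = (\<lambda>(A, X). (A, FO (\<tau> A) X)),
     FA = (\<lambda>((A, X), (f, k), (A', Y)). ((A, FO (\<tau> A) X), (f, FA (\<tau> A) k), (A', FO (\<tau> A') Y)))\<rparr>"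


section \<open>Monoids and modules in a monoidal indexed category\<close>

text \<open>The functors \<open>Mon(F)\<close> and \<open>Mod(F)\<close> for a lax monoidal functor \<open>F\<close> with codomain \<open>W\<close>.\<close>

definition mon_ob :: "('p, 'n, 'y) moncat_scheme \<Rightarrow> ('o, 'm, 'p, 'n) laxfunc \<Rightarrow> ('o, 'm) mon \<Rightarrow> ('p, 'n) mon" where
  "mon_ob W F = (\<lambda>(R, m, e). (FO F R, FA F m \<cdot>\<^bsub>W\<^esub> lmul F R R, FA F e \<cdot>\<^bsub>W\<^esub> lunt F))"

definition mod_ob :: "('p, 'n, 'y) moncat_scheme \<Rightarrow> ('o, 'm, 'p, 'n) laxfunc \<Rightarrow> ('o, 'm) modl \<Rightarrow> ('p, 'n) modl" where
  "mod_ob W F = (\<lambda>(R, (M, k)). (mon_ob W F R, (FO F M, FA F k \<cdot>\<^bsub>W\<^esub> lmul F M (fst R))))"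

definition mon_func :: "('p, 'n, 'y) moncat_scheme \<Rightarrow> ('o, 'm, 'p, 'n) laxfunc \<Rightarrow>
    (('o, 'm) mon, ('o, 'm) mon_ar, ('p, 'n) mon, ('p, 'n) mon_ar) func" where
  "mon_func W F = \<lparr>FO = mon_ob W F, FA = (\<lambda>(R, h, S). (mon_ob W F R, FA F h, mon_ob W F S))\<rparr>"

definition mod_func :: "('p, 'n, 'y) moncat_scheme \<Rightarrow> ('o, 'm, 'p, 'n) laxfunc \<Rightarrow>
    (('o, 'm) modl, ('o, 'm) modl_ar, ('p, 'n) modl, ('p, 'n) modl_ar) func" where
  "mod_func W F =
    \<lparr>FO = mod_ob W F, FA = (\<lambda>(x, (h, a), y). (mod_ob W F x, (FA F h, FA F a), mod_ob W F y))\<rparr>"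

definition Mon_idx :: "('b, 'f, 'x) cat_scheme \<Rightarrow> ('b, 'f, 'o, 'm) moncat_icat \<Rightarrow>
    ('b, 'f, ('o, 'm) mon, ('o, 'm) mon_ar) icat" where
  "Mon_idx B \<Phi> =
    \<lparr>ifib = (\<lambda>A. Mon_cat (ifib \<Phi> A)),
     irei = (\<lambda>f. mon_func (ifib \<Phi> (Dom B f)) (irei \<Phi> f)),
     ipc = (\<lambda>f g R.
       (mon_ob (ifib \<Phi> (Dom B f)) (irei \<Phi> f) (mon_ob (ifib \<Phi> (Dom B g)) (irei \<Phi> g) R),
        ipc \<Phi> f g (fst R),
        mon_ob (ifib \<Phi> (Dom B f)) (irei \<Phi> (g \<cdot>\<^bsub>B\<^esub> f)) R)),
     ipi = (\<lambda>A R. (R, ipi \<Phi> A (fst R), mon_ob (ifib \<Phi> A) (irei \<Phi> (Idn B A)) R))\<rparr>"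

definition Mod_idx :: "('b, 'f, 'x) cat_scheme \<Rightarrow> ('b, 'f, 'o, 'm) moncat_icat \<Rightarrow>
    ('b, 'f, ('o, 'm) modl, ('o, 'm) modl_ar) icat" where
  "Mod_idx B \<Phi> =
    \<lparr>ifib = (\<lambda>A. Mod_cat (ifib \<Phi> A)),
     irei = (\<lambda>f. mod_func (ifib \<Phi> (Dom B f)) (irei \<Phi> f)),
     ipc = (\<lambda>f g x.
       (mod_ob (ifib \<Phi> (Dom B f)) (irei \<Phi> f) (mod_ob (ifib \<Phi> (Dom B g)) (irei \<Phi> g) x),
        (ipc \<Phi> f g (fst (fst x)), ipc \<Phi> f g (fst (snd x))),
        mod_ob (ifib \<Phi> (Dom B f)) (irei \<Phi> (g \<cdot>\<^bsub>B\<^esub> f)) x)),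
     ipi = (\<lambda>A x. (x, (ipi \<Phi> A (fst (fst x)), ipi \<Phi> A (fst (snd x))),
        mod_ob (ifib \<Phi> A) (irei \<Phi> (Idn B A)) x))\<rparr>"

definition Mon_Phi :: "('b, 'f, 'x) cat_scheme \<Rightarrow> ('b, 'f, 'o, 'm) moncat_icat \<Rightarrow>
    ('b \<times> ('o, 'm) mon, ('b \<times> ('o, 'm) mon) \<times> ('f \<times> ('o, 'm) mon_ar) \<times> ('b \<times> ('o, 'm) mon)) cat" where
  "Mon_Phi B \<Phi> = grothendieck B (Mon_idx B \<Phi>)"

definition Mod_Phi :: "('b, 'f, 'x) cat_scheme \<Rightarrow> ('b, 'f, 'o, 'm) moncat_icat \<Rightarrow>
    ('b \<times> ('o, 'm) modl, ('b \<times> ('o, 'm) modl) \<times> ('f \<times> ('o, 'm) modl_ar) \<times> ('b \<times> ('o, 'm) modl)) cat" where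
  "Mod_Phi B \<Phi> = grothendieck B (Mod_idx B \<Phi>)"

definition Mod_Phi_proj :: "('b \<times> ('o, 'm) modl, ('b \<times> ('o, 'm) modl) \<times> ('f \<times> ('o, 'm) modl_ar) \<times> ('b \<times> ('o, 'm) modl),
    'b \<times> ('o, 'm) mon, ('b \<times> ('o, 'm) mon) \<times> ('f \<times> ('o, 'm) mon_ar) \<times> ('b \<times> ('o, 'm) mon)) func" where
  "Mod_Phi_proj = grothendieck_map (\<lambda>A. Mod_proj)"

text \<open>The monoidal indexed category determined by a cleavage \<open>c\<close>, all of whose structure is obtained
  by factoring through the chosen Cartesian lifts.\<close>

definition inv_image :: "('b, 'f, 'o, 'm) monfib \<Rightarrow> ('f \<Rightarrow> 'o \<Rightarrow> 'm) \<Rightarrow> 'f \<Rightarrow> ('o, 'm, 'o, 'm) laxfunc" where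
  "inv_image F c f =
    \<lparr>FO = (\<lambda>X. Dom (tot F) (c f X)),
     FA = (\<lambda>k. vert_fact F (c f (Cod (tot F) k)) (k \<cdot>\<^bsub>tot F\<^esub> c f (Dom (tot F) k))),
     lmul = (\<lambda>X Y. vert_fact F (c f (FO (ftens F) (X, Y))) (FA (ftens F) (c f X, c f Y))),
     lunt = vert_fact F (c f (FO (funit F) (Cod (base F) f))) (FA (funit F) f)\<rparr>"

definition Phi_P :: "('b, 'f, 'o, 'm) monfib \<Rightarrow> ('f \<Rightarrow> 'o \<Rightarrow> 'm) \<Rightarrow> ('b, 'f, 'o, 'm) moncat_icat" where
  "Phi_P F c =
    \<lparr>ifib = fibre F,
     irei = inv_image F c,
     ipc = (\<lambda>f g Z. vert_fact F (c (g \<cdot>\<^bsub>base F\<^esub> f) Z)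
        (c g Z \<cdot>\<^bsub>tot F\<^esub> c f (Dom (tot F) (c g Z)))),
     ipi = (\<lambda>A X. vert_fact F (c (Idn (base F) A) X) (Idn (tot F) X))\<rparr>"

end

theory Submission
  imports Defs
begin

text \<open>Everything rests on one principle. An arrow \<open>v\<close> into the source of a Cartesian arrow \<open>k\<close> is
  determined by its image in the base and by \<open>k \<cdot> v\<close>, so an equation between two such arrows may be
  checked after composing with \<open>k\<close>. The tensor product, the unit and the structural isomorphisms live
  on the whole of \<open>E\<close>, not only on the fibres; hence the check consists of moving \<open>k\<close> through the
  structure by functoriality and naturality, until the law known on the target of \<open>k\<close> applies.

  Used on laws, this principle shows that a structure map \<open>r\<close> with \<open>k \<cdot> r = s \<cdot> (k \<otimes> h)\<close> inherits from
  \<open>s\<close> the axioms of an action (\<open>module_laws_lift\<close>), and, as a monoid is a module over itself, the axioms of a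
  monoid (\<open>monoid_laws_lift\<close>). Used on compatibility with actions (\<open>action_factor\<close>), it shows that
  factorisations through such lifts are again arrows of monoids and of modules. So a lift of \<open>(S, N)\<close> along a
  morphism \<open>h : R \<rightarrow> S\<close> of monoids is Cartesian as soon as its module component \<open>k\<close> is Cartesian in \<open>E\<close>
  (\<open>mod_cartesian\<close>). A horizontal lift is the case in which \<open>h\<close> is Cartesian as well, and restriction of
  scalars is the case in which \<open>k\<close> is an identity; the lift along a general morphism is the composite of
  the two. This is the first claim.

  For the second claim, the fibres of the categories of monoids and of modules over an object \<open>A\<close> of the base
  are equal to the categories of monoids and of modules in the fibre over \<open>A\<close>, since \<open>u\<close> sends the identity of
  \<open>A\<close> to an identity.

  For the third claim, any choice of Cartesian lifts of \<open>f\<close> equips the inverse image along \<open>f\<close> with a lax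
  monoidal structure, and any two choices are related by a unique vertical comparison, which is monoidal. The
  inverse images along composites and identities, and the composites and identities of inverse images, all come
  from such choices; this yields the monoidal indexed category. An arrow of the Grothendieck construction of its
  monoids is a morphism \<open>f\<close> of the base with a vertical morphism \<open>h\<close> into the inverse image, and
  corresponds to the composite of \<open>h\<close> with the chosen lift; Cartesianness makes this a bijection, compatible
  with composition. The same holds for modules. The category and fibration structures of the Grothendieck
  constructions are then transported along these bijections.\<close>

section \<open>Categories and Cartesian arrows\<close>

lemma homI: "f \<in> Ar C \<Longrightarrow> Dom C f = X \<Longrightarrow> Cod C f = Y \<Longrightarrow> f \<in> hom C X Y"
  by (simp add: hom_def)

lemma homD: "f \<in> hom C X Y \<Longrightarrow> f \<in> Ar C \<and> Dom C f = X \<and> Cod C f = Y"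
  by (simp add: hom_def)

lemma category_simps [simp]:
  assumes "category C"
  shows "f \<in> Ar C \<Longrightarrow> Dom C f \<in> Ob C"
    and "f \<in> Ar C \<Longrightarrow> Cod C f \<in> Ob C"
    and "X \<in> Ob C \<Longrightarrow> Idn C X \<in> Ar C"
    and "X \<in> Ob C \<Longrightarrow> Dom C (Idn C X) = X"
    and "X \<in> Ob C \<Longrightarrow> Cod C (Idn C X) = X"
    and "f \<in> Ar C \<Longrightarrow> g \<in> Ar C \<Longrightarrow> Cod C f = Dom C g \<Longrightarrow> g \<cdot>\<^bsub>C\<^esub> f \<in> Ar C"
    and "f \<in> Ar C \<Longrightarrow> g \<in> Ar C \<Longrightarrow> Cod C f = Dom C g \<Longrightarrow> Dom C (g \<cdot>\<^bsub>C\<^esub> f) = Dom C f"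
    and "f \<in> Ar C \<Longrightarrow> g \<in> Ar C \<Longrightarrow> Cod C f = Dom C g \<Longrightarrow> Cod C (g \<cdot>\<^bsub>C\<^esub> f) = Cod C g"
    and "f \<in> Ar C \<Longrightarrow> Dom C f = X \<Longrightarrow> f \<cdot>\<^bsub>C\<^esub> Idn C X = f"
    and "f \<in> Ar C \<Longrightarrow> Cod C f = X \<Longrightarrow> Idn C X \<cdot>\<^bsub>C\<^esub> f = f"
    and "f \<in> Ar C \<Longrightarrow> g \<in> Ar C \<Longrightarrow> h \<in> Ar C \<Longrightarrow> Cod C f = Dom C g \<Longrightarrow> Cod C g = Dom C h \<Longrightarrow>
      (h \<cdot>\<^bsub>C\<^esub> g) \<cdot>\<^bsub>C\<^esub> f = h \<cdot>\<^bsub>C\<^esub> (g \<cdot>\<^bsub>C\<^esub> f)"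
  using assms unfolding category_def hom_def by blast+

lemma functor_simps:
  assumes "is_functor C D F"
  shows "category C" and "category D"
    and "X \<in> Ob C \<Longrightarrow> FO F X \<in> Ob D"
    and "f \<in> Ar C \<Longrightarrow> FA F f \<in> Ar D"
    and "f \<in> Ar C \<Longrightarrow> Dom D (FA F f) = FO F (Dom C f)"
    and "f \<in> Ar C \<Longrightarrow> Cod D (FA F f) = FO F (Cod C f)"
    and "X \<in> Ob C \<Longrightarrow> FA F (Idn C X) = Idn D (FO F X)"
    and "f \<in> Ar C \<Longrightarrow> g \<in> Ar C \<Longrightarrow> Cod C f = Dom C g \<Longrightarrow>
      FA F (g \<cdot>\<^bsub>C\<^esub> f) = FA F g \<cdot>\<^bsub>D\<^esub> FA F f"
  using assms unfolding is_functor_def hom_def by blast+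

lemma category_hom_cat:
  assumes C: "C = hom_cat obs H i c"
    and "\<And>X. X \<in> Ob C \<Longrightarrow> (X, i X, X) \<in> Ar C"
    and "\<And>X Y Z f g. (X, f, Y) \<in> Ar C \<Longrightarrow> (Y, g, Z) \<in> Ar C \<Longrightarrow> (X, c X Y Z g f, Z) \<in> Ar C"
    and "\<And>X Y f. (X, f, Y) \<in> Ar C \<Longrightarrow> c X X Y f (i X) = f \<and> c X Y Y (i Y) f = f"
    and "\<And>X Y Z W f g h. (X, f, Y) \<in> Ar C \<Longrightarrow> (Y, g, Z) \<in> Ar C \<Longrightarrow> (Z, h, W) \<in> Ar C \<Longrightarrow>
      c X Y W (c Y Z W h g) f = c X Z W h (c X Y Z g f)"
  shows "category C"
  using assms(2-) unfolding category_def C hom_cat_def hom_def by auto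

lemma hom_cat_simps:
  "Ob (hom_cat obs H i c) = obs"
  "(X, f, Y) \<in> Ar (hom_cat obs H i c) \<longleftrightarrow> X \<in> obs \<and> Y \<in> obs \<and> f \<in> H X Y"
  "Dom (hom_cat obs H i c) = fst" "Cod (hom_cat obs H i c) x = snd (snd x)"
  "Idn (hom_cat obs H i c) X = (X, i X, X)"
  "(Y', g, Z) \<cdot>\<^bsub>hom_cat obs H i c\<^esub> (X, f, Y) = (X, c X Y Z g f, Z)"
  by (auto simp: hom_cat_def fun_eq_iff case_prod_unfold)

lemma category_prod_cat: "category C \<Longrightarrow> category D \<Longrightarrow> category (prod_cat C D)"
  unfolding category_def prod_cat_def by (auto simp: hom_def)

lemma nat_iso_cong:
  assumes "FO G = FO G'" "FA G = FA G'" "FO H = FO H'" "FA H = FA H'"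
  shows "nat_iso C D G H t \<longleftrightarrow> nat_iso C D G' H' t"
  using assms by (simp add: nat_iso_def nat_trans_def is_functor_def)

text \<open>A monoid is a right module over itself: associativity and the right unit law are the module
  axioms for the multiplication, and only the left unit law is added.\<close>

lemma monoids_iff:
  "(R, m, e) \<in> monoids V \<longleftrightarrow> e \<in> hom V (munit V) R \<and> (R, m) \<in> right_modules V (R, m, e) \<and>
     m \<cdot>\<^bsub>V\<^esub> (e \<odot>\<^bsub>V\<^esub> Idn V R) = mlunit V R"
  by (auto simp: monoids_def right_modules_def)

lemma cartesian_factor:
  assumes "cartesian E B P k" "h \<in> Ar E" "w \<in> Ar B" "Dom B w = FO P (Dom E h)"
    "Cod B w = FO P (Dom E k)" "Cod E h = Cod E k" "FA P k \<cdot>\<^bsub>B\<^esub> w = FA P h"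
  obtains v where "v \<in> Ar E" "Dom E v = Dom E h" "Cod E v = Dom E k" "FA P v = w" "k \<cdot>\<^bsub>E\<^esub> v = h"
proof -
  have "\<exists>!v. v \<in> hom E (Dom E h) (Dom E k) \<and> FA P v = w \<and> k \<cdot>\<^bsub>E\<^esub> v = h"
    using assms homI[of w B] unfolding cartesian_def by blast
  then show ?thesis using that homD by (metis (no_types, lifting))
qed

lemma cartesian_cancel:
  assumes P: "is_functor E B P" and k: "cartesian E B P k"
    and v: "v \<in> hom E X (Dom E k)" "v' \<in> hom E X (Dom E k)"
    and eq: "FA P v = FA P v'" "k \<cdot>\<^bsub>E\<^esub> v = k \<cdot>\<^bsub>E\<^esub> v'"
  shows "v = v'"
proof -
  note [simp] = functor_simps[OF P]
  have kAr: "k \<in> Ar E" using k by (simp add: cartesian_def)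
  have "\<exists>!u. u \<in> hom E (Dom E (k \<cdot>\<^bsub>E\<^esub> v)) (Dom E k) \<and> FA P u = FA P v \<and> k \<cdot>\<^bsub>E\<^esub> u = k \<cdot>\<^bsub>E\<^esub> v"
    by (rule k[unfolded cartesian_def, THEN conjunct2, rule_format]) (use kAr v in \<open>auto simp: hom_def\<close>)
  moreover have "Dom E (k \<cdot>\<^bsub>E\<^esub> v) = X"
    using kAr v by (auto simp: hom_def)
  ultimately show ?thesis using v eq by metis
qed

lemma cartesian_comp:
  assumes P: "is_functor E B P" and k: "cartesian E B P k" and l: "cartesian E B P l"
    and kl: "Cod E l = Dom E k"
  shows "cartesian E B P (k \<cdot>\<^bsub>E\<^esub> l)"
proof -
  note [simp] = functor_simps[OF P]
  have Ar: "k \<in> Ar E" "l \<in> Ar E" using k l by (simp_all add: cartesian_def)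
  show ?thesis unfolding cartesian_def
  proof (intro conjI ballI impI)
    show "k \<cdot>\<^bsub>E\<^esub> l \<in> Ar E" using Ar kl by simp
    fix h w assume h: "h \<in> Ar E" "w \<in> hom B (FO P (Dom E h)) (FO P (Dom E (k \<cdot>\<^bsub>E\<^esub> l)))"
      "Cod E h = Cod E (k \<cdot>\<^bsub>E\<^esub> l)" "FA P (k \<cdot>\<^bsub>E\<^esub> l) \<cdot>\<^bsub>B\<^esub> w = FA P h"
    have w: "w \<in> Ar B" "Dom B w = FO P (Dom E h)" "Cod B w = FO P (Dom E l)"
      using h(2) Ar kl by (auto simp: hom_def)
    obtain u where u: "u \<in> Ar E" "Dom E u = Dom E h" "Cod E u = Dom E k"
      "FA P u = FA P l \<cdot>\<^bsub>B\<^esub> w" "k \<cdot>\<^bsub>E\<^esub> u = h"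
      by (rule cartesian_factor[OF k h(1), of "FA P l \<cdot>\<^bsub>B\<^esub> w"]) (use h(3,4) Ar kl w in simp_all)
    obtain v where v: "v \<in> Ar E" "Dom E v = Dom E h" "Cod E v = Dom E l"
      "FA P v = w" "l \<cdot>\<^bsub>E\<^esub> v = u"
      by (rule cartesian_factor[OF l u(1), of w]) (use u w kl Ar in simp_all)
    show "\<exists>!v. v \<in> hom E (Dom E h) (Dom E (k \<cdot>\<^bsub>E\<^esub> l)) \<and> FA P v = w \<and> k \<cdot>\<^bsub>E\<^esub> l \<cdot>\<^bsub>E\<^esub> v = h"
    proof (rule ex1I[of _ v])
      show "v \<in> hom E (Dom E h) (Dom E (k \<cdot>\<^bsub>E\<^esub> l)) \<and> FA P v = w \<and> k \<cdot>\<^bsub>E\<^esub> l \<cdot>\<^bsub>E\<^esub> v = h"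
        using u v Ar kl by (auto simp: hom_def)
      fix v' assume "v' \<in> hom E (Dom E h) (Dom E (k \<cdot>\<^bsub>E\<^esub> l)) \<and> FA P v' = w \<and> k \<cdot>\<^bsub>E\<^esub> l \<cdot>\<^bsub>E\<^esub> v' = h"
      then have v': "v' \<in> Ar E" "Dom E v' = Dom E h" "Cod E v' = Dom E l" "FA P v' = w"
        "k \<cdot>\<^bsub>E\<^esub> (l \<cdot>\<^bsub>E\<^esub> v') = h"
        using Ar kl by (auto simp: hom_def)
      have v'u: "l \<cdot>\<^bsub>E\<^esub> v' = u"
        by (rule cartesian_cancel[OF P k, where X = "Dom E h"]) (use u v' Ar kl in \<open>auto simp: hom_def\<close>)
      show "v' = v"
        by (rule cartesian_cancel[OF P l, where X = "Dom E h"]) (use v v' v'u in \<open>auto simp: hom_def\<close>)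
    qed
  qed
qed

lemma cartesian_Idn:
  assumes "is_functor E B P" "X \<in> Ob E"
  shows "cartesian E B P (Idn E X)"
  unfolding cartesian_def
proof (intro conjI ballI impI)
  note [simp] = functor_simps[OF assms(1)]
  show "Idn E X \<in> Ar E" using assms by simp
  fix h w assume h: "h \<in> Ar E" "w \<in> hom B (FO P (Dom E h)) (FO P (Dom E (Idn E X)))"
    "Cod E h = Cod E (Idn E X)" "FA P (Idn E X) \<cdot>\<^bsub>B\<^esub> w = FA P h"
  then have "w = FA P h" using assms by (simp add: hom_def)
  then show "\<exists>!v. v \<in> hom E (Dom E h) (Dom E (Idn E X)) \<and> FA P v = w \<and> Idn E X \<cdot>\<^bsub>E\<^esub> v = h"
    using h assms by (intro ex1I[of _ h]) (auto simp: hom_def)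
qed

text \<open>A base arrow is lifted in two steps, first through \<open>p k\<close> to an arrow of \<open>N\<close>, then through \<open>k\<close> to an
  arrow of \<open>M\<close>.\<close>

lemma cartesian_over:
  assumes p: "is_functor M N p" and q: "is_functor N B q"
    and k: "cartesian M N p k" and pk: "cartesian N B q (FA p k)"
  shows "cartesian M B (comp_func q p) k"
  unfolding cartesian_def
proof (intro conjI ballI impI)
  note [simp] = functor_simps[OF p] functor_simps[OF q]
  show kAr: "k \<in> Ar M" using k by (simp add: cartesian_def)
  fix h w
  assume h: "h \<in> Ar M" "w \<in> hom B (FO (comp_func q p) (Dom M h)) (FO (comp_func q p) (Dom M k))"
    "Cod M h = Cod M k" "FA (comp_func q p) k \<cdot>\<^bsub>B\<^esub> w = FA (comp_func q p) h"
  then have w: "w \<in> Ar B" "Dom B w = FO q (FO p (Dom M h))" "Cod B w = FO q (FO p (Dom M k))"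
    "FA q (FA p k) \<cdot>\<^bsub>B\<^esub> w = FA q (FA p h)"
    by (auto simp: hom_def comp_func_def)
  obtain u where u: "u \<in> Ar N" "Dom N u = Dom N (FA p h)" "Cod N u = Dom N (FA p k)" "FA q u = w"
    "FA p k \<cdot>\<^bsub>N\<^esub> u = FA p h"
    by (rule cartesian_factor[OF pk, of "FA p h" w]) (use h(1,3) w kAr in simp_all)
  obtain v where v: "v \<in> Ar M" "Dom M v = Dom M h" "Cod M v = Dom M k" "FA p v = u" "k \<cdot>\<^bsub>M\<^esub> v = h"
    by (rule cartesian_factor[OF k h(1), of u]) (use h(1,3) u kAr in simp_all)
  show "\<exists>!v. v \<in> hom M (Dom M h) (Dom M k) \<and> FA (comp_func q p) v = w \<and> k \<cdot>\<^bsub>M\<^esub> v = h"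
  proof (rule ex1I[of _ v])
    show "v \<in> hom M (Dom M h) (Dom M k) \<and> FA (comp_func q p) v = w \<and> k \<cdot>\<^bsub>M\<^esub> v = h"
      using v u by (simp add: hom_def comp_func_def)
    fix v' assume "v' \<in> hom M (Dom M h) (Dom M k) \<and> FA (comp_func q p) v' = w \<and> k \<cdot>\<^bsub>M\<^esub> v' = h"
    then have v': "v' \<in> Ar M" "Dom M v' = Dom M h" "Cod M v' = Dom M k" "FA q (FA p v') = w" "k \<cdot>\<^bsub>M\<^esub> v' = h"
      by (auto simp: hom_def comp_func_def)
    have eq: "FA p k \<cdot>\<^bsub>N\<^esub> FA p v' = FA p h"
      using functor_simps(8)[OF p v'(1) kAr v'(3)] v'(5) by simp
    have v'u: "FA p v' = u"
      by (rule cartesian_cancel[OF q pk, of _ "FO p (Dom M h)"]) (use u v' kAr h(1) eq in \<open>auto simp: hom_def\<close>)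
    show "v' = v"
      by (rule cartesian_cancel[OF p k, of _ "Dom M h"]) (use v v' v'u in \<open>auto simp: hom_def\<close>)
  qed
qed

section \<open>Transport and fibres of fibrations\<close>

text \<open>A bijection on objects and arrows transports the category structure: if the identities and
  composites of \<open>C\<close> are the ones obtained from those of \<open>D\<close>, then the axioms for \<open>C\<close> are inherited. For
  a Grothendieck construction this replaces a direct verification from the coherence laws of the indexed
  category.\<close>

lemma cat_isomorphismI:
  assumes D: "category D"
    and KO: "\<And>X. X \<in> Ob C \<Longrightarrow> FO K X \<in> Ob D \<and> GO (FO K X) = X"
    and GO: "\<And>Y. Y \<in> Ob D \<Longrightarrow> GO Y \<in> Ob C \<and> FO K (GO Y) = Y"
    and KA: "\<And>f. f \<in> Ar C \<Longrightarrow> Dom C f \<in> Ob C \<and> Cod C f \<in> Ob C \<and>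
        FA K f \<in> hom D (FO K (Dom C f)) (FO K (Cod C f)) \<and> GA (FA K f) = f"
    and GA: "\<And>g. g \<in> Ar D \<Longrightarrow> GA g \<in> Ar C \<and> FA K (GA g) = g"
    and Id: "\<And>X. X \<in> Ob C \<Longrightarrow> Idn C X = GA (Idn D (FO K X))"
    and Co: "\<And>f g. f \<in> Ar C \<Longrightarrow> g \<in> Ar C \<Longrightarrow> Cod C f = Dom C g \<Longrightarrow>
        g \<cdot>\<^bsub>C\<^esub> f = GA (FA K g \<cdot>\<^bsub>D\<^esub> FA K f)"
  shows "cat_isomorphism C D K"
proof -
  note [simp] = D
  have KA': "FA K f \<in> Ar D" "Dom D (FA K f) = FO K (Dom C f)" "Cod D (FA K f) = FO K (Cod C f)"
    "GA (FA K f) = f" "Dom C f \<in> Ob C" "Cod C f \<in> Ob C" if "f \<in> Ar C" for f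
    using KA[OF that] by (auto simp: hom_def)
  have GA': "GA g \<in> Ar C" "FA K (GA g) = g" "Dom C (GA g) = GO (Dom D g)"
    "Cod C (GA g) = GO (Cod D g)" if "g \<in> Ar D" for g
    using GA[OF that] KA'[of "GA g"] KO by metis+
  note [simp] = KA' GA' Id Co KO GO
  have C: "category C"
    unfolding category_def by (auto simp: hom_def)
  have K: "is_functor C D K"
    using C unfolding is_functor_def by (auto simp: hom_def)
  have G: "is_functor D C \<lparr>FO = GO, FA = GA\<rparr>"
    using C unfolding is_functor_def by (auto simp: hom_def)
  show "cat_isomorphism C D K"
    unfolding cat_isomorphism_def
    by (intro conjI K exI[of _ "\<lparr>FO = GO, FA = GA\<rparr>"] G) (auto simp: func_eq_def comp_func_def id_func_def)
qed

lemma cat_isomorphism_id: "category C \<Longrightarrow> cat_isomorphism C C id_func"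
  unfolding cat_isomorphism_def
  by (intro conjI exI[of _ id_func]) (auto simp: is_functor_def func_eq_def comp_func_def id_func_def hom_def)

lemma cat_isomorphismE:
  fixes C :: "('o, 'm, 'z) cat_scheme" and D :: "('p, 'n, 'y) cat_scheme"
  assumes "cat_isomorphism C D K"
  obtains G :: "('p, 'n, 'o, 'm) func" where "is_functor C D K" "is_functor D C G"
    "\<forall>X \<in> Ob C. FO G (FO K X) = X" "\<forall>f \<in> Ar C. FA G (FA K f) = f"
    "\<forall>X \<in> Ob D. FO K (FO G X) = X" "\<forall>f \<in> Ar D. FA K (FA G f) = f"
proof -
  obtain G :: "('p, 'n, 'o, 'm) func" where "is_functor C D K" "is_functor D C G" "func_eq C (comp_func G K) id_func"
    "func_eq D (comp_func K G) id_func"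
    using assms unfolding cat_isomorphism_def by blast
  then show ?thesis by (intro that[of G]) (simp_all add: func_eq_def comp_func_def id_func_def)
qed

text \<open>The Cartesian lifts are the images, under the inverse of \<open>K\<close>, of those of \<open>p'\<close>. Functoriality of
  \<open>p\<close> is part of the conclusion: it holds because \<open>L\<close> is injective and \<open>p'\<close> and \<open>K\<close> are functors.\<close>

lemma fibration_transport:
  fixes M :: "('o, 'm, 'z) cat_scheme" and N :: "('p, 'n, 'y) cat_scheme"
    and M' :: "('o2, 'm2, 'z2) cat_scheme" and N' :: "('p2, 'n2, 'y2) cat_scheme"
  assumes K: "cat_isomorphism M M' K" and L: "cat_isomorphism N N' L"
    and sq: "func_eq M (comp_func p' K) (comp_func L p)"
    and pO: "\<And>X. X \<in> Ob M \<Longrightarrow> FO p X \<in> Ob N" and pA: "\<And>f. f \<in> Ar M \<Longrightarrow> FA p f \<in> Ar N"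
    and p': "fibration M' N' p'"
  shows "fibration M N p"
proof -
  obtain G :: "('o2, 'm2, 'o, 'm) func" where KF: "is_functor M M' K" and GF: "is_functor M' M G"
    and GK: "\<forall>X \<in> Ob M. FO G (FO K X) = X" "\<forall>f \<in> Ar M. FA G (FA K f) = f"
    and KG: "\<forall>X \<in> Ob M'. FO K (FO G X) = X" "\<forall>f \<in> Ar M'. FA K (FA G f) = f"
    by (rule cat_isomorphismE[OF K])
  obtain H :: "('p2, 'n2, 'p, 'n) func" where LF: "is_functor N N' L" and HF: "is_functor N' N H"
    and HL: "\<forall>X \<in> Ob N. FO H (FO L X) = X" "\<forall>f \<in> Ar N. FA H (FA L f) = f"
    by (rule cat_isomorphismE[OF L])
  have pF': "is_functor M' N' p'" using p' by (simp add: fibration_def)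
  have Lp: "FO L (FO p X) = FO p' (FO K X)" if "X \<in> Ob M" for X
    using sq that by (simp add: func_eq_def comp_func_def)
  have LpA: "FA L (FA p f) = FA p' (FA K f)" if "f \<in> Ar M" for f
    using sq that by (simp add: func_eq_def comp_func_def)
  note [simp] = functor_simps[OF KF] functor_simps[OF LF] functor_simps[OF pF'] pO pA Lp LpA
  have injO: "X = Y" if "FO L X = FO L Y" "X \<in> Ob N" "Y \<in> Ob N" for X Y using that HL by metis
  have injA: "x = y" if "FA L x = FA L y" "x \<in> Ar N" "y \<in> Ar N" for x y using that HL by metis
  have injK: "X = Y" if "FO K X = FO K Y" "X \<in> Ob M" "Y \<in> Ob M" for X Y using that GK by metis
  have injKA: "x = y" if "FA K x = FA K y" "x \<in> Ar M" "y \<in> Ar M" for x y using that GK by metis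
  have pD: "Dom N (FA p f) = FO p (Dom M f)" and pC: "Cod N (FA p f) = FO p (Cod M f)"
    if "f \<in> Ar M" for f
  proof -
    have "FO L (Dom N (FA p f)) = Dom N' (FA L (FA p f))" "FO L (Cod N (FA p f)) = Cod N' (FA L (FA p f))"
      using that functor_simps(5,6)[OF LF pA[OF that]] by metis+
    then show "Dom N (FA p f) = FO p (Dom M f)" and "Cod N (FA p f) = FO p (Cod M f)"
      using that by (auto intro!: injO)
  qed
  note [simp] = pD pC
  have pI: "FA p (Idn M X) = Idn N (FO p X)" if "X \<in> Ob M" for X
    by (rule injA) (use that in simp_all)
  have pC: "FA p (g \<cdot>\<^bsub>M\<^esub> f) = FA p g \<cdot>\<^bsub>N\<^esub> FA p f" if "f \<in> Ar M" "g \<in> Ar M" "Cod M f = Dom M g" for f g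
    by (rule injA) (use that in simp_all)
  have pF: "is_functor M N p"
    unfolding is_functor_def using pI pC by (simp add: hom_def)
  show ?thesis unfolding fibration_def
  proof (intro conjI pF ballI impI)
    fix f Y assume f: "f \<in> Ar N" and Y: "Y \<in> Ob M" "FO p Y = Cod N f"
    have "FO p' (FO K Y) = Cod N' (FA L f)" using Y f Lp[of Y] by simp
    moreover have "FA L f \<in> Ar N'" "FO K Y \<in> Ob M'" using Y f by simp_all
    ultimately obtain k' where "cartesian_lift M' N' p' (FA L f) (FO K Y) k'"
      using p' unfolding fibration_def by blast
    then have k': "cartesian M' N' p' k'" "FA p' k' = FA L f" "Cod M' k' = FO K Y" "k' \<in> Ar M'"
      by (auto simp: cartesian_lift_def cartesian_def)
    define k where "k = FA G k'"
    have k: "k \<in> Ar M" "FA K k = k'" using k'(4) functor_simps[OF GF] KG by (simp_all add: k_def)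
    have cod: "Cod M k = Y"
      by (rule injK) (use k k' Y functor_simps(6)[OF KF k(1)] in simp_all)
    have dom: "FO K (Dom M k) = Dom M' k'"
      using k functor_simps(5)[OF KF k(1)] by simp
    have pk: "FA p k = f"
      by (rule injA) (use k k' f in simp_all)
    have "cartesian M N p k" unfolding cartesian_def
    proof (intro conjI ballI impI k(1))
      fix h w assume h: "h \<in> Ar M" "w \<in> hom N (FO p (Dom M h)) (FO p (Dom M k))"
        "Cod M h = Cod M k" "FA p k \<cdot>\<^bsub>N\<^esub> w = FA p h"
      have w: "w \<in> Ar N" "Dom N w = FO p (Dom M h)" "Cod N w = FO p (Dom M k)"
        using h(2) by (auto simp: hom_def)
      have "FA p' k' \<cdot>\<^bsub>N'\<^esub> FA L w = FA L (FA p k \<cdot>\<^bsub>N\<^esub> w)"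
        using w k h(1) by simp
      then have eq: "FA p' k' \<cdot>\<^bsub>N'\<^esub> FA L w = FA p' (FA K h)"
        using h(1,4) by simp
      obtain v' where v': "v' \<in> Ar M'" "Dom M' v' = Dom M' (FA K h)" "Cod M' v' = Dom M' k'"
          "FA p' v' = FA L w" "k' \<cdot>\<^bsub>M'\<^esub> v' = FA K h"
        by (rule cartesian_factor[OF k'(1), of "FA K h" "FA L w"]) (use w h(1,3) k cod k'(3) dom eq in simp_all)
      define v where "v = FA G v'"
      have v: "v \<in> Ar M" "FA K v = v'" using v'(1) functor_simps[OF GF] KG by (simp_all add: v_def)
      have v2: "Dom M v = Dom M h" "Cod M v = Dom M k"
        using v v' h(1) k dom functor_simps(5,6)[OF KF v(1)] by (simp_all add: injK)
      have v3: "FA p v = w"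
        by (rule injA) (use v v' w in simp_all)
      have v4: "k \<cdot>\<^bsub>M\<^esub> v = h"
        by (rule injKA) (use v v2 v' k h in simp_all)
      show "\<exists>!v. v \<in> hom M (Dom M h) (Dom M k) \<and> FA p v = w \<and> k \<cdot>\<^bsub>M\<^esub> v = h"
      proof (rule ex1I[of _ v])
        show "v \<in> hom M (Dom M h) (Dom M k) \<and> FA p v = w \<and> k \<cdot>\<^bsub>M\<^esub> v = h"
          using v v2 v3 v4 by (simp add: hom_def)
        fix u assume u: "u \<in> hom M (Dom M h) (Dom M k) \<and> FA p u = w \<and> k \<cdot>\<^bsub>M\<^esub> u = h"
        then have u': "u \<in> Ar M" "Dom M u = Dom M h" "Cod M u = Dom M k" by (auto simp: hom_def)
        have "FA K u = v'"
        proof (rule cartesian_cancel[OF pF' k'(1)])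
          show "FA K u \<in> hom M' (FO K (Dom M h)) (Dom M' k')" using u' dom by (simp add: hom_def)
          show "v' \<in> hom M' (FO K (Dom M h)) (Dom M' k')" using v' h(1) by (simp add: hom_def)
          show "FA p' (FA K u) = FA p' v'" using LpA[OF u'(1)] u v' by simp
          show "k' \<cdot>\<^bsub>M'\<^esub> FA K u = k' \<cdot>\<^bsub>M'\<^esub> v'"
            using functor_simps(8)[OF KF u'(1) k(1)] u u' v' k by simp
        qed
        then show "u = v" using v u' by (intro injKA) simp_all
      qed
    qed
    then show "\<exists>k. cartesian_lift M N p f Y k"
      using pk cod by (auto simp: cartesian_lift_def)
  qed
qed

lemma category_fibre_cat:
  assumes "is_functor E B P" "A \<in> Ob B"
  shows "category (fibre_cat E B P A)"
proof -
  note [simp] = functor_simps[OF assms(1)]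
  show ?thesis using assms(2) unfolding category_def fibre_cat_def by (auto simp: hom_def)
qed

text \<open>A lift of an arrow over the identity of \<open>A\<close>, and every factorisation through it of an arrow over that
  identity, again lie over the identity of \<open>A\<close>, so Cartesianness in \<open>M\<close> suffices.\<close>

lemma fibration_fibre_cat:
  assumes p: "fibration M N p" and q: "is_functor N B q" and r: "r = comp_func q p" and A: "A \<in> Ob B"
  shows "fibration (fibre_cat M B r A) (fibre_cat N B q A) p"
proof -
  have pF: "is_functor M N p" using p by (simp add: fibration_def)
  note [simp] = functor_simps[OF pF] functor_simps[OF q]
  have rF: "is_functor M B r" unfolding is_functor_def r comp_func_def by (auto simp: hom_def)
  show ?thesis unfolding fibration_def
  proof (intro conjI ballI impI)
    show "is_functor (fibre_cat M B r A) (fibre_cat N B q A) p"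
      using category_fibre_cat[OF rF A] category_fibre_cat[OF q A]
      unfolding is_functor_def by (auto simp: fibre_cat_def hom_def r comp_func_def)
    fix f Y assume f: "f \<in> Ar (fibre_cat N B q A)" and Y: "Y \<in> Ob (fibre_cat M B r A)"
      "FO p Y = Cod (fibre_cat N B q A) f"
    then obtain k where k: "cartesian_lift M N p f Y k"
      using p unfolding fibration_def fibre_cat_def by auto
    then have k': "cartesian M N p k" "FA p k = f" "Cod M k = Y" "k \<in> Ar M"
      by (auto simp: cartesian_lift_def cartesian_def)
    have pk: "FO p (Dom M k) = Dom N f" using k' functor_simps(5)[OF pF k'(4)] by simp
    have "cartesian (fibre_cat M B r A) (fibre_cat N B q A) p k"
      unfolding cartesian_def
    proof (intro conjI ballI impI)
      show "k \<in> Ar (fibre_cat M B r A)" using k' f Y pk by (auto simp: fibre_cat_def r comp_func_def)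
      fix h w assume h: "h \<in> Ar (fibre_cat M B r A)"
        "w \<in> hom (fibre_cat N B q A) (FO p (Dom (fibre_cat M B r A) h)) (FO p (Dom (fibre_cat M B r A) k))"
        "Cod (fibre_cat M B r A) h = Cod (fibre_cat M B r A) k"
        "FA p k \<cdot>\<^bsub>fibre_cat N B q A\<^esub> w = FA p h"
      have "\<exists>!v. v \<in> hom M (Dom M h) (Dom M k) \<and> FA p v = w \<and> k \<cdot>\<^bsub>M\<^esub> v = h"
        by (rule k'(1)[unfolded cartesian_def, THEN conjunct2, rule_format])
           (use h in \<open>auto simp: fibre_cat_def hom_def\<close>)
      moreover have "v \<in> hom (fibre_cat M B r A) (Dom (fibre_cat M B r A) h) (Dom (fibre_cat M B r A) k)
          \<and> FA p v = w \<and> k \<cdot>\<^bsub>fibre_cat M B r A\<^esub> v = h \<longleftrightarrow>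
          v \<in> hom M (Dom M h) (Dom M k) \<and> FA p v = w \<and> k \<cdot>\<^bsub>M\<^esub> v = h" for v
        using h f pk by (auto simp: fibre_cat_def hom_def r comp_func_def)
      ultimately show "\<exists>!v. v \<in> hom (fibre_cat M B r A) (Dom (fibre_cat M B r A) h) (Dom (fibre_cat M B r A) k)
          \<and> FA p v = w \<and> k \<cdot>\<^bsub>fibre_cat M B r A\<^esub> v = h"
        by simp
    qed
    then show "\<exists>k. cartesian_lift (fibre_cat M B r A) (fibre_cat N B q A) p f Y k"
      using k' by (auto simp: cartesian_lift_def fibre_cat_def)
  qed
qed

section \<open>Monoidal fibred categories and their fibres\<close>

locale monoidal_fibration =
  fixes F :: "('b, 'f, 'o, 'm) monfib"
  assumes monoidal_fibred: "monoidal_fibred_category F"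
begin

abbreviation E where "E \<equiv> tot F"
abbreviation B where "B \<equiv> base F"
abbreviation P where "P \<equiv> FO (proj F)"
abbreviation PA where "PA \<equiv> FA (proj F)"
abbreviation U where "U \<equiv> FO (funit F)"
abbreviation UA where "UA \<equiv> FA (funit F)"
abbreviation comp (infixl "\<bullet>" 70) where "g \<bullet> f \<equiv> g \<cdot>\<^bsub>tot F\<^esub> f"
abbreviation tens_ob (infixl "\<boxtimes>" 75) where "X \<boxtimes> Y \<equiv> FO (ftens F) (X, Y)"
abbreviation tens_ar (infixl "\<star>" 75) where "f \<star> g \<equiv> FA (ftens F) (f, g)"
abbreviation cart where "cart \<equiv> cartesian (tot F) (base F) (proj F)"
abbreviation iE where "iE \<equiv> Idn (tot F)"
abbreviation iB where "iB \<equiv> Idn (base F)"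

lemma fibration_proj: "fibration E B (proj F)"
  and functor_ftens: "is_functor (fprod_cat E E (proj F) (proj F)) E (ftens F)"
  and functor_funit: "is_functor B E (funit F)"
  and coherence: "\<forall>A \<in> Ob B. monoidal_coherence (fibre F A)"
  using monoidal_fibred unfolding monoidal_fibred_category_def Let_def by blast+

lemma functor_proj: "is_functor E B (proj F)"
  using fibration_proj by (simp add: fibration_def)

lemmas proj_simps [simp] = functor_simps[OF functor_proj]

text \<open>The axioms are restated with explicit sources and targets, in a form in which the simplifier can
  discharge all side conditions on composability and on lying over the same arrow.\<close>

lemma unit_simps [simp]:
  shows "A \<in> Ob B \<Longrightarrow> U A \<in> Ob E"
    and "f \<in> Ar B \<Longrightarrow> UA f \<in> Ar E"
    and "f \<in> Ar B \<Longrightarrow> Dom E (UA f) = U (Dom B f)"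
    and "f \<in> Ar B \<Longrightarrow> Cod E (UA f) = U (Cod B f)"
    and "A \<in> Ob B \<Longrightarrow> UA (iB A) = iE (U A)"
    and "f \<in> Ar B \<Longrightarrow> g \<in> Ar B \<Longrightarrow> Cod B f = Dom B g \<Longrightarrow> UA (g \<cdot>\<^bsub>B\<^esub> f) = UA g \<bullet> UA f"
    and "A \<in> Ob B \<Longrightarrow> P (U A) = A"
    and "f \<in> Ar B \<Longrightarrow> PA (UA f) = f"
proof -
  have "func_eq B (comp_func (proj F) (funit F)) id_func"
    using monoidal_fibred unfolding monoidal_fibred_category_def Let_def by blast
  then show "A \<in> Ob B \<Longrightarrow> P (U A) = A" "f \<in> Ar B \<Longrightarrow> PA (UA f) = f"
    by (auto simp: func_eq_def comp_func_def id_func_def)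
qed (use functor_simps[OF functor_funit] in auto)

lemma tens_simps [simp]:
  shows "X \<in> Ob E \<Longrightarrow> Y \<in> Ob E \<Longrightarrow> P X = P Y \<Longrightarrow> X \<boxtimes> Y \<in> Ob E"
    and "X \<in> Ob E \<Longrightarrow> Y \<in> Ob E \<Longrightarrow> P X = P Y \<Longrightarrow> P (X \<boxtimes> Y) = P X"
    and "f \<in> Ar E \<Longrightarrow> g \<in> Ar E \<Longrightarrow> PA f = PA g \<Longrightarrow> f \<star> g \<in> Ar E"
    and "f \<in> Ar E \<Longrightarrow> g \<in> Ar E \<Longrightarrow> PA f = PA g \<Longrightarrow> PA (f \<star> g) = PA f"
    and "f \<in> Ar E \<Longrightarrow> g \<in> Ar E \<Longrightarrow> PA f = PA g \<Longrightarrow> Dom E (f \<star> g) = Dom E f \<boxtimes> Dom E g"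
    and "f \<in> Ar E \<Longrightarrow> g \<in> Ar E \<Longrightarrow> PA f = PA g \<Longrightarrow> Cod E (f \<star> g) = Cod E f \<boxtimes> Cod E g"
    and "X \<in> Ob E \<Longrightarrow> Y \<in> Ob E \<Longrightarrow> P X = P Y \<Longrightarrow> iE X \<star> iE Y = iE (X \<boxtimes> Y)"
proof -
  have "func_eq (fprod_cat E E (proj F) (proj F)) (comp_func (proj F) (ftens F)) (comp_func (proj F) fst_func)"
    using monoidal_fibred unfolding monoidal_fibred_category_def Let_def by blast
  then show "X \<in> Ob E \<Longrightarrow> Y \<in> Ob E \<Longrightarrow> P X = P Y \<Longrightarrow> P (X \<boxtimes> Y) = P X"
    "f \<in> Ar E \<Longrightarrow> g \<in> Ar E \<Longrightarrow> PA f = PA g \<Longrightarrow> PA (f \<star> g) = PA f"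
    by (auto simp: func_eq_def comp_func_def fst_func_def fprod_cat_def)
qed (use functor_simps[OF functor_ftens] in \<open>auto simp: fprod_cat_def prod_cat_def\<close>)

lemma tens_comp:
  assumes "f \<in> Ar E" "f' \<in> Ar E" "g \<in> Ar E" "g' \<in> Ar E" "PA f = PA f'" "PA g = PA g'"
    "Cod E f = Dom E g" "Cod E f' = Dom E g'"
  shows "(g \<star> g') \<bullet> (f \<star> f') = (g \<bullet> f) \<star> (g' \<bullet> f')"
  using functor_simps(8)[OF functor_ftens, of "(f, f')" "(g, g')"] assms
  by (simp add: fprod_cat_def prod_cat_def)

lemma assoc_simps [simp]:
  assumes "X \<in> Ob E" "Y \<in> Ob E" "Z \<in> Ob E" "P X = A" "P Y = A" "P Z = A"
  shows "fassoc F X Y Z \<in> Ar E" and "PA (fassoc F X Y Z) = iB A"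
    and "Dom E (fassoc F X Y Z) = (X \<boxtimes> Y) \<boxtimes> Z" and "Cod E (fassoc F X Y Z) = X \<boxtimes> (Y \<boxtimes> Z)"
    and "is_iso E (fassoc F X Y Z)"
proof -
  let ?E2 = "fprod_cat E E (proj F) (proj F)"
  let ?E3 = "fprod_cat ?E2 E (comp_func (proj F) fst_func) (proj F)"
  have n: "nat_iso ?E3 E (tens_l (ftens F)) (tens_r (ftens F)) (\<lambda>((X, Y), Z). fassoc F X Y Z)"
    and p: "\<forall>((X, Y), Z) \<in> Ob ?E3. PA (fassoc F X Y Z) = iB (P X)"
    using monoidal_fibred unfolding monoidal_fibred_category_def Let_def by blast+
  have o: "((X, Y), Z) \<in> Ob ?E3"
    using assms by (simp add: fprod_cat_def comp_func_def fst_func_def)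
  show "PA (fassoc F X Y Z) = iB A" using p o assms by auto
  show "fassoc F X Y Z \<in> Ar E" "Dom E (fassoc F X Y Z) = (X \<boxtimes> Y) \<boxtimes> Z"
    "Cod E (fassoc F X Y Z) = X \<boxtimes> (Y \<boxtimes> Z)" "is_iso E (fassoc F X Y Z)"
    using n o unfolding nat_iso_def nat_trans_def by (auto simp: hom_def tens_l_def tens_r_def)
qed

text \<open>Naturality holds along arbitrary arrows of \<open>E\<close> over a common arrow of the base, not only
  along vertical ones. This is what lets Cartesian arrows pass through the associativity isomorphism.\<close>

lemma assoc_natural:
  assumes "f \<in> Ar E" "g \<in> Ar E" "h \<in> Ar E" "PA f = PA g" "PA g = PA h"
  shows "(f \<star> (g \<star> h)) \<bullet> fassoc F (Dom E f) (Dom E g) (Dom E h) =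
    fassoc F (Cod E f) (Cod E g) (Cod E h) \<bullet> ((f \<star> g) \<star> h)"
proof -
  let ?E2 = "fprod_cat E E (proj F) (proj F)"
  let ?E3 = "fprod_cat ?E2 E (comp_func (proj F) fst_func) (proj F)"
  have n: "nat_iso ?E3 E (tens_l (ftens F)) (tens_r (ftens F)) (\<lambda>((X, Y), Z). fassoc F X Y Z)"
    using monoidal_fibred unfolding monoidal_fibred_category_def Let_def by blast
  have o: "((f, g), h) \<in> Ar ?E3"
    using assms by (simp add: fprod_cat_def comp_func_def fst_func_def)
  show ?thesis
    using n o unfolding nat_iso_def nat_trans_def
    by (auto simp: tens_l_def tens_r_def fprod_cat_def prod_cat_def)
qed

lemma unitor_simps [simp]:
  assumes "X \<in> Ob E" "P X = A"
  shows "flunit F X \<in> Ar E" and "PA (flunit F X) = iB A"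
    and "Dom E (flunit F X) = U A \<boxtimes> X" and "Cod E (flunit F X) = X" and "is_iso E (flunit F X)"
    and "frunit F X \<in> Ar E" and "PA (frunit F X) = iB A"
    and "Dom E (frunit F X) = X \<boxtimes> U A" and "Cod E (frunit F X) = X" and "is_iso E (frunit F X)"
  using monoidal_fibred assms unfolding monoidal_fibred_category_def Let_def nat_iso_def nat_trans_def
  by (auto simp: hom_def id_func_def)

lemma unitor_natural:
  assumes "f \<in> Ar E"
  shows "f \<bullet> flunit F (Dom E f) = flunit F (Cod E f) \<bullet> (UA (PA f) \<star> f)"
    and "f \<bullet> frunit F (Dom E f) = frunit F (Cod E f) \<bullet> (f \<star> UA (PA f))"
  using monoidal_fibred assms unfolding monoidal_fibred_category_def Let_def nat_iso_def nat_trans_def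
  by (auto simp: id_func_def)

lemma fibre_simps [simp]:
  "Ob (fibre F A) = {X \<in> Ob E. P X = A}"
  "Dom (fibre F A) = Dom E" "Cod (fibre F A) = Cod E" "Idn (fibre F A) = iE" "Comp (fibre F A) = Comp E"
  "tens (fibre F A) = ftens F" "munit (fibre F A) = U A" "massoc (fibre F A) = fassoc F"
  "mlunit (fibre F A) = flunit F" "mrunit (fibre F A) = frunit F"
  by (auto simp: fibre_def fibre_cat_def cat.defs moncat.defs)

lemma vertical:
  assumes "f \<in> Ar E" "PA f = iB A" "A \<in> Ob B"
  shows "P (Dom E f) = A" and "P (Cod E f) = A"
  using proj_simps(5,6)[OF assms(1)] assms(2,3) by (metis category_simps(4,5) proj_simps(2))+

lemma Ar_fibre [simp]: "A \<in> Ob B \<Longrightarrow> f \<in> Ar (fibre F A) \<longleftrightarrow> f \<in> Ar E \<and> PA f = iB A"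
  using vertical by (auto simp: fibre_def fibre_cat_def cat.defs moncat.defs)

lemma hom_fibre [simp]:
  "A \<in> Ob B \<Longrightarrow> f \<in> hom (fibre F A) X Y \<longleftrightarrow> f \<in> Ar E \<and> PA f = iB A \<and> Dom E f = X \<and> Cod E f = Y"
  by (auto simp: hom_def)

text \<open>The inverse of \<open>f\<close> is vertical, as its image in the base is inverse to an identity.\<close>

lemma is_iso_fibre:
  assumes "is_iso E f" "PA f = iB A" "A \<in> Ob B"
  shows "is_iso (fibre F A) f"
proof -
  obtain g where f: "f \<in> Ar E" and g: "g \<in> Ar E" "Dom E g = Cod E f" "Cod E g = Dom E f"
    "g \<bullet> f = iE (Dom E f)" "f \<bullet> g = iE (Cod E f)"
    using assms(1) by (auto simp: is_iso_def hom_def)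
  note v = vertical[OF f assms(2,3)]
  have "PA (f \<bullet> g) = PA g" unfolding proj_simps(8)[OF g(1) f g(3)] using f g assms v by simp
  then have "PA g = iB A" using f g v by simp
  then show ?thesis using f g assms by (auto simp: is_iso_def)
qed

lemma category_fibre [simp]: "A \<in> Ob B \<Longrightarrow> category (fibre F A)"
  unfolding category_def by (auto simp: vertical)

lemma monoidal_category_fibre [simp]:
  assumes A: "A \<in> Ob B"
  shows "monoidal_category (fibre F A)"
  unfolding monoidal_category_def
proof (intro conjI)
  let ?V = "fibre F A"
  have T: "is_functor (prod_cat ?V ?V) ?V (tens ?V)"
    using A unfolding is_functor_def
    by (auto simp: category_prod_cat) (auto simp: prod_cat_def tens_comp)
  show "category ?V" "munit ?V \<in> Ob ?V" "monoidal_coherence ?V"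
    using A coherence by simp_all
  show "is_functor (prod_cat ?V ?V) ?V (tens ?V)" by (rule T)
  show "nat_iso (prod_cat (prod_cat ?V ?V) ?V) ?V (tens_l (tens ?V)) (tens_r (tens ?V))
      (\<lambda>((X, Y), Z). massoc ?V X Y Z)"
    unfolding nat_iso_def nat_trans_def is_functor_def
    using A
    by (auto simp: category_prod_cat) (auto simp: prod_cat_def tens_l_def tens_r_def tens_comp assoc_natural vertical intro!: is_iso_fibre)
  show "nat_iso ?V ?V \<lparr>FO = (\<lambda>X. munit ?V \<otimes>\<^bsub>?V\<^esub> X), FA = (\<lambda>f. Idn ?V (munit ?V) \<odot>\<^bsub>?V\<^esub> f)\<rparr> id_func (mlunit ?V)"
    unfolding nat_iso_def nat_trans_def is_functor_def
    using A unitor_natural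
    by (auto simp: id_func_def tens_comp vertical intro!: is_iso_fibre)
  show "nat_iso ?V ?V \<lparr>FO = (\<lambda>X. X \<otimes>\<^bsub>?V\<^esub> munit ?V), FA = (\<lambda>f. f \<odot>\<^bsub>?V\<^esub> Idn ?V (munit ?V))\<rparr> id_func (mrunit ?V)"
    unfolding nat_iso_def nat_trans_def is_functor_def
    using A unitor_natural
    by (auto simp: id_func_def tens_comp vertical intro!: is_iso_fibre)
qed

section \<open>Algebraic laws along Cartesian arrows\<close>

lemma cart_Ar: "cart k \<Longrightarrow> k \<in> Ar E"
  by (simp add: cartesian_def)

text \<open>The principle behind all diagram chases below.\<close>

lemma cart_cancel:
  assumes "cart k" "v \<in> Ar E" "v' \<in> Ar E" "Dom E v = Dom E v'" "Cod E v = Dom E k" "Cod E v' = Dom E k"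
    "PA v = PA v'" "k \<bullet> v = k \<bullet> v'"
  shows "v = v'"
  by (rule cartesian_cancel[OF functor_proj assms(1), of _ "Dom E v'"]) (use assms in \<open>auto simp: hom_def\<close>)

lemma vert_fact_props:
  assumes k: "cart k" and h: "h \<in> Ar E" "Cod E h = Cod E k" "PA h = PA k"
  shows "vert_fact F k h \<in> Ar E" and "Dom E (vert_fact F k h) = Dom E h"
    and "Cod E (vert_fact F k h) = Dom E k" and "PA (vert_fact F k h) = iB (P (Dom E h))"
    and "k \<bullet> vert_fact F k h = h"
proof -
  have eq: "P (Dom E k) = P (Dom E h)"
    using h proj_simps(5)[OF h(1)] proj_simps(5)[OF cart_Ar[OF k]] by simp
  have "\<exists>!v. v \<in> hom E (Dom E h) (Dom E k) \<and> PA v = iB (P (Dom E h)) \<and> k \<bullet> v = h"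
    by (rule k[unfolded cartesian_def, THEN conjunct2, rule_format])
       (use h cart_Ar[OF k] eq in \<open>auto simp: hom_def\<close>)
  from theI'[OF this] show "vert_fact F k h \<in> Ar E" "Dom E (vert_fact F k h) = Dom E h"
    "Cod E (vert_fact F k h) = Dom E k" "PA (vert_fact F k h) = iB (P (Dom E h))"
    "k \<bullet> vert_fact F k h = h"
    by (auto simp: vert_fact_def hom_def)
qed

lemma vert_fact_eqI:
  assumes "cart k" "v \<in> Ar E" "Cod E v = Dom E k" "PA v = iB (P (Dom E v))" "k \<bullet> v = h"
  shows "vert_fact F k h = v"
proof -
  have k: "k \<in> Ar E" using assms cart_Ar by blast
  have d: "P (Dom E k) = P (Dom E v)" using vertical(2)[OF assms(2,4)] assms(2,3) by simp
  have h: "h \<in> Ar E" "Dom E h = Dom E v" "Cod E h = Cod E k" "PA h = PA k"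
    using assms k d by auto
  show ?thesis
    by (rule cart_cancel[OF assms(1)]) (use assms h vert_fact_props[OF assms(1) h(1,3,4)] in simp_all)
qed

text \<open>The interchange law, in a form that merges adjacent tensor products inside a composite
  associated to the right.\<close>

lemma tens_comp_assoc:
  assumes "f \<in> Ar E" "f' \<in> Ar E" "g \<in> Ar E" "g' \<in> Ar E" "PA f = PA f'" "PA g = PA g'"
    "Cod E f = Dom E g" "Cod E f' = Dom E g'" "x \<in> Ar E" "Cod E x = Dom E f \<boxtimes> Dom E f'"
  shows "(g \<star> g') \<bullet> ((f \<star> f') \<bullet> x) = ((g \<bullet> f) \<star> (g' \<bullet> f')) \<bullet> x"
proof -
  have "(g \<star> g') \<bullet> ((f \<star> f') \<bullet> x) = ((g \<star> g') \<bullet> (f \<star> f')) \<bullet> x"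
    using assms by simp
  then show ?thesis using tens_comp[OF assms(1-8)] by simp
qed

text \<open>Composition with \<open>kN\<close> turns each axiom for \<open>r\<close> into the axiom for \<open>s\<close>, precomposed with a tensor
  product of \<open>kN\<close> with copies of \<open>kS\<close> or with \<open>u(f)\<close>: interchange moves these arrows past the structure maps, naturality moves them past
  the associativity and unit isomorphisms.\<close>

lemma module_laws_lift:
  assumes kN: "cart kN" "Cod E kN = N" "Dom E kN = M" "PA kN = f"
    and kS: "kS \<in> Ar E" "Cod E kS = S" "Dom E kS = R" "PA kS = f"
    and n: "n \<in> hom (fibre F (Cod B f)) (S \<boxtimes> S) S" "l \<in> hom (fibre F (Cod B f)) (U (Cod B f)) S"
    and N: "(N, s) \<in> right_modules (fibre F (Cod B f)) (S, n, l)"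
    and m: "m \<in> hom (fibre F (Dom B f)) (R \<boxtimes> R) R" "kS \<bullet> m = n \<bullet> (kS \<star> kS)"
    and e: "e \<in> hom (fibre F (Dom B f)) (U (Dom B f)) R" "kS \<bullet> e = l \<bullet> UA f"
    and r: "r \<in> hom (fibre F (Dom B f)) (M \<boxtimes> R) M" "kN \<bullet> r = s \<bullet> (kN \<star> kS)"
  shows "(M, r) \<in> right_modules (fibre F (Dom B f)) (R, m, e)"
proof -
  have kN': "kN \<in> Ar E" using kN cart_Ar by blast
  have f: "f \<in> Ar B" using kN kN' by auto
  have P: "P N = Cod B f" "P M = Dom B f" "P S = Cod B f" "P R = Dom B f"
    using proj_simps(5,6)[OF kN'] proj_simps(5,6)[OF kS(1)] kN kS by auto
  have Ob: "N \<in> Ob E" "M \<in> Ob E" "S \<in> Ob E" "R \<in> Ob E"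
    using kN kN' kS by auto
  have s: "s \<in> Ar E" "PA s = iB (Cod B f)" "Dom E s = N \<boxtimes> S" "Cod E s = N"
    and law: "s \<bullet> (s \<star> iE S) = s \<bullet> (iE N \<star> n) \<bullet> fassoc F N S S" "s \<bullet> (iE N \<star> l) = frunit F N"
    using N f by (auto simp: right_modules_def)
  note [simp] = f P Ob s kN(2-4) kN' kS tens_comp tens_comp_assoc
  have n' [simp]: "n \<in> Ar E" "PA n = iB (Cod B f)" "Dom E n = S \<boxtimes> S" "Cod E n = S"
    "l \<in> Ar E" "PA l = iB (Cod B f)" "Dom E l = U (Cod B f)" "Cod E l = S"
    using n by simp_all
  have m' [simp]: "m \<in> Ar E" "PA m = iB (Dom B f)" "Dom E m = R \<boxtimes> R" "Cod E m = R"
    "e \<in> Ar E" "PA e = iB (Dom B f)" "Dom E e = U (Dom B f)" "Cod E e = R"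
    "r \<in> Ar E" "PA r = iB (Dom B f)" "Dom E r = M \<boxtimes> R" "Cod E r = M"
    using m e r by simp_all
  have r2: "kN \<bullet> (r \<bullet> x) = s \<bullet> ((kN \<star> kS) \<bullet> x)" if "x \<in> Ar E" "Cod E x = M \<boxtimes> R" for x
  proof -
    have "kN \<bullet> (r \<bullet> x) = (kN \<bullet> r) \<bullet> x" using that by simp
    then show ?thesis using that by (simp add: r)
  qed
  have assoc: "r \<bullet> (r \<star> iE R) = r \<bullet> (iE M \<star> m) \<bullet> fassoc F M R R"
  proof (rule cart_cancel[OF kN(1)])
    have "kN \<bullet> (r \<bullet> (r \<star> iE R)) = s \<bullet> (s \<star> iE S) \<bullet> ((kN \<star> kS) \<star> kS)"
      by (simp add: r2 r(2))
    also have "\<dots> = s \<bullet> (iE N \<star> n) \<bullet> (fassoc F N S S \<bullet> ((kN \<star> kS) \<star> kS))"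
      unfolding law by simp
    also have "\<dots> = s \<bullet> (iE N \<star> n) \<bullet> ((kN \<star> (kS \<star> kS)) \<bullet> fassoc F M R R)"
      using assoc_natural[of kN kS kS] by simp
    also have "\<dots> = kN \<bullet> (r \<bullet> (iE M \<star> m) \<bullet> fassoc F M R R)"
      by (simp add: r2 m(2))
    finally show "kN \<bullet> (r \<bullet> (r \<star> iE R)) = kN \<bullet> (r \<bullet> (iE M \<star> m) \<bullet> fassoc F M R R)" .
  qed simp_all
  have unit: "r \<bullet> (iE M \<star> e) = frunit F M"
  proof (rule cart_cancel[OF kN(1)])
    have "kN \<bullet> (r \<bullet> (iE M \<star> e)) = s \<bullet> (iE N \<star> l) \<bullet> (kN \<star> UA f)"
      by (simp add: r2 e(2))
    also have "\<dots> = kN \<bullet> frunit F M"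
      unfolding law using unitor_natural(2)[of kN] by simp
    finally show "kN \<bullet> (r \<bullet> (iE M \<star> e)) = kN \<bullet> frunit F M" .
  qed simp_all
  show ?thesis
    using assoc unit by (auto simp: right_modules_def)
qed

text \<open>All but the left unit law is the preceding lemma for the module \<open>R\<close> over itself, with
  \<open>kN = kS\<close>.\<close>

lemma monoid_laws_lift:
  assumes k: "cart k" "Cod E k = S" "Dom E k = R" "PA k = f"
    and S: "(S, n, l) \<in> monoids (fibre F (Cod B f))"
    and m: "m \<in> hom (fibre F (Dom B f)) (R \<boxtimes> R) R" "k \<bullet> m = n \<bullet> (k \<star> k)"
    and e: "e \<in> hom (fibre F (Dom B f)) (U (Dom B f)) R" "k \<bullet> e = l \<bullet> UA f"
  shows "(R, m, e) \<in> monoids (fibre F (Dom B f))"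
proof -
  have k': "k \<in> Ar E" using k cart_Ar by blast
  have f: "f \<in> Ar B" using k k' by auto
  have P: "P S = Cod B f" "P R = Dom B f" and Ob: "S \<in> Ob E" "R \<in> Ob E"
    using proj_simps(5,6)[OF k'] k k' by auto
  note [simp] = f P Ob k(2-4) k' tens_comp tens_comp_assoc
  have nl: "n \<in> hom (fibre F (Cod B f)) (S \<boxtimes> S) S" "l \<in> hom (fibre F (Cod B f)) (U (Cod B f)) S"
    and law: "n \<bullet> (l \<star> iE S) = flunit F S"
    using S by (auto simp: monoids_def)
  then have n' [simp]: "n \<in> Ar E" "PA n = iB (Cod B f)" "Dom E n = S \<boxtimes> S" "Cod E n = S"
    "l \<in> Ar E" "PA l = iB (Cod B f)" "Dom E l = U (Cod B f)" "Cod E l = S"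
    by simp_all
  have m' [simp]: "m \<in> Ar E" "PA m = iB (Dom B f)" "Dom E m = R \<boxtimes> R" "Cod E m = R"
    "e \<in> Ar E" "PA e = iB (Dom B f)" "Dom E e = U (Dom B f)" "Cod E e = R"
    using m e by simp_all
  have "(R, m) \<in> right_modules (fibre F (Dom B f)) (R, m, e)"
    using module_laws_lift[OF k k' k(2-4) nl _ m e m] S by (simp add: monoids_iff)
  moreover have "m \<bullet> (e \<star> iE R) = flunit F R"
  proof (rule cart_cancel[OF k(1)])
    have "k \<bullet> (m \<bullet> (e \<star> iE R)) = (k \<bullet> m) \<bullet> (e \<star> iE R)" by simp
    also have "\<dots> = n \<bullet> (l \<star> iE S) \<bullet> (UA f \<star> k)"
      by (simp add: m(2) e(2))
    also have "\<dots> = k \<bullet> flunit F R"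
      unfolding law using unitor_natural(1)[of k] by simp
    finally show "k \<bullet> (m \<bullet> (e \<star> iE R)) = k \<bullet> flunit F R" .
  qed simp_all
  ultimately show ?thesis using e by (simp add: monoids_iff)
qed

text \<open>If \<open>kN\<close> and its composite with \<open>y\<close> both commute with the actions, then so does \<open>y\<close>: the two sides
  agree after composition with \<open>kN\<close>. For \<open>kN = kS\<close> and \<open>y = w\<close> this is compatibility with
  multiplications.\<close>

lemma action_factor:
  assumes kN: "cart kN" "kS \<in> Ar E" "PA kS = PA kN"
    and w: "w \<in> Ar E" "Cod E w = Dom E kS" and y: "y \<in> Ar E" "Cod E y = Dom E kN" "PA y = PA w"
    and r: "r \<in> Ar E" "Dom E r = Dom E kN \<boxtimes> Dom E kS" "Cod E r = Dom E kN" "PA r = iB (P (Dom E kN))"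
    and s: "s \<in> Ar E" "Dom E s = Cod E kN \<boxtimes> Cod E kS"
    and t: "t \<in> Ar E" "Dom E t = Dom E y \<boxtimes> Dom E w" "Cod E t = Dom E y" "PA t = iB (P (Dom E y))"
    and kr: "kN \<bullet> r = s \<bullet> (kN \<star> kS)" and kt: "(kN \<bullet> y) \<bullet> t = s \<bullet> ((kN \<bullet> y) \<star> (kS \<bullet> w))"
  shows "y \<bullet> t = r \<bullet> (y \<star> w)"
proof (rule cart_cancel[OF kN(1)])
  have kN': "kN \<in> Ar E" using kN cart_Ar by blast
  have P: "P (Dom E kS) = P (Dom E kN)" "P (Cod E kS) = P (Cod E kN)" "P (Dom E w) = P (Dom E y)"
    using proj_simps(5,6)[OF kN'] proj_simps(5,6)[OF kN(2)] proj_simps(5)[OF w(1)] proj_simps(5)[OF y(1)] kN y by auto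
  note [simp] = kN' kN P w y r s t
  have "kN \<bullet> (y \<bullet> t) = (kN \<bullet> y) \<bullet> t" by simp
  also have "\<dots> = s \<bullet> (kN \<star> kS) \<bullet> (y \<star> w)" unfolding kt by (simp add: tens_comp)
  also have "\<dots> = kN \<bullet> (r \<bullet> (y \<star> w))" unfolding kr[symmetric] by simp
  finally show "kN \<bullet> (y \<bullet> t) = kN \<bullet> (r \<bullet> (y \<star> w))" .
  show "y \<bullet> t \<in> Ar E" "r \<bullet> (y \<star> w) \<in> Ar E" "Dom E (y \<bullet> t) = Dom E (r \<bullet> (y \<star> w))"
    "Cod E (y \<bullet> t) = Dom E kN" "Cod E (r \<bullet> (y \<star> w)) = Dom E kN" "PA (y \<bullet> t) = PA (r \<bullet> (y \<star> w))"
    by simp_all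
qed

section \<open>The categories of monoids and of modules\<close>

lemma MonE_Ob: "(R, m, e) \<in> Ob (MonE F) \<longleftrightarrow> R \<in> Ob E \<and> (R, m, e) \<in> monoids (fibre F (P R))"
  by (auto simp: MonE_def hom_cat_def monoids_def)

lemma MonE_Ar: "((R, m, e), h, (S, n, l)) \<in> Ar (MonE F) \<longleftrightarrow>
    (R, m, e) \<in> Ob (MonE F) \<and> (S, n, l) \<in> Ob (MonE F) \<and> h \<in> Ar E \<and> Dom E h = R \<and> Cod E h = S \<and>
    h \<bullet> m = n \<bullet> (h \<star> h) \<and> h \<bullet> e = l \<bullet> UA (PA h)"
  by (auto simp: MonE_def hom_cat_def hom_def)

lemma MonE_ObD:
  assumes "(R, m, e) \<in> Ob (MonE F)"
  shows "R \<in> Ob E" and "m \<in> Ar E" and "Dom E m = R \<boxtimes> R" and "Cod E m = R" and "PA m = iB (P R)"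
    and "e \<in> Ar E" and "Dom E e = U (P R)" and "Cod E e = R" and "PA e = iB (P R)"
  using assms by (auto simp: MonE_Ob monoids_def)

lemma ModE_Ob: "((R, m, e), (M, r)) \<in> Ob (ModE F) \<longleftrightarrow>
    (R, m, e) \<in> Ob (MonE F) \<and> (M, r) \<in> right_modules (fibre F (P R)) (R, m, e)"
  by (auto simp: ModE_def hom_cat_def)

lemma ModE_Ar: "((R, (M, r)), (h, a), (S, (N, s))) \<in> Ar (ModE F) \<longleftrightarrow>
    (R, (M, r)) \<in> Ob (ModE F) \<and> (S, (N, s)) \<in> Ob (ModE F) \<and> (R, h, S) \<in> Ar (MonE F) \<and>
    a \<in> Ar E \<and> Dom E a = M \<and> Cod E a = N \<and> PA h = PA a \<and> a \<bullet> r = s \<bullet> (a \<star> h)"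
  by (auto simp: ModE_def hom_cat_def hom_def)

lemma ModE_ObD:
  assumes "(R, (M, r)) \<in> Ob (ModE F)"
  shows "R \<in> Ob (MonE F)" and "M \<in> Ob E" and "P M = P (fst R)"
    and "r \<in> Ar E" and "Dom E r = M \<boxtimes> fst R" and "Cod E r = M" and "PA r = iB (P (fst R))"
proof -
  obtain R0 m e where R: "R = (R0, m, e)" by (cases R)
  show "R \<in> Ob (MonE F)" "M \<in> Ob E" "P M = P (fst R)"
    "r \<in> Ar E" "Dom E r = M \<boxtimes> fst R" "Cod E r = M" "PA r = iB (P (fst R))"
    using assms MonE_ObD(1)[of R0 m e] unfolding R by (auto simp: ModE_Ob right_modules_def)
qed

lemma MonE_ArD:
  assumes "(R, h, S) \<in> Ar (MonE F)"
  shows "R \<in> Ob (MonE F)" and "S \<in> Ob (MonE F)" and "h \<in> Ar E" and "Dom E h = fst R" and "Cod E h = fst S"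
  using assms by (cases R; cases S; auto simp: MonE_Ar)+

lemma MonE_comp:
  assumes "(R, h, S) \<in> Ar (MonE F)" and "(S, g, T) \<in> Ar (MonE F)"
  shows "(R, g \<bullet> h, T) \<in> Ar (MonE F)"
proof -
  obtain R0 m e where R: "R = (R0, m, e)" by (cases R)
  obtain S0 n l where S: "S = (S0, n, l)" by (cases S)
  obtain T0 q d where T: "T = (T0, q, d)" by (cases T)
  note a = assms[unfolded R S T MonE_Ar]
  note [simp] = MonE_ObD[OF conjunct1[OF a(1)]] MonE_ObD[OF conjunct1[OF a(2)]]
    MonE_ObD[OF conjunct1[OF conjunct2[OF a(2)]]]
  have [simp]: "h \<in> Ar E" "Dom E h = R0" "Cod E h = S0" "g \<in> Ar E" "Dom E g = S0" "Cod E g = T0"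
    using a by auto
  have mult: "h \<bullet> m = n \<bullet> (h \<star> h)" "g \<bullet> n = q \<bullet> (g \<star> g)"
    and unit: "h \<bullet> e = l \<bullet> UA (PA h)" "g \<bullet> l = d \<bullet> UA (PA g)"
    using a by auto
  have "(g \<bullet> h) \<bullet> m = (g \<bullet> n) \<bullet> (h \<star> h)" by (simp add: mult(1))
  also have "\<dots> = q \<bullet> ((g \<bullet> h) \<star> (g \<bullet> h))" unfolding mult(2) by (simp add: tens_comp)
  finally have "(g \<bullet> h) \<bullet> m = q \<bullet> ((g \<bullet> h) \<star> (g \<bullet> h))" .
  moreover have "(g \<bullet> h) \<bullet> e = (g \<bullet> l) \<bullet> UA (PA h)" by (simp add: unit(1))
  then have "(g \<bullet> h) \<bullet> e = d \<bullet> UA (PA (g \<bullet> h))" unfolding unit(2) by simp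
  ultimately show ?thesis using a unfolding R S T MonE_Ar by simp
qed

lemma MonE_id:
  assumes "R \<in> Ob (MonE F)"
  shows "(R, iE (fst R), R) \<in> Ar (MonE F)"
proof -
  obtain R0 m e where R: "R = (R0, m, e)" by (cases R)
  note [simp] = MonE_ObD[OF assms[unfolded R]]
  show ?thesis using assms unfolding R MonE_Ar by simp
qed

lemma category_MonE [simp]: "category (MonE F)"
proof (rule category_hom_cat[OF MonE_def])
  fix X assume "X \<in> Ob (MonE F)"
  then show "(X, case X of (R, m, e) \<Rightarrow> iE R, X) \<in> Ar (MonE F)"
    using MonE_id[of X] by (simp add: case_prod_unfold)
qed (auto simp: MonE_comp MonE_ArD case_prod_unfold)

lemma MonE_simps [simp]:
  "Dom (MonE F) (X, h, Y) = X" "Cod (MonE F) (X, h, Y) = Y" "Idn (MonE F) X = (X, iE (fst X), X)"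
  "(Y', g, Z) \<cdot>\<^bsub>MonE F\<^esub> (X, h, Y) = (X, g \<bullet> h, Z)"
  by (simp_all add: MonE_def hom_cat_def case_prod_unfold)

lemma ModE_ArD:
  assumes "((R, M), (h, a), (S, N)) \<in> Ar (ModE F)"
  shows "(R, M) \<in> Ob (ModE F)" and "(S, N) \<in> Ob (ModE F)" and "(R, h, S) \<in> Ar (MonE F)"
    and "a \<in> Ar E" and "Dom E a = fst M" and "Cod E a = fst N" and "PA a = PA h"
    and "a \<bullet> snd M = snd N \<bullet> (a \<star> h)"
  using assms by (cases M; cases N; auto simp: ModE_Ar)+

lemma ModE_ArI:
  assumes "(R, M) \<in> Ob (ModE F)" and "(S, N) \<in> Ob (ModE F)" and "(R, h, S) \<in> Ar (MonE F)"
    and "a \<in> Ar E" and "Dom E a = fst M" and "Cod E a = fst N" and "PA a = PA h"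
    and "a \<bullet> snd M = snd N \<bullet> (a \<star> h)"
  shows "((R, M), (h, a), (S, N)) \<in> Ar (ModE F)"
  using assms by (cases M; cases N; auto simp: ModE_Ar)

lemma ModE_comp:
  assumes "((R, M), (h, a), (S, N)) \<in> Ar (ModE F)" and "((S, N), (g, b), (T, L)) \<in> Ar (ModE F)"
  shows "((R, M), (g \<bullet> h, b \<bullet> a), (T, L)) \<in> Ar (ModE F)"
proof -
  obtain M0 r where M: "M = (M0, r)" by (cases M)
  obtain N0 s where N: "N = (N0, s)" by (cases N)
  obtain L0 t where L: "L = (L0, t)" by (cases L)
  note 1 = ModE_ArD[OF assms(1)] and 2 = ModE_ArD[OF assms(2)]
  note [simp] = 1(4-7) 2(4-7) MonE_ArD[OF 1(3)] MonE_ArD[OF 2(3)]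
    ModE_ObD[OF 1(1)[unfolded M]] ModE_ObD[OF 1(2)[unfolded N]] ModE_ObD[OF 2(2)[unfolded L]] M N L
  show ?thesis
  proof (rule ModE_ArI)
    have "(b \<bullet> a) \<bullet> r = b \<bullet> (a \<bullet> r)" by simp
    also have "\<dots> = (b \<bullet> s) \<bullet> (a \<star> h)" using 1(8) by simp
    also have "\<dots> = t \<bullet> ((b \<bullet> a) \<star> (g \<bullet> h))" using 2(8) by (simp add: tens_comp)
    finally show "(b \<bullet> a) \<bullet> snd M = snd L \<bullet> ((b \<bullet> a) \<star> (g \<bullet> h))" by simp
  qed (use 1 2 MonE_comp in simp_all)
qed

lemma ModE_id:
  assumes "(R, M) \<in> Ob (ModE F)"
  shows "((R, M), (iE (fst R), iE (fst M)), (R, M)) \<in> Ar (ModE F)"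
proof -
  obtain M0 r where M: "M = (M0, r)" by (cases M)
  obtain R0 m e where R: "R = (R0, m, e)" by (cases R)
  note o = ModE_ObD[OF assms[unfolded M]]
  note [simp] = o(2-) M MonE_ObD[OF o(1)[unfolded R]] R
  show ?thesis by (rule ModE_ArI) (use assms MonE_id[OF o(1)] in simp_all)
qed

lemma category_ModE [simp]: "category (ModE F)"
proof (rule category_hom_cat[OF ModE_def])
  fix X assume "X \<in> Ob (ModE F)"
  then show "(X, (\<lambda>((R, m, e), (M, k)). (iE R, iE M)) X, X) \<in> Ar (ModE F)"
    using ModE_id[of "fst X" "snd X"] by (simp add: case_prod_unfold)
next
  fix X Y Z f g assume "(X, f, Y) \<in> Ar (ModE F)" "(Y, g, Z) \<in> Ar (ModE F)"
  then show "(X, (\<lambda>(h', a') (h, a). (h' \<bullet> h, a' \<bullet> a)) g f, Z) \<in> Ar (ModE F)"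
    using ModE_comp by (cases X; cases Y; cases Z; cases f; cases g) simp
next
  fix X Y f assume a: "(X, f, Y) \<in> Ar (ModE F)"
  obtain R M where X: "X = (R, M)" by (cases X)
  obtain S N where Y: "Y = (S, N)" by (cases Y)
  obtain h b where f: "f = (h, b)" by (cases f)
  note 1 = ModE_ArD[OF a[unfolded X Y f]]
  note [simp] = 1 MonE_ArD[OF 1(3)]
  show "(\<lambda>(h', a') (h, a). (h' \<bullet> h, a' \<bullet> a)) f ((\<lambda>((R, m, e), (M, k)). (iE R, iE M)) X) = f \<and> (\<lambda>(h', a') (h, a). (h' \<bullet> h, a' \<bullet> a)) ((\<lambda>((R, m, e), (M, k)). (iE R, iE M)) Y) f = f"
    unfolding X Y f by (simp add: case_prod_unfold)
next
  fix X Y Z W f g h assume a: "(X, f, Y) \<in> Ar (ModE F)" "(Y, g, Z) \<in> Ar (ModE F)" "(Z, h, W) \<in> Ar (ModE F)"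
  obtain X1 X2 Y1 Y2 Z1 Z2 W1 W2 f1 f2 g1 g2 h1 h2 where
    e: "X = (X1, X2)" "Y = (Y1, Y2)" "Z = (Z1, Z2)" "W = (W1, W2)" "f = (f1, f2)" "g = (g1, g2)" "h = (h1, h2)"
    by (cases X; cases Y; cases Z; cases W; cases f; cases g; cases h)
  note 1 = a[unfolded e, THEN ModE_ArD(3), THEN MonE_ArD(3)] a[unfolded e, THEN ModE_ArD(3), THEN MonE_ArD(4)]
    a[unfolded e, THEN ModE_ArD(3), THEN MonE_ArD(5)] a[unfolded e, THEN ModE_ArD(4)]
    a[unfolded e, THEN ModE_ArD(5)] a[unfolded e, THEN ModE_ArD(6)]
  show "(\<lambda>(h', a') (h, a). (h' \<bullet> h, a' \<bullet> a)) ((\<lambda>(h', a') (h, a). (h' \<bullet> h, a' \<bullet> a)) h g) f = (\<lambda>(h', a') (h, a). (h' \<bullet> h, a' \<bullet> a)) h ((\<lambda>(h', a') (h, a). (h' \<bullet> h, a' \<bullet> a)) g f)"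
    unfolding e using 1 by simp
qed

lemma ModE_simps [simp]:
  "Dom (ModE F) (X, x, Y) = X" "Cod (ModE F) (X, x, Y) = Y"
  "Idn (ModE F) X = (X, (iE (fst (fst X)), iE (fst (snd X))), X)"
  "(Y', (g, b), Z) \<cdot>\<^bsub>ModE F\<^esub> (X, (h, a), Y) = (X, (g \<bullet> h, b \<bullet> a), Z)"
  by (simp_all add: ModE_def hom_cat_def case_prod_unfold)

lemma MonE_Ob_simps: "R \<in> Ob (MonE F) \<Longrightarrow> fst R \<in> Ob E"
  using MonE_ObD(1) by (cases R) auto

lemma MonE_cases:
  assumes "x \<in> Ar (MonE F)"
  obtains R h S where "x = (R, h, S)" "(R, h, S) \<in> Ar (MonE F)"
  using assms by (cases x) auto

lemma ModE_cases:
  assumes "x \<in> Ar (ModE F)"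
  obtains R M h a S N where "x = ((R, M), (h, a), (S, N))" "((R, M), (h, a), (S, N)) \<in> Ar (ModE F)"
  using assms by (cases x) (metis surj_pair)

lemma functor_MonE_proj: "is_functor (MonE F) B (MonE_proj F)"
  unfolding is_functor_def
proof (intro conjI ballI impI)
  show "FO (MonE_proj F) X \<in> Ob B" "FA (MonE_proj F) (Idn (MonE F) X) = iB (FO (MonE_proj F) X)"
    if "X \<in> Ob (MonE F)" for X
    using MonE_Ob_simps[OF that] by (simp_all add: MonE_proj_def)
  show "FA (MonE_proj F) x \<in> hom B (FO (MonE_proj F) (Dom (MonE F) x)) (FO (MonE_proj F) (Cod (MonE F) x))"
    if "x \<in> Ar (MonE F)" for x
    by (rule MonE_cases[OF that]) (auto simp: MonE_proj_def hom_def MonE_ArD)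
  show "FA (MonE_proj F) (y \<cdot>\<^bsub>MonE F\<^esub> x) = FA (MonE_proj F) y \<cdot>\<^bsub>B\<^esub> FA (MonE_proj F) x"
    if x: "x \<in> Ar (MonE F)" and y: "y \<in> Ar (MonE F)" and "Cod (MonE F) x = Dom (MonE F) y" for x y
    by (rule MonE_cases[OF x], rule MonE_cases[OF y])
       (use that in \<open>auto simp: MonE_proj_def MonE_ArD\<close>)
qed simp_all

lemma functor_Mod_proj: "is_functor (ModE F) (MonE F) Mod_proj"
  unfolding is_functor_def
proof (intro conjI ballI impI)
  show "FO Mod_proj X \<in> Ob (MonE F)" "FA Mod_proj (Idn (ModE F) X) = Idn (MonE F) (FO Mod_proj X)"
    if "X \<in> Ob (ModE F)" for X
    using that ModE_ObD(1)[of "fst X" "fst (snd X)" "snd (snd X)"]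
    by (simp_all add: Mod_proj_def case_prod_unfold)
  show "FA Mod_proj x \<in> hom (MonE F) (FO Mod_proj (Dom (ModE F) x)) (FO Mod_proj (Cod (ModE F) x))"
    if "x \<in> Ar (ModE F)" for x
    by (rule ModE_cases[OF that]) (auto simp: Mod_proj_def hom_def ModE_ArD)
  show "FA Mod_proj (y \<cdot>\<^bsub>ModE F\<^esub> x) = FA Mod_proj y \<cdot>\<^bsub>MonE F\<^esub> FA Mod_proj x"
    if x: "x \<in> Ar (ModE F)" and y: "y \<in> Ar (ModE F)" and "Cod (ModE F) x = Dom (ModE F) y" for x y
    by (rule ModE_cases[OF x], rule ModE_cases[OF y])
       (use that in \<open>auto simp: Mod_proj_def\<close>)
qed simp_all

section \<open>Induced structures\<close>

lemma MonE_over: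
  assumes "(R, h, S) \<in> Ar (MonE F)" "PA h = f"
  shows "P (fst R) = Dom B f" and "P (fst S) = Cod B f"
  using MonE_ArD[OF assms(1)] proj_simps(5,6)[of h] assms(2) by simp_all

text \<open>The structure maps are the vertical factorisations through \<open>k\<close> of \<open>n \<cdot> (k \<otimes> k)\<close> and of
  \<open>l \<cdot> u(f)\<close>, where \<open>n\<close> and \<open>l\<close> are the structure maps of \<open>S\<close>.\<close>

lemma monoid_lift:
  assumes S: "S \<in> Ob (MonE F)" and k: "cart k" "Cod E k = fst S"
  shows "\<exists>R. fst R = Dom E k \<and> (R, k, S) \<in> Ar (MonE F)"
proof -
  obtain S0 n l where S': "S = (S0, n, l)" by (cases S)
  note [simp] = MonE_ObD[OF S[unfolded S']]
  have k': "k \<in> Ar E" "Cod E k = S0" using k cart_Ar S' by auto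
  obtain f where f: "PA k = f" by simp
  have P: "P S0 = Cod B f" "P (Dom E k) = Dom B f" "f \<in> Ar B"
    using proj_simps(4,5,6)[OF k'(1)] unfolding f k'(2) by auto
  note [simp] = k' f P
  obtain m where m: "m \<in> Ar E" "Dom E m = Dom E (n \<bullet> (k \<star> k))" "Cod E m = Dom E k"
    "PA m = iB (Dom B f)" "k \<bullet> m = n \<bullet> (k \<star> k)"
    by (rule cartesian_factor[OF k(1), of "n \<bullet> (k \<star> k)" "iB (Dom B f)"]) simp_all
  obtain e where e: "e \<in> Ar E" "Dom E e = Dom E (l \<bullet> UA f)" "Cod E e = Dom E k"
    "PA e = iB (Dom B f)" "k \<bullet> e = l \<bullet> UA f"
    by (rule cartesian_factor[OF k(1), of "l \<bullet> UA f" "iB (Dom B f)"]) simp_all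
  have "(Dom E k, m, e) \<in> monoids (fibre F (Dom B f))"
    by (rule monoid_laws_lift[OF k(1) k'(2) refl f, of n l])
       (use S m e in \<open>simp_all add: S' MonE_Ob\<close>)
  then show ?thesis
    using S m(5) e(5) by (intro exI[of _ "(Dom E k, m, e)"]) (simp add: MonE_Ar S' MonE_Ob)
qed

text \<open>For \<open>h\<close> Cartesian this gives the induced module
  structure; for \<open>k\<close> an identity it gives restriction of scalars.\<close>

lemma module_lift:
  assumes SN: "(S, N) \<in> Ob (ModE F)" and h: "(R, h, S) \<in> Ar (MonE F)"
    and k: "cart k" "Cod E k = fst N" "PA k = PA h"
  shows "\<exists>M. fst M = Dom E k \<and> ((R, M), (h, k), (S, N)) \<in> Ar (ModE F)"
proof -
  obtain N0 s where N: "N = (N0, s)" by (cases N)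
  obtain S0 n l where S': "S = (S0, n, l)" by (cases S)
  obtain R0 m e where R: "R = (R0, m, e)" by (cases R)
  note o = ModE_ObD[OF SN[unfolded N]]
  note o2 = MonE_ObD[OF o(1)[unfolded S']]
  note hD = MonE_ArD[OF h]
  note o3 = MonE_ObD[OF hD(1)[unfolded R]]
  note hA = h[unfolded R S' MonE_Ar]
  obtain f where f: "PA h = f" by simp
  have k': "k \<in> Ar E" "Cod E k = N0" "PA k = f" using k cart_Ar N f by auto
  have P: "P R0 = Dom B f" "P S0 = Cod B f" "P N0 = Cod B f" "P (Dom E k) = Dom B f" "f \<in> Ar B"
    using MonE_over[OF h f] o(3) proj_simps(4,5)[OF k'(1)] unfolding k'(3) by (simp_all add: R S')
  note [simp] = k' f P
  note [simp] = o2 o(2,4-7) o3 hD(3-5) R S'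
  obtain r where r: "r \<in> Ar E" "Dom E r = Dom E (s \<bullet> (k \<star> h))" "Cod E r = Dom E k"
    "PA r = iB (Dom B f)" "k \<bullet> r = s \<bullet> (k \<star> h)"
    by (rule cartesian_factor[OF k(1), of "s \<bullet> (k \<star> h)" "iB (Dom B f)"]) simp_all
  have "(Dom E k, r) \<in> right_modules (fibre F (Dom B f)) R"
    unfolding R
    by (rule module_laws_lift[OF k(1) k'(2) refl k'(3) hD(3) _ _ f, where n = n and l = l])
       (use SN hA r in \<open>simp_all add: ModE_Ob N\<close>)
  then show ?thesis
    using SN h hA r(5) unfolding N
    by (intro exI[of _ "(Dom E k, r)"]) (simp add: ModE_Ar ModE_Ob)
qed

lemma monoid_lift_unique:
  assumes R: "(R, k, S) \<in> Ar (MonE F)" "(R', k, S) \<in> Ar (MonE F)" and k: "cart k"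
  shows "R = R'"
proof -
  obtain R0 m e where R0: "R = (R0, m, e)" by (cases R)
  obtain R1 m' e' where R1: "R' = (R1, m', e')" by (cases R')
  obtain S0 n l where S: "S = (S0, n, l)" by (cases S)
  note a = R(1)[unfolded R0 S MonE_Ar] R(2)[unfolded R1 S MonE_Ar]
  note [simp] = MonE_ObD[OF conjunct1[OF a(1)]] MonE_ObD[OF conjunct1[OF a(2)]]
  have "R0 = R1" using a by auto
  moreover have "m = m'" by (rule cart_cancel[OF k]) (use a in auto)
  moreover have "e = e'" by (rule cart_cancel[OF k]) (use a in auto)
  ultimately show ?thesis by (simp add: R0 R1)
qed

lemma module_lift_unique:
  assumes M: "((R, M), (h, k), (S, N)) \<in> Ar (ModE F)" "((R, M'), (h, k), (S, N)) \<in> Ar (ModE F)"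
    and k: "cart k"
  shows "M = M'"
proof -
  obtain M0 r where M0: "M = (M0, r)" by (cases M)
  obtain M1 r' where M1: "M' = (M1, r')" by (cases M')
  note a = ModE_ArD[OF M(1)] and a' = ModE_ArD[OF M(2)]
  note [simp] = ModE_ObD[OF a(1)[unfolded M0]] ModE_ObD[OF a'(1)[unfolded M1]]
  have eq: "M0 = M1" using a(5) a'(5) by (simp add: M0 M1)
  moreover have "r = r'"
    by (rule cart_cancel[OF k]) (use eq a(5,8) a'(5,8) in \<open>auto simp: M0 M1\<close>)
  ultimately show ?thesis by (simp add: M0 M1)
qed

lemma induced_monoid_arrow:
  assumes "S \<in> Ob (MonE F)" "cart k" "Cod E k = fst S"
  shows "fst (induced_monoid F k S) = Dom E k" and "(induced_monoid F k S, k, S) \<in> Ar (MonE F)"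
proof -
  have "\<exists>!R. fst R = Dom E k \<and> (R, k, S) \<in> Ar (MonE F)"
    using monoid_lift[OF assms] monoid_lift_unique[OF _ _ assms(2)] by blast
  from theI'[OF this]
  show "fst (induced_monoid F k S) = Dom E k" "(induced_monoid F k S, k, S) \<in> Ar (MonE F)"
    by (auto simp: induced_monoid_def)
qed

lemma induced_module_arrow:
  assumes SN: "(S, N) \<in> Ob (ModE F)" and k: "cart k" "Cod E k = fst S"
    and k': "cart k'" "Cod E k' = fst N" "PA k' = PA k"
  shows "fst (induced_module F k k' S N) = Dom E k'"
    and "((induced_monoid F k S, induced_module F k k' S N), (k, k'), (S, N)) \<in> Ar (ModE F)"
proof -
  have S: "S \<in> Ob (MonE F)" using ModE_ObD(1) SN by (cases N) blast
  have "\<exists>!M. fst M = Dom E k' \<and> ((induced_monoid F k S, M), (k, k'), (S, N)) \<in> Ar (ModE F)"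
    using module_lift[OF SN induced_monoid_arrow(2)[OF S k] k'] module_lift_unique[OF _ _ k'(1)] by blast
  from theI'[OF this]
  show "fst (induced_module F k k' S N) = Dom E k'"
    "((induced_monoid F k S, induced_module F k k' S N), (k, k'), (S, N)) \<in> Ar (ModE F)"
    by (auto simp: induced_module_def)
qed

text \<open>Restriction of scalars is the structure lifted along an identity of \<open>E\<close>, which is Cartesian.\<close>

lemma restrict_scalars_arrow:
  assumes SN: "(S, N) \<in> Ob (ModE F)" and h: "(R, h, S) \<in> Ar (MonE F)" and v: "PA h = iB A" "A \<in> Ob B"
  shows "((R, restrict_scalars (fibre F A) h N), (h, iE (fst N)), (S, N)) \<in> Ar (ModE F)"
proof -
  obtain N0 s where N: "N = (N0, s)" by (cases N)
  note o [simp] = ModE_ObD[OF SN[unfolded N]]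
  note hD = MonE_ArD[OF h]
  have P: "P (fst S) = A" using MonE_over(2)[OF h v(1)] v(2) by simp
  obtain M where M: "fst M = N0" "((R, M), (h, iE N0), (S, N)) \<in> Ar (ModE F)"
    using module_lift[OF SN h cartesian_Idn[OF functor_proj o(2)]] v P N by auto
  obtain r where M': "M = (N0, r)" using M(1) by (cases M) simp
  note a = ModE_ArD[OF M(2)]
  note [simp] = ModE_ObD[OF a(1)[unfolded M']]
  have "r = s \<bullet> (iE N0 \<star> h)" using a(8) by (simp add: M' N)
  then have "M = restrict_scalars (fibre F A) h N" by (simp add: M' N restrict_scalars_def)
  then show ?thesis using M N by simp
qed

section \<open>The fibrations of monoids and of modules\<close>

lemma mon_factor:
  assumes k: "(R, k, S) \<in> Ar (MonE F)" "cart k" and x: "(Q, k \<bullet> v, S) \<in> Ar (MonE F)"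
    and v: "v \<in> Ar E" "Dom E v = fst Q" "Cod E v = fst R"
  shows "(Q, v, R) \<in> Ar (MonE F)"
proof -
  obtain R0 m e where R: "R = (R0, m, e)" by (cases R)
  obtain S0 n l where S: "S = (S0, n, l)" by (cases S)
  obtain Q0 q d where Q: "Q = (Q0, q, d)" by (cases Q)
  note a = k(1)[unfolded R S MonE_Ar] x[unfolded Q S MonE_Ar]
  note o = MonE_ObD[OF conjunct1[OF a(1)]] MonE_ObD[OF conjunct1[OF conjunct2[OF a(1)]]]
    MonE_ObD[OF conjunct1[OF a(2)]]
  note [simp] = o
  have [simp]: "k \<in> Ar E" "Dom E k = R0" "Cod E k = S0" "v \<in> Ar E" "Dom E v = Q0" "Cod E v = R0"
    using a v R Q by auto
  have "v \<bullet> q = m \<bullet> (v \<star> v)"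
    by (rule action_factor[OF k(2), where kS = k and s = n]) (use a in auto)
  moreover have "v \<bullet> d = e \<bullet> UA (PA v)"
  proof (rule cart_cancel[OF k(2)])
    have "k \<bullet> (v \<bullet> d) = (k \<bullet> v) \<bullet> d" by simp
    also have "\<dots> = l \<bullet> UA (PA (k \<bullet> v))" using a by simp
    also have "\<dots> = l \<bullet> UA (PA k) \<bullet> UA (PA v)" by simp
    also have "l \<bullet> UA (PA k) = k \<bullet> e" using a by simp
    finally show "k \<bullet> (v \<bullet> d) = k \<bullet> (e \<bullet> UA (PA v))" by simp
  qed simp_all
  ultimately show ?thesis using a v by (simp add: R Q MonE_Ar)
qed

text \<open>Together with the preceding lemma this reduces Cartesianness of an arrow of monoids or of modules
  to Cartesianness of its components in \<open>E\<close>.\<close>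

lemma mod_factor:
  assumes k: "((R, M), (h, k), (S, N)) \<in> Ar (ModE F)" "cart k"
    and x: "((Q, L), (h \<bullet> w, k \<bullet> y), (S, N)) \<in> Ar (ModE F)"
    and w: "(Q, w, R) \<in> Ar (MonE F)" and y: "y \<in> Ar E" "Dom E y = fst L" "Cod E y = fst M" "PA y = PA w"
  shows "((Q, L), (w, y), (R, M)) \<in> Ar (ModE F)"
proof -
  obtain M0 r where M: "M = (M0, r)" by (cases M)
  obtain N0 s where N: "N = (N0, s)" by (cases N)
  obtain L0 t where L: "L = (L0, t)" by (cases L)
  note a = ModE_ArD[OF k(1)] and b = ModE_ArD[OF x]
  note oM = ModE_ObD[OF a(1)[unfolded M]] and oN = ModE_ObD[OF a(2)[unfolded N]]
    and oL = ModE_ObD[OF b(1)[unfolded L]]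
  note hD = MonE_ArD[OF a(3)] and wD = MonE_ArD[OF w]
  have "y \<bullet> t = r \<bullet> (y \<star> w)"
    by (rule action_factor[OF k(2), where kS = h and s = s])
       (use y a(4-8) b(8) oM oN oL hD(3-5) wD(3-5) in \<open>simp_all add: M N L\<close>)
  then show ?thesis
    using a b w y by (intro ModE_ArI) (simp_all add: M L)
qed

lemma mon_cartesian:
  assumes k: "(R, k, S) \<in> Ar (MonE F)" "cart k"
  shows "cartesian (MonE F) B (MonE_proj F) (R, k, S)"
  unfolding cartesian_def
proof (intro conjI ballI impI)
  fix x w
  assume x: "x \<in> Ar (MonE F)" and w: "w \<in> hom B (FO (MonE_proj F) (Dom (MonE F) x)) (FO (MonE_proj F) (Dom (MonE F) (R, k, S)))"
    and c: "Cod (MonE F) x = Cod (MonE F) (R, k, S)"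
    and e: "FA (MonE_proj F) (R, k, S) \<cdot>\<^bsub>B\<^esub> w = FA (MonE_proj F) x"
  obtain Q h where x': "x = (Q, h, S)" "(Q, h, S) \<in> Ar (MonE F)"
    by (rule MonE_cases[OF x]) (use c in auto)
  note hD = MonE_ArD[OF x'(2)] and kD = MonE_ArD[OF k(1)]
  have w': "w \<in> Ar B" "Dom B w = P (fst Q)" "Cod B w = P (fst R)" "PA k \<cdot>\<^bsub>B\<^esub> w = PA h"
    using w e x' by (auto simp: hom_def MonE_proj_def)
  obtain v where v: "v \<in> Ar E" "Dom E v = Dom E h" "Cod E v = Dom E k" "PA v = w" "k \<bullet> v = h"
    by (rule cartesian_factor[OF k(2) hD(3), of w]) (use w' hD kD in simp_all)
  have vA: "(Q, v, R) \<in> Ar (MonE F)"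
    by (rule mon_factor[OF k]) (use v x' hD kD in simp_all)
  show "\<exists>!u. u \<in> hom (MonE F) (Dom (MonE F) x) (Dom (MonE F) (R, k, S)) \<and>
      FA (MonE_proj F) u = w \<and> (R, k, S) \<cdot>\<^bsub>MonE F\<^esub> u = x"
  proof (rule ex1I[of _ "(Q, v, R)"])
    show "(Q, v, R) \<in> hom (MonE F) (Dom (MonE F) x) (Dom (MonE F) (R, k, S)) \<and>
      FA (MonE_proj F) (Q, v, R) = w \<and> (R, k, S) \<cdot>\<^bsub>MonE F\<^esub> (Q, v, R) = x"
      using v vA x' by (simp add: hom_def MonE_proj_def)
    fix u assume u: "u \<in> hom (MonE F) (Dom (MonE F) x) (Dom (MonE F) (R, k, S)) \<and>
      FA (MonE_proj F) u = w \<and> (R, k, S) \<cdot>\<^bsub>MonE F\<^esub> u = x"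
    obtain v' where u': "u = (Q, v', R)"
      using u x' by (cases u) (auto simp: hom_def)
    have v': "(Q, v', R) \<in> Ar (MonE F)" "PA v' = w" "k \<bullet> v' = h"
      using u x' by (auto simp: hom_def MonE_proj_def u')
    have "v' = v"
      by (rule cart_cancel[OF k(2)]) (use v v' hD kD MonE_ArD[OF v'(1)] in simp_all)
    then show "u = (Q, v, R)" by (simp add: u')
  qed
qed (rule k)

text \<open>Given the component on monoids, the factorisation of the component on modules is forced, and
  exists because \<open>k\<close> is Cartesian.\<close>

lemma mod_cartesian:
  assumes k: "((R, M), (h, k), (S, N)) \<in> Ar (ModE F)" "cart k"
  shows "cartesian (ModE F) (MonE F) Mod_proj ((R, M), (h, k), (S, N))"
  unfolding cartesian_def
proof (intro conjI ballI impI)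
  let ?k = "((R, M), (h, k), (S, N))"
  fix x w
  assume x: "x \<in> Ar (ModE F)" and w: "w \<in> hom (MonE F) (FO Mod_proj (Dom (ModE F) x)) (FO Mod_proj (Dom (ModE F) ?k))"
    and c: "Cod (ModE F) x = Cod (ModE F) ?k"
    and e: "FA Mod_proj ?k \<cdot>\<^bsub>MonE F\<^esub> w = FA Mod_proj x"
  obtain Q L g a where x': "x = ((Q, L), (g, a), (S, N))" "((Q, L), (g, a), (S, N)) \<in> Ar (ModE F)"
    by (rule ModE_cases[OF x]) (use c in auto)
  obtain w' where w': "w = (Q, w', R)"
    using w x' by (cases w) (auto simp: hom_def Mod_proj_def)
  have wA: "(Q, w', R) \<in> Ar (MonE F)" and hw: "h \<bullet> w' = g"
    using w e x' by (auto simp: hom_def Mod_proj_def w')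
  note aD = ModE_ArD[OF x'(2)] and kD = ModE_ArD[OF k(1)]
  note gD = MonE_ArD[OF aD(3)] and hD = MonE_ArD[OF kD(3)] and wD = MonE_ArD[OF wA]
  have P: "P (fst L) = P (fst Q)" "P (fst M) = P (fst R)"
    using ModE_ObD(3)[of Q "fst L" "snd L"] ModE_ObD(3)[of R "fst M" "snd M"] aD(1) kD(1) by simp_all
  obtain v where v: "v \<in> Ar E" "Dom E v = Dom E a" "Cod E v = Dom E k" "PA v = PA w'" "k \<bullet> v = a"
    by (rule cartesian_factor[OF k(2) aD(4), of "PA w'"]) (use hw aD kD gD hD wD P in auto)
  have vA: "((Q, L), (w', v), (R, M)) \<in> Ar (ModE F)"
    by (rule mod_factor[OF k]) (use v x' hw wA aD kD in simp_all)
  show "\<exists>!u. u \<in> hom (ModE F) (Dom (ModE F) x) (Dom (ModE F) ?k) \<and>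
      FA Mod_proj u = w \<and> ?k \<cdot>\<^bsub>ModE F\<^esub> u = x"
  proof (rule ex1I[of _ "((Q, L), (w', v), (R, M))"])
    show "((Q, L), (w', v), (R, M)) \<in> hom (ModE F) (Dom (ModE F) x) (Dom (ModE F) ?k) \<and>
      FA Mod_proj ((Q, L), (w', v), (R, M)) = w \<and> ?k \<cdot>\<^bsub>ModE F\<^esub> ((Q, L), (w', v), (R, M)) = x"
      using v vA x' hw by (simp add: hom_def Mod_proj_def w')
    fix u assume u: "u \<in> hom (ModE F) (Dom (ModE F) x) (Dom (ModE F) ?k) \<and>
      FA Mod_proj u = w \<and> ?k \<cdot>\<^bsub>ModE F\<^esub> u = x"
    have uA: "u \<in> Ar (ModE F)" using u by (simp add: hom_def)
    obtain h' v' where u': "u = ((Q, L), (h', v'), (R, M))"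
      by (rule ModE_cases[OF uA]) (use u x' in \<open>auto simp: hom_def\<close>)
    have v': "((Q, L), (h', v'), (R, M)) \<in> Ar (ModE F)" "h' = w'" "k \<bullet> v' = a"
      using u x' by (auto simp: hom_def Mod_proj_def u' w')
    have "v' = v"
      by (rule cart_cancel[OF k(2)]) (use v v' aD kD ModE_ArD[OF v'(1)] in simp_all)
    then show "u = ((Q, L), (w', v), (R, M))" by (simp add: u' v')
  qed
qed (rule k)

lemma fibration_MonE: "fibration (MonE F) B (MonE_proj F)"
  unfolding fibration_def
proof (intro conjI functor_MonE_proj ballI impI)
  fix f S assume f: "f \<in> Ar B" and S: "S \<in> Ob (MonE F)" "FO (MonE_proj F) S = Cod B f"
  obtain k where "cartesian_lift E B (proj F) f (fst S) k"
    using fibration_proj f MonE_Ob_simps[OF S(1)] S(2) unfolding fibration_def MonE_proj_def by auto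
  then have k: "cart k" "PA k = f" "Cod E k = fst S" by (auto simp: cartesian_lift_def)
  obtain R where "(R, k, S) \<in> Ar (MonE F)" using monoid_lift[OF S(1) k(1,3)] by blast
  then have "cartesian_lift (MonE F) B (MonE_proj F) f S (R, k, S)"
    using k mon_cartesian by (simp add: cartesian_lift_def MonE_proj_def)
  then show "\<exists>k. cartesian_lift (MonE F) B (MonE_proj F) f S k" by blast
qed

lemma fibration_ModE: "fibration (ModE F) (MonE F) Mod_proj"
  unfolding fibration_def
proof (intro conjI functor_Mod_proj ballI impI)
  fix x Y assume x: "x \<in> Ar (MonE F)" and Y: "Y \<in> Ob (ModE F)" "FO Mod_proj Y = Cod (MonE F) x"
  obtain S N where Y': "Y = (S, N)" by (cases Y)
  obtain R h where x': "x = (R, h, S)" "(R, h, S) \<in> Ar (MonE F)"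
    by (rule MonE_cases[OF x]) (use Y in \<open>auto simp: Mod_proj_def Y'\<close>)
  have N: "fst N \<in> Ob E" "P (fst N) = P (fst S)"
    using ModE_ObD(2,3)[of S "fst N" "snd N"] Y Y' by auto
  obtain k where "cartesian_lift E B (proj F) (PA h) (fst N) k"
    using fibration_proj MonE_ArD(3)[OF x'(2)] MonE_over(2)[OF x'(2) refl] N
    unfolding fibration_def by (metis proj_simps(4))
  then have k: "cart k" "PA k = PA h" "Cod E k = fst N" by (auto simp: cartesian_lift_def)
  obtain M where "((R, M), (h, k), (S, N)) \<in> Ar (ModE F)"
    using module_lift[OF Y(1)[unfolded Y'] x'(2) k(1,3,2)] by blast
  then have "cartesian_lift (ModE F) (MonE F) Mod_proj x Y ((R, M), (h, k), (S, N))"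
    using k mod_cartesian x' Y' by (simp add: cartesian_lift_def Mod_proj_def)
  then show "\<exists>k. cartesian_lift (ModE F) (MonE F) Mod_proj x Y k" by blast
qed

text \<open>Both factors have Cartesian module components, \<open>fN\<close> and an identity, so each is Cartesian over
  its image in the category of monoids. The horizontal factor is moreover Cartesian over the base, because its
  image \<open>fS\<close> is.\<close>

lemma composite_cartesian_lift:
  fixes R S N fS fN h
  defines "A \<equiv> P (fst R)" and "S' \<equiv> induced_monoid F fS S" and "N' \<equiv> induced_module F fS fN S N"
    and "h' \<equiv> vert_fact F fS h"
  defines "N'' \<equiv> restrict_scalars (fibre F A) h' N'"
  defines "vert \<equiv> ((R, N''), (h', iE (fst N')), (S', N'))" and "horiz \<equiv> ((S', N'), (fS, fN), (S, N))"
  assumes h: "(R, h, S) \<in> Ar (MonE F)" and SN: "(S, N) \<in> Ob (ModE F)"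
    and fS: "cartesian_lift E B (proj F) (PA h) (fst S) fS"
    and fN: "cartesian_lift E B (proj F) (PA h) (fst N) fN"
  shows "cartesian_lift (ModE F) (MonE F) Mod_proj (R, h', S') (S', N') vert"
    and "FA (ModE_proj F) vert = iB A"
    and "cartesian_lift (ModE F) (MonE F) Mod_proj (S', fS, S) (S, N) horiz"
    and "cartesian_lift (ModE F) B (ModE_proj F) (PA h) (S, N) horiz"
    and "cartesian_lift (ModE F) (MonE F) Mod_proj (R, h, S) (S, N) (horiz \<cdot>\<^bsub>ModE F\<^esub> vert)"
    and "Dom (ModE F) (horiz \<cdot>\<^bsub>ModE F\<^esub> vert) = (R, N'')"
proof -
  have S: "S \<in> Ob (MonE F)" using ModE_ObD(1) SN by (cases N) blast
  have kS: "cart fS" "Cod E fS = fst S" "PA fS = PA h"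
    and kN: "cart fN" "Cod E fN = fst N" "PA fN = PA fS"
    using fS fN by (auto simp: cartesian_lift_def)
  note hD = MonE_ArD[OF h]
  have S': "fst S' = Dom E fS" "(S', fS, S) \<in> Ar (MonE F)"
    unfolding S'_def by (rule induced_monoid_arrow[OF S kS(1,2)])+
  have hor: "fst N' = Dom E fN" "horiz \<in> Ar (ModE F)"
    unfolding S'_def N'_def horiz_def by (rule induced_module_arrow[OF SN kS(1,2) kN])+
  have h': "h' \<in> Ar E" "Dom E h' = fst R" "Cod E h' = Dom E fS" "PA h' = iB A" "fS \<bullet> h' = h"
    using vert_fact_props[OF kS(1) hD(3)] kS hD unfolding h'_def A_def by simp_all
  have A: "A \<in> Ob B" using MonE_Ob_simps[OF hD(1)] unfolding A_def by simp
  have h'A: "(R, h', S') \<in> Ar (MonE F)"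
    by (rule mon_factor[OF S'(2) kS(1)]) (use h h' S' in simp_all)
  have SN': "(S', N') \<in> Ob (ModE F)" using ModE_ArD(1) hor(2) unfolding horiz_def by blast
  have "fst N' \<in> Ob E" using ModE_ObD(2)[of S' "fst N'" "snd N'"] SN' by simp
  then have id: "cart (iE (fst N'))" by (rule cartesian_Idn[OF functor_proj])
  have ver: "vert \<in> Ar (ModE F)"
    unfolding vert_def N''_def by (rule restrict_scalars_arrow[OF SN' h'A h'(4) A])
  have 1: "cartesian (ModE F) (MonE F) Mod_proj vert"
    using ver mod_cartesian[OF _ id] unfolding vert_def by blast
  have 2: "cartesian (ModE F) (MonE F) Mod_proj horiz"
    using hor mod_cartesian[OF _ kN(1)] unfolding horiz_def by blast
  show "cartesian_lift (ModE F) (MonE F) Mod_proj (R, h', S') (S', N') vert"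
    using 1 by (simp add: cartesian_lift_def vert_def Mod_proj_def)
  show "FA (ModE_proj F) vert = iB A"
    using h' by (simp add: vert_def ModE_proj_def Mod_proj_def MonE_proj_def comp_func_def)
  show "cartesian_lift (ModE F) (MonE F) Mod_proj (S', fS, S) (S, N) horiz"
    using 2 by (simp add: cartesian_lift_def horiz_def Mod_proj_def)
  have "cartesian (ModE F) B (ModE_proj F) horiz"
    unfolding ModE_proj_def
    by (rule cartesian_over[OF functor_Mod_proj functor_MonE_proj 2])
       (use mon_cartesian[OF S'(2) kS(1)] in \<open>simp add: horiz_def Mod_proj_def\<close>)
  then show "cartesian_lift (ModE F) B (ModE_proj F) (PA h) (S, N) horiz"
    using kS by (simp add: cartesian_lift_def horiz_def ModE_proj_def Mod_proj_def MonE_proj_def comp_func_def)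
  have "cartesian (ModE F) (MonE F) Mod_proj (horiz \<cdot>\<^bsub>ModE F\<^esub> vert)"
    by (rule cartesian_comp[OF functor_Mod_proj 2 1]) (simp add: horiz_def vert_def)
  then show "cartesian_lift (ModE F) (MonE F) Mod_proj (R, h, S) (S, N) (horiz \<cdot>\<^bsub>ModE F\<^esub> vert)"
    using h' by (simp add: cartesian_lift_def horiz_def vert_def Mod_proj_def)
  show "Dom (ModE F) (horiz \<cdot>\<^bsub>ModE F\<^esub> vert) = (R, N'')"
    by (simp add: horiz_def vert_def)
qed

section \<open>The fibres over an object of the base\<close>

lemma monoids_fibre_iff: "A \<in> Ob B \<Longrightarrow> R \<in> monoids (fibre F A) \<longleftrightarrow> R \<in> Ob (MonE F) \<and> P (fst R) = A"
  by (cases R) (auto simp: MonE_Ob monoids_def)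

text \<open>Over an identity the unit condition \<open>h \<cdot> e = l \<cdot> u(1)\<close> becomes \<open>h \<cdot> e = l\<close>, the condition for a
  morphism of monoids in the fibre.\<close>

lemma MonE_Ar_fibre:
  assumes A: "A \<in> Ob B"
  shows "(R, h, S) \<in> Ar (Mon_cat (fibre F A)) \<longleftrightarrow> (R, h, S) \<in> Ar (MonE F) \<and> PA h = iB A"
proof -
  obtain R0 m e where R: "R = (R0, m, e)" by (cases R)
  obtain S0 n l where S: "S = (S0, n, l)" by (cases S)
  show ?thesis
  proof
    assume a: "(R, h, S) \<in> Ar (Mon_cat (fibre F A))"
    then have o: "R \<in> Ob (MonE F)" "S \<in> Ob (MonE F)" "P S0 = A" and h: "h \<in> Ar E" "Dom E h = R0" "Cod E h = S0"
      "PA h = iB A" "h \<bullet> m = n \<bullet> (h \<star> h)" "h \<bullet> e = l"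
      using A by (auto simp: Mon_cat_def hom_cat_def monoids_fibre_iff R S)
    then show "(R, h, S) \<in> Ar (MonE F) \<and> PA h = iB A"
      using A MonE_ObD(6-8)[of S0 n l] by (simp add: R S MonE_Ar)
  next
    assume "(R, h, S) \<in> Ar (MonE F) \<and> PA h = iB A"
    then have a: "(R, h, S) \<in> Ar (MonE F)" and v: "PA h = iB A" by auto
    have P: "P R0 = A" "P S0 = A" using MonE_over[OF a v] A by (simp_all add: R S)
    show "(R, h, S) \<in> Ar (Mon_cat (fibre F A))"
      using a v A P MonE_ObD(6-8)[of S0 n l]
      by (simp add: R S Mon_cat_def hom_cat_def monoids_fibre_iff MonE_Ar)
  qed
qed

lemma fibre_MonE:
  assumes A: "A \<in> Ob B"
  shows "fibre_cat (MonE F) B (MonE_proj F) A = Mon_cat (fibre F A)"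
proof (rule cat.equality)
  show "Ob (fibre_cat (MonE F) B (MonE_proj F) A) = Ob (Mon_cat (fibre F A))"
    using monoids_fibre_iff[OF A] by (auto simp: fibre_cat_def MonE_proj_def Mon_cat_def hom_cat_def)
  show "Ar (fibre_cat (MonE F) B (MonE_proj F) A) = Ar (Mon_cat (fibre F A))"
  proof (intro set_eqI)
    fix x :: "('o, 'm) mon_ar"
    obtain R h S where x: "x = (R, h, S)" by (cases x)
    show "x \<in> Ar (fibre_cat (MonE F) B (MonE_proj F) A) \<longleftrightarrow> x \<in> Ar (Mon_cat (fibre F A))"
      unfolding x MonE_Ar_fibre[OF A]
      using A MonE_over[of R h S "iB A"] by (auto simp: fibre_cat_def MonE_proj_def)
  qed
qed (simp_all add: fibre_cat_def MonE_def Mon_cat_def hom_cat_def)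

lemma modules_fibre_iff: "A \<in> Ob B \<Longrightarrow>
    R \<in> monoids (fibre F A) \<and> M \<in> right_modules (fibre F A) R \<longleftrightarrow> (R, M) \<in> Ob (ModE F) \<and> P (fst R) = A"
  by (cases R; cases M) (auto simp: ModE_Ob monoids_fibre_iff)

lemma ModE_Ar_fibre:
  assumes A: "A \<in> Ob B"
  shows "((R, M), (h, a), (S, N)) \<in> Ar (Mod_cat (fibre F A)) \<longleftrightarrow>
    ((R, M), (h, a), (S, N)) \<in> Ar (ModE F) \<and> PA h = iB A"
proof -
  obtain M0 r where M: "M = (M0, r)" by (cases M)
  obtain N0 s where N: "N = (N0, s)" by (cases N)
  have "R \<in> monoids (fibre F A) \<and> M \<in> right_modules (fibre F A) R \<longleftrightarrow> (R, M) \<in> Ob (ModE F)"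
    "S \<in> monoids (fibre F A) \<and> N \<in> right_modules (fibre F A) S \<longleftrightarrow> (S, N) \<in> Ob (ModE F)"
    if "(R, h, S) \<in> Ar (MonE F)" "PA h = iB A"
    using MonE_over[OF that] A modules_fibre_iff[OF A] by auto
  then show ?thesis
    using A by (auto simp: M N Mod_cat_def hom_cat_def MonE_Ar_fibre ModE_Ar)
qed

lemma fibre_ModE:
  assumes A: "A \<in> Ob B"
  shows "fibre_cat (ModE F) B (ModE_proj F) A = Mod_cat (fibre F A)"
proof (rule cat.equality)
  have p: "FO (ModE_proj F) (R, M) = P (fst R)" "FA (ModE_proj F) ((R, M), (h, a), (S, N)) = PA h" for R M h a S N
    by (simp_all add: ModE_proj_def MonE_proj_def Mod_proj_def comp_func_def)
  show "Ob (fibre_cat (ModE F) B (ModE_proj F) A) = Ob (Mod_cat (fibre F A))"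
    using modules_fibre_iff[OF A] p by (auto simp: fibre_cat_def Mod_cat_def hom_cat_def)
  show "Ar (fibre_cat (ModE F) B (ModE_proj F) A) = Ar (Mod_cat (fibre F A))"
  proof (intro set_eqI)
    fix x :: "('o, 'm) modl_ar"
    obtain R M h a S N where x: "x = ((R, M), (h, a), (S, N))" by (metis surj_pair)
    show "x \<in> Ar (fibre_cat (ModE F) B (ModE_proj F) A) \<longleftrightarrow> x \<in> Ar (Mod_cat (fibre F A))"
      unfolding x ModE_Ar_fibre[OF A]
      using A MonE_over[of R h S "iB A"] ModE_ArD(3)[of R M h a S N] p by (auto simp: fibre_cat_def)
  qed
qed (simp_all add: fibre_cat_def ModE_def Mod_cat_def hom_cat_def)

lemma fibres_isomorphic:
  assumes A: "A \<in> Ob B"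
  shows "isomorphic_fibrations
    (fibre_cat (ModE F) B (ModE_proj F) A) (fibre_cat (MonE F) B (MonE_proj F) A) Mod_proj
    (Mod_cat (fibre F A)) (Mon_cat (fibre F A)) Mod_proj"
proof -
  let ?M = "fibre_cat (ModE F) B (ModE_proj F) A" and ?N = "fibre_cat (MonE F) B (MonE_proj F) A"
  have fib: "fibration ?M ?N Mod_proj"
    by (rule fibration_fibre_cat[OF fibration_ModE functor_MonE_proj ModE_proj_def A])
  then have "category ?M" "category ?N"
    using functor_simps(1,2) by (auto simp: fibration_def)
  then have "isomorphic_fibrations ?M ?N Mod_proj ?M ?N Mod_proj"
    unfolding isomorphic_fibrations_def
    by (intro conjI exI[of _ id_func] fib cat_isomorphism_id)
       (simp_all add: func_eq_def comp_func_def id_func_def)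
  then show ?thesis by (simp only: fibre_ModE[OF A] fibre_MonE[OF A])
qed

section \<open>Inverse image functors\<close>

text \<open>Says that \<open>G\<close> is the inverse image functor along \<open>f\<close> for the Cartesian lifts \<open>\<kappa> X\<close>, with the lax monoidal
  structure forced by these lifts. The lifts are a parameter, so that composites of inverse images and identity
  functors are instances too.\<close>

definition inverse_image :: "'f \<Rightarrow> ('o \<Rightarrow> 'm) \<Rightarrow> ('o, 'm, 'o, 'm) laxfunc \<Rightarrow> bool" where
  "inverse_image f \<kappa> G \<longleftrightarrow> f \<in> Ar B \<and>
    (\<forall>X \<in> Ob (fibre F (Cod B f)). cartesian_lift E B (proj F) f X (\<kappa> X) \<and> FO G X = Dom E (\<kappa> X)) \<and>
    (\<forall>h \<in> Ar (fibre F (Cod B f)). FA G h \<in> hom (fibre F (Dom B f)) (FO G (Dom E h)) (FO G (Cod E h)) \<and>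
      \<kappa> (Cod E h) \<bullet> FA G h = h \<bullet> \<kappa> (Dom E h)) \<and>
    (\<forall>X \<in> Ob (fibre F (Cod B f)). \<forall>Y \<in> Ob (fibre F (Cod B f)).
      lmul G X Y \<in> hom (fibre F (Dom B f)) (FO G X \<boxtimes> FO G Y) (FO G (X \<boxtimes> Y)) \<and>
      \<kappa> (X \<boxtimes> Y) \<bullet> lmul G X Y = \<kappa> X \<star> \<kappa> Y) \<and>
    lunt G \<in> hom (fibre F (Dom B f)) (U (Dom B f)) (FO G (U (Cod B f))) \<and>
    \<kappa> (U (Cod B f)) \<bullet> lunt G = UA f"

lemma inverse_imageD:
  assumes "inverse_image f \<kappa> G"
  shows "f \<in> Ar B"
    and "X \<in> Ob E \<Longrightarrow> P X = Cod B f \<Longrightarrow> \<kappa> X \<in> Ar E"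
    and "X \<in> Ob E \<Longrightarrow> P X = Cod B f \<Longrightarrow> cart (\<kappa> X)"
    and "X \<in> Ob E \<Longrightarrow> P X = Cod B f \<Longrightarrow> PA (\<kappa> X) = f"
    and "X \<in> Ob E \<Longrightarrow> P X = Cod B f \<Longrightarrow> Cod E (\<kappa> X) = X"
    and "X \<in> Ob E \<Longrightarrow> P X = Cod B f \<Longrightarrow> Dom E (\<kappa> X) = FO G X"
    and "X \<in> Ob E \<Longrightarrow> P X = Cod B f \<Longrightarrow> FO G X \<in> Ob E"
    and "X \<in> Ob E \<Longrightarrow> P X = Cod B f \<Longrightarrow> P (FO G X) = Dom B f"
    and "h \<in> Ar E \<Longrightarrow> PA h = iB (Cod B f) \<Longrightarrow> FA G h \<in> Ar E"
    and "h \<in> Ar E \<Longrightarrow> PA h = iB (Cod B f) \<Longrightarrow> PA (FA G h) = iB (Dom B f)"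
    and "h \<in> Ar E \<Longrightarrow> PA h = iB (Cod B f) \<Longrightarrow> Dom E (FA G h) = FO G (Dom E h)"
    and "h \<in> Ar E \<Longrightarrow> PA h = iB (Cod B f) \<Longrightarrow> Cod E (FA G h) = FO G (Cod E h)"
    and "h \<in> Ar E \<Longrightarrow> PA h = iB (Cod B f) \<Longrightarrow> Cod E h = Y \<Longrightarrow> \<kappa> Y \<bullet> FA G h = h \<bullet> \<kappa> (Dom E h)"
    and "X \<in> Ob E \<Longrightarrow> P X = Cod B f \<Longrightarrow> Y \<in> Ob E \<Longrightarrow> P Y = Cod B f \<Longrightarrow> lmul G X Y \<in> Ar E"
    and "X \<in> Ob E \<Longrightarrow> P X = Cod B f \<Longrightarrow> Y \<in> Ob E \<Longrightarrow> P Y = Cod B f \<Longrightarrow> PA (lmul G X Y) = iB (Dom B f)"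
    and "X \<in> Ob E \<Longrightarrow> P X = Cod B f \<Longrightarrow> Y \<in> Ob E \<Longrightarrow> P Y = Cod B f \<Longrightarrow>
      Dom E (lmul G X Y) = FO G X \<boxtimes> FO G Y"
    and "X \<in> Ob E \<Longrightarrow> P X = Cod B f \<Longrightarrow> Y \<in> Ob E \<Longrightarrow> P Y = Cod B f \<Longrightarrow>
      Cod E (lmul G X Y) = FO G (X \<boxtimes> Y)"
    and "X \<in> Ob E \<Longrightarrow> P X = Cod B f \<Longrightarrow> Y \<in> Ob E \<Longrightarrow> P Y = Cod B f \<Longrightarrow>
      \<kappa> (X \<boxtimes> Y) \<bullet> lmul G X Y = \<kappa> X \<star> \<kappa> Y"
    and "lunt G \<in> Ar E" and "PA (lunt G) = iB (Dom B f)" and "Dom E (lunt G) = U (Dom B f)"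
    and "Cod E (lunt G) = FO G (U (Cod B f))" and "\<kappa> (U (Cod B f)) \<bullet> lunt G = UA f"
proof -
  note a = assms[unfolded inverse_image_def cartesian_lift_def]
  show f [simp]: "f \<in> Ar B" using a by blast
  note b = a[simplified]
  show k: "X \<in> Ob E \<Longrightarrow> P X = Cod B f \<Longrightarrow> \<kappa> X \<in> Ar E" for X
    using b cart_Ar by blast
  show "X \<in> Ob E \<Longrightarrow> P X = Cod B f \<Longrightarrow> cart (\<kappa> X)" "X \<in> Ob E \<Longrightarrow> P X = Cod B f \<Longrightarrow> PA (\<kappa> X) = f"
    "X \<in> Ob E \<Longrightarrow> P X = Cod B f \<Longrightarrow> Cod E (\<kappa> X) = X" "X \<in> Ob E \<Longrightarrow> P X = Cod B f \<Longrightarrow> Dom E (\<kappa> X) = FO G X"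
    using b by simp_all
  show "X \<in> Ob E \<Longrightarrow> P X = Cod B f \<Longrightarrow> FO G X \<in> Ob E" "X \<in> Ob E \<Longrightarrow> P X = Cod B f \<Longrightarrow> P (FO G X) = Dom B f"
    using b k[of X] proj_simps(5)[of "\<kappa> X"] by simp_all
  show "h \<in> Ar E \<Longrightarrow> PA h = iB (Cod B f) \<Longrightarrow> FA G h \<in> Ar E"
    "h \<in> Ar E \<Longrightarrow> PA h = iB (Cod B f) \<Longrightarrow> PA (FA G h) = iB (Dom B f)"
    "h \<in> Ar E \<Longrightarrow> PA h = iB (Cod B f) \<Longrightarrow> Dom E (FA G h) = FO G (Dom E h)"
    "h \<in> Ar E \<Longrightarrow> PA h = iB (Cod B f) \<Longrightarrow> Cod E (FA G h) = FO G (Cod E h)"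
    "h \<in> Ar E \<Longrightarrow> PA h = iB (Cod B f) \<Longrightarrow> Cod E h = Y \<Longrightarrow> \<kappa> Y \<bullet> FA G h = h \<bullet> \<kappa> (Dom E h)"
    using b by auto
  show "X \<in> Ob E \<Longrightarrow> P X = Cod B f \<Longrightarrow> Y \<in> Ob E \<Longrightarrow> P Y = Cod B f \<Longrightarrow> lmul G X Y \<in> Ar E"
    "X \<in> Ob E \<Longrightarrow> P X = Cod B f \<Longrightarrow> Y \<in> Ob E \<Longrightarrow> P Y = Cod B f \<Longrightarrow> PA (lmul G X Y) = iB (Dom B f)"
    "X \<in> Ob E \<Longrightarrow> P X = Cod B f \<Longrightarrow> Y \<in> Ob E \<Longrightarrow> P Y = Cod B f \<Longrightarrow>
      Dom E (lmul G X Y) = FO G X \<boxtimes> FO G Y"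
    "X \<in> Ob E \<Longrightarrow> P X = Cod B f \<Longrightarrow> Y \<in> Ob E \<Longrightarrow> P Y = Cod B f \<Longrightarrow>
      Cod E (lmul G X Y) = FO G (X \<boxtimes> Y)"
    "X \<in> Ob E \<Longrightarrow> P X = Cod B f \<Longrightarrow> Y \<in> Ob E \<Longrightarrow> P Y = Cod B f \<Longrightarrow>
      \<kappa> (X \<boxtimes> Y) \<bullet> lmul G X Y = \<kappa> X \<star> \<kappa> Y"
    "lunt G \<in> Ar E" "PA (lunt G) = iB (Dom B f)" "Dom E (lunt G) = U (Dom B f)"
    "Cod E (lunt G) = FO G (U (Cod B f))" "\<kappa> (U (Cod B f)) \<bullet> lunt G = UA f"
    using b by auto
qed

text \<open>The defining equations, applied inside a composite associated to the right.\<close>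

lemma inverse_image_assoc:
  assumes "inverse_image f \<kappa> G" "x \<in> Ar E"
  shows "h \<in> Ar E \<Longrightarrow> PA h = iB (Cod B f) \<Longrightarrow> Cod E h = Y \<Longrightarrow> Cod E x = FO G (Dom E h) \<Longrightarrow>
      \<kappa> Y \<bullet> (FA G h \<bullet> x) = h \<bullet> (\<kappa> (Dom E h) \<bullet> x)"
    and "X \<in> Ob E \<Longrightarrow> P X = Cod B f \<Longrightarrow> Y \<in> Ob E \<Longrightarrow> P Y = Cod B f \<Longrightarrow> Cod E x = FO G X \<boxtimes> FO G Y \<Longrightarrow>
      \<kappa> (X \<boxtimes> Y) \<bullet> (lmul G X Y \<bullet> x) = (\<kappa> X \<star> \<kappa> Y) \<bullet> x"
    and "Cod E x = U (Dom B f) \<Longrightarrow> \<kappa> (U (Cod B f)) \<bullet> (lunt G \<bullet> x) = UA f \<bullet> x"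
proof -
  note d = inverse_imageD[OF assms(1)]
  note [simp] = d(1-12,14-17,19-22) assms(2)
  show "\<kappa> Y \<bullet> (FA G h \<bullet> x) = h \<bullet> (\<kappa> (Dom E h) \<bullet> x)"
    if h: "h \<in> Ar E" "PA h = iB (Cod B f)" "Cod E h = Y" "Cod E x = FO G (Dom E h)"
  proof -
    have P: "P (Dom E h) = Cod B f" "P Y = Cod B f" "Y \<in> Ob E" using vertical[OF h(1,2)] h by auto
    have "\<kappa> Y \<bullet> (FA G h \<bullet> x) = (\<kappa> Y \<bullet> FA G h) \<bullet> x" using h P by simp
    also have "\<dots> = h \<bullet> (\<kappa> (Dom E h) \<bullet> x)" unfolding d(13)[OF h(1-3)] using h P by simp
    finally show ?thesis .
  qed
  show "\<kappa> (X \<boxtimes> Y) \<bullet> (lmul G X Y \<bullet> x) = (\<kappa> X \<star> \<kappa> Y) \<bullet> x"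
    if h: "X \<in> Ob E" "P X = Cod B f" "Y \<in> Ob E" "P Y = Cod B f" "Cod E x = FO G X \<boxtimes> FO G Y"
  proof -
    have "\<kappa> (X \<boxtimes> Y) \<bullet> (lmul G X Y \<bullet> x) = (\<kappa> (X \<boxtimes> Y) \<bullet> lmul G X Y) \<bullet> x" using h by simp
    then show ?thesis unfolding d(18)[OF h(1-4)] .
  qed
  show "\<kappa> (U (Cod B f)) \<bullet> (lunt G \<bullet> x) = UA f \<bullet> x" if h: "Cod E x = U (Dom B f)"
  proof -
    have "\<kappa> (U (Cod B f)) \<bullet> (lunt G \<bullet> x) = (\<kappa> (U (Cod B f)) \<bullet> lunt G) \<bullet> x" using h by simp
    then show ?thesis unfolding d(23) .
  qed
qed

text \<open>Every axiom equates two vertical arrows into the source of some \<open>\<kappa> X\<close>. After composition with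
  \<open>\<kappa> X\<close> it becomes naturality of the associativity or unit isomorphisms of \<open>E\<close> at the lifts, or functoriality
  of the tensor product.\<close>

lemma inverse_image_lax_monoidal:
  assumes G: "inverse_image f \<kappa> G"
  shows "lax_monoidal_functor (fibre F (Cod B f)) (fibre F (Dom B f)) G"
proof -
  note d [simp] = inverse_imageD[OF G] inverse_image_assoc[OF G]
  note [simp] = tens_comp tens_comp_assoc
  let ?V = "fibre F (Cod B f)" and ?W = "fibre F (Dom B f)"
  have V: "P (Dom E h) = Cod B f" "P (Cod E h) = Cod B f" if "h \<in> Ar E" "PA h = iB (Cod B f)" for h
    using vertical[OF that] by simp_all
  have id: "FA G (iE X) = iE (FO G X)" if [simp]: "X \<in> Ob E" "P X = Cod B f" for X
    by (rule cart_cancel[OF d(3)[of X]]) simp_all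
  have comp: "FA G (h \<bullet> g) = FA G h \<bullet> FA G g"
    if [simp]: "g \<in> Ar E" "h \<in> Ar E" "PA g = iB (Cod B f)" "PA h = iB (Cod B f)" "Cod E g = Dom E h" for g h
  proof -
    note [simp] = V[of g] V[of h]
    show ?thesis by (rule cart_cancel[OF d(3)[of "Cod E h"]]) simp_all
  qed
  have fG: "is_functor ?V ?W G"
    unfolding is_functor_def using id comp V by (auto simp: hom_def)
  have nat: "FA G (g \<star> h) \<bullet> lmul G (Dom E g) (Dom E h) = lmul G (Cod E g) (Cod E h) \<bullet> (FA G g \<star> FA G h)"
    if [simp]: "g \<in> Ar E" "h \<in> Ar E" "PA g = iB (Cod B f)" "PA h = iB (Cod B f)" for g h
  proof -
    note [simp] = V[of g] V[of h]
    show ?thesis by (rule cart_cancel[OF d(3)[of "Cod E g \<boxtimes> Cod E h"]]) simp_all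
  qed
  have assoc: "FA G (fassoc F X Y Z) \<bullet> lmul G (X \<boxtimes> Y) Z \<bullet> (lmul G X Y \<star> iE (FO G Z)) =
      lmul G X (Y \<boxtimes> Z) \<bullet> (iE (FO G X) \<star> lmul G Y Z) \<bullet> fassoc F (FO G X) (FO G Y) (FO G Z)"
    if [simp]: "X \<in> Ob E" "P X = Cod B f" "Y \<in> Ob E" "P Y = Cod B f" "Z \<in> Ob E" "P Z = Cod B f" for X Y Z
  proof (rule cart_cancel[OF d(3)[of "X \<boxtimes> (Y \<boxtimes> Z)"]])
    show "\<kappa> (X \<boxtimes> (Y \<boxtimes> Z)) \<bullet> (FA G (fassoc F X Y Z) \<bullet> lmul G (X \<boxtimes> Y) Z \<bullet> (lmul G X Y \<star> iE (FO G Z))) =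
      \<kappa> (X \<boxtimes> (Y \<boxtimes> Z)) \<bullet> (lmul G X (Y \<boxtimes> Z) \<bullet> (iE (FO G X) \<star> lmul G Y Z) \<bullet> fassoc F (FO G X) (FO G Y) (FO G Z))"
      using assoc_natural[of "\<kappa> X" "\<kappa> Y" "\<kappa> Z"] by simp
  qed simp_all
  have lunit: "FA G (flunit F X) \<bullet> lmul G (U (Cod B f)) X \<bullet> (lunt G \<star> iE (FO G X)) = flunit F (FO G X)"
    if [simp]: "X \<in> Ob E" "P X = Cod B f" for X
  proof (rule cart_cancel[OF d(3)[of X]])
    show "\<kappa> X \<bullet> (FA G (flunit F X) \<bullet> lmul G (U (Cod B f)) X \<bullet> (lunt G \<star> iE (FO G X))) = \<kappa> X \<bullet> flunit F (FO G X)"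
      using unitor_natural(1)[of "\<kappa> X"] by simp
  qed simp_all
  have runit: "FA G (frunit F X) \<bullet> lmul G X (U (Cod B f)) \<bullet> (iE (FO G X) \<star> lunt G) = frunit F (FO G X)"
    if [simp]: "X \<in> Ob E" "P X = Cod B f" for X
  proof (rule cart_cancel[OF d(3)[of X]])
    show "\<kappa> X \<bullet> (FA G (frunit F X) \<bullet> lmul G X (U (Cod B f)) \<bullet> (iE (FO G X) \<star> lunt G)) = \<kappa> X \<bullet> frunit F (FO G X)"
      using unitor_natural(2)[of "\<kappa> X"] by simp
  qed simp_all
  have mv: "monoidal_category ?V" "monoidal_category ?W" by simp_all
  have "nat_trans (prod_cat ?V ?V) ?W
      \<lparr>FO = (\<lambda>(X, Y). FO G X \<boxtimes> FO G Y), FA = (\<lambda>(f, g). FA G f \<star> FA G g)\<rparr>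
      (comp_func G (ftens F)) (\<lambda>(X, Y). lmul G X Y)"
    unfolding nat_trans_def is_functor_def
    by (simp add: category_prod_cat) (auto simp: prod_cat_def comp_func_def hom_def id comp[symmetric] nat V)
  then show ?thesis
    unfolding lax_monoidal_functor_def using mv fG assoc lunit runit by simp
qed

text \<open>Both functors are inverse images along the same arrow, so a vertical comparison compatible with the
  lifts exists in either direction; all identities, including that the two comparisons are mutually inverse, can be
  checked after composition with a lift.\<close>

lemma inverse_image_comparison:
  assumes G: "inverse_image f \<kappa> G" and H: "inverse_image f \<kappa>' H"
    and t: "\<And>X. X \<in> Ob E \<Longrightarrow> P X = Cod B f \<Longrightarrow>
      t X \<in> Ar E \<and> PA (t X) = iB (Dom B f) \<and> Dom E (t X) = FO G X \<and> Cod E (t X) = FO H X \<and> \<kappa>' X \<bullet> t X = \<kappa> X"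
  shows "monoidal_transformation (fibre F (Cod B f)) (fibre F (Dom B f)) G H t"
    and "nat_iso (fibre F (Cod B f)) (fibre F (Dom B f)) G H t"
proof -
  note d [simp] = inverse_imageD[OF G] inverse_image_assoc[OF G]
  note d' [simp] = inverse_imageD[OF H] inverse_image_assoc[OF H]
  note [simp] = tens_comp tens_comp_assoc
  let ?V = "fibre F (Cod B f)" and ?W = "fibre F (Dom B f)"
  have V: "P (Dom E h) = Cod B f" "P (Cod E h) = Cod B f" if "h \<in> Ar E" "PA h = iB (Cod B f)" for h
    using vertical[OF that] by simp_all
  have t' [simp]: "t X \<in> Ar E" "PA (t X) = iB (Dom B f)" "Dom E (t X) = FO G X" "Cod E (t X) = FO H X"
    "\<kappa>' X \<bullet> t X = \<kappa> X" if "X \<in> Ob E" "P X = Cod B f" for X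
    using t[OF that] by auto
  have t2 [simp]: "\<kappa>' X \<bullet> (t X \<bullet> x) = \<kappa> X \<bullet> x"
    if [simp]: "X \<in> Ob E" "P X = Cod B f" "x \<in> Ar E" "Cod E x = FO G X" for X x
  proof -
    have "\<kappa>' X \<bullet> (t X \<bullet> x) = (\<kappa>' X \<bullet> t X) \<bullet> x" by (simp del: t'(5))
    then show ?thesis by simp
  qed
  have lax: "lax_monoidal_functor ?V ?W G" "lax_monoidal_functor ?V ?W H"
    using inverse_image_lax_monoidal G H by blast+
  have nat: "FA H h \<bullet> t (Dom E h) = t (Cod E h) \<bullet> FA G h" if [simp]: "h \<in> Ar E" "PA h = iB (Cod B f)" for h
  proof -
    note [simp] = V[OF that]
    show ?thesis by (rule cart_cancel[OF d'(3)[of "Cod E h"]]) simp_all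
  qed
  have nt: "nat_trans ?V ?W G H t"
    using lax nat unfolding nat_trans_def lax_monoidal_functor_def by simp
  have mult: "t (X \<boxtimes> Y) \<bullet> lmul G X Y = lmul H X Y \<bullet> (t X \<star> t Y)"
    if [simp]: "X \<in> Ob E" "P X = Cod B f" "Y \<in> Ob E" "P Y = Cod B f" for X Y
    by (rule cart_cancel[OF d'(3)[of "X \<boxtimes> Y"]]) simp_all
  have unit: "t (U (Cod B f)) \<bullet> lunt G = lunt H"
    by (rule cart_cancel[OF d'(3)[of "U (Cod B f)"]]) simp_all
  show "monoidal_transformation ?V ?W G H t"
    unfolding monoidal_transformation_def using lax nt mult unit by simp
  have iso: "is_iso ?W (t X)" if [simp]: "X \<in> Ob E" "P X = Cod B f" for X
  proof -
    obtain s where [simp]: "s \<in> Ar E" "Dom E s = FO H X" "Cod E s = FO G X" "PA s = iB (Dom B f)"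
      and s: "\<kappa> X \<bullet> s = \<kappa>' X"
      by (rule cartesian_factor[OF d(3)[of X], of "\<kappa>' X" "iB (Dom B f)"]) simp_all
    have s2: "\<kappa> X \<bullet> (s \<bullet> x) = \<kappa>' X \<bullet> x" if [simp]: "x \<in> Ar E" "Cod E x = FO H X" for x
    proof -
      have "\<kappa> X \<bullet> (s \<bullet> x) = (\<kappa> X \<bullet> s) \<bullet> x" by simp
      then show ?thesis by (simp add: s)
    qed
    have "s \<bullet> t X = iE (FO G X)"
      by (rule cart_cancel[OF d(3)[of X]]) (simp_all add: s2)
    moreover have "t X \<bullet> s = iE (FO H X)"
      by (rule cart_cancel[OF d'(3)[of X]]) (simp_all add: s)
    ultimately show ?thesis unfolding is_iso_def by (intro conjI bexI[of _ s]) simp_all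
  qed
  show "nat_iso ?V ?W G H t"
    unfolding nat_iso_def using nt iso by simp
qed

lemma inverse_image_id:
  assumes [simp]: "A \<in> Ob B"
  shows "inverse_image (iB A) iE (id_lax (fibre F A))"
  unfolding inverse_image_def
  by (auto simp: id_lax_def cartesian_lift_def vertical cartesian_Idn[OF functor_proj])

lemma inverse_image_comp:
  assumes G: "inverse_image f \<kappa> G" and H: "inverse_image g \<kappa>' H" and fg [simp]: "Cod B f = Dom B g"
  shows "inverse_image (g \<cdot>\<^bsub>B\<^esub> f) (\<lambda>X. \<kappa>' X \<bullet> \<kappa> (FO H X)) (comp_lax (fibre F (Dom B f)) G H)"
proof -
  note d [simp] = inverse_imageD[OF G, unfolded fg] inverse_image_assoc[OF G, unfolded fg]
  note d' [simp] = inverse_imageD[OF H] inverse_image_assoc[OF H]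
  have V: "P (Dom E h) = Cod B g" "P (Cod E h) = Cod B g" if "h \<in> Ar E" "PA h = iB (Cod B g)" for h
    using vertical[OF that] by simp_all
  show ?thesis
    unfolding inverse_image_def
    by (auto simp: comp_lax_def cartesian_lift_def V tens_comp tens_comp_assoc intro!: cartesian_comp[OF functor_proj])
qed

lemma inverse_image_cleavage:
  assumes c: "cleavage E B (proj F) c" and f [simp]: "f \<in> Ar B"
  shows "inverse_image f (c f) (inv_image F c f)"
proof -
  have k: "cart (c f X)" "PA (c f X) = f" "Cod E (c f X) = X" "c f X \<in> Ar E" "P (Dom E (c f X)) = Dom B f"
    "cartesian_lift E B (proj F) f X (c f X)"
    if "X \<in> Ob E" "P X = Cod B f" for X
  proof -
    show l: "cartesian_lift E B (proj F) f X (c f X)" using c that f unfolding cleavage_def by blast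
    then show "cart (c f X)" "PA (c f X) = f" "Cod E (c f X) = X" and a: "c f X \<in> Ar E"
      by (auto simp: cartesian_lift_def cartesian_def)
    then show "P (Dom E (c f X)) = Dom B f" using proj_simps(5)[OF a] by simp
  qed
  have V: "P (Dom E h) = Cod B f" "P (Cod E h) = Cod B f" if "h \<in> Ar E" "PA h = iB (Cod B f)" for h
    using vertical[OF that] by simp_all
  show ?thesis
    unfolding inverse_image_def
    by (auto simp: inv_image_def k V vert_fact_props)
qed

text \<open>The monoid that the lax functor \<open>G\<close> assigns to \<open>S\<close> is the one induced by the lift
  \<open>\<kappa>\<close>, since its structure maps become those of \<open>S\<close> after composition with the lift.\<close>

lemma mon_ob_arrow:
  assumes G: "inverse_image f \<kappa> G" and S: "S \<in> Ob (MonE F)" "P (fst S) = Cod B f"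
  shows "(mon_ob (fibre F (Dom B f)) G S, \<kappa> (fst S), S) \<in> Ar (MonE F)"
proof -
  obtain S0 n l where S': "S = (S0, n, l)" by (cases S)
  note [simp] = MonE_ObD[OF S(1)[unfolded S']] S(2)[unfolded S', simplified]
    inverse_imageD[OF G] inverse_image_assoc[OF G]
  have k: "cart (\<kappa> S0)" "Cod E (\<kappa> S0) = S0" "Dom E (\<kappa> S0) = FO G S0" "PA (\<kappa> S0) = f" by simp_all
  have "(FO G S0, FA G n \<bullet> lmul G S0 S0, FA G l \<bullet> lunt G) \<in> monoids (fibre F (Dom B f))"
    by (rule monoid_laws_lift[OF k]) (use S in \<open>simp_all add: S' MonE_Ob\<close>)
  then show ?thesis
    using S by (simp add: S' mon_ob_def MonE_Ar MonE_Ob)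
qed

lemma mod_ob_arrow:
  assumes G: "inverse_image f \<kappa> G" and SN: "(S, N) \<in> Ob (ModE F)" "P (fst S) = Cod B f"
  shows "(mod_ob (fibre F (Dom B f)) G (S, N), (\<kappa> (fst S), \<kappa> (fst N)), (S, N)) \<in> Ar (ModE F)"
proof -
  obtain N0 s where N: "N = (N0, s)" by (cases N)
  obtain S0 n l where S': "S = (S0, n, l)" by (cases S)
  note o = ModE_ObD[OF SN(1)[unfolded N]]
  note [simp] = inverse_imageD[OF G] inverse_image_assoc[OF G]
  have P: "P S0 = Cod B f" "P N0 = Cod B f" using SN o by (simp_all add: S')
  note S = mon_ob_arrow[OF G o(1) SN(2)]
  let ?R = "mon_ob (fibre F (Dom B f)) G S"
  have N0: "N0 \<in> Ob E" by (rule o(2))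
  have k: "cart (\<kappa> N0)" "Cod E (\<kappa> N0) = fst N" "PA (\<kappa> N0) = PA (\<kappa> (fst S))"
    using P N0 MonE_Ob_simps[OF o(1)] by (simp_all add: S' N)
  obtain M where M: "fst M = Dom E (\<kappa> N0)" "((?R, M), (\<kappa> (fst S), \<kappa> N0), (S, N)) \<in> Ar (ModE F)"
    using module_lift[OF SN(1) S k] by blast
  obtain r where M': "M = (FO G N0, r)" using M(1) P N0 by (cases M) simp
  note a = ModE_ArD[OF M(2)]
  note r = ModE_ObD[OF a(1)[unfolded M']]
  have R0: "fst ?R = FO G S0" by (simp add: S' mon_ob_def)
  have S0: "S0 \<in> Ob E" using MonE_Ob_simps[OF o(1)] by (simp add: S')
  have "r = FA G s \<bullet> lmul G N0 S0"
    by (rule cart_cancel[OF k(1)]) (use a(8) r R0 S0 N0 P o in \<open>simp_all add: M' N S'\<close>)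
  then have "mod_ob (fibre F (Dom B f)) G (S, N) = (?R, M)"
    by (simp add: mod_ob_def N M' S')
  then show ?thesis using M N by simp
qed

section \<open>The monoidal indexed category of a cleavage\<close>

context
  fixes c
  assumes c: "cleavage E B (proj F) c"
begin

abbreviation Phi where "Phi \<equiv> Phi_P F c"
abbreviation pull where "pull \<equiv> inv_image F c"

lemma Phi_simps [simp]: "ifib Phi = fibre F" "irei Phi = pull"
  by (simp_all add: Phi_P_def)

lemmas pull_inverse_image = inverse_image_cleavage[OF c]

lemma comparison_comp:
  assumes [simp]: "f \<in> Ar B" "g \<in> Ar B" "Cod B f = Dom B g" "X \<in> Ob E" "P X = Cod B g"
  shows "ipc Phi f g X \<in> Ar E" and "PA (ipc Phi f g X) = iB (Dom B f)"
    and "Dom E (ipc Phi f g X) = FO (pull f) (FO (pull g) X)"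
    and "Cod E (ipc Phi f g X) = FO (pull (g \<cdot>\<^bsub>B\<^esub> f)) X"
    and "c (g \<cdot>\<^bsub>B\<^esub> f) X \<bullet> ipc Phi f g X = c g X \<bullet> c f (FO (pull g) X)"
    and "x \<in> Ar E \<Longrightarrow> Cod E x = FO (pull f) (FO (pull g) X) \<Longrightarrow>
      c (g \<cdot>\<^bsub>B\<^esub> f) X \<bullet> (ipc Phi f g X \<bullet> x) = c g X \<bullet> (c f (FO (pull g) X) \<bullet> x)"
proof -
  note [simp] = inverse_imageD[OF pull_inverse_image[of f]] inverse_imageD[OF pull_inverse_image[of g]]
    inverse_imageD[OF pull_inverse_image[of "g \<cdot>\<^bsub>B\<^esub> f"]]
  have e: "ipc Phi f g X = vert_fact F (c (g \<cdot>\<^bsub>B\<^esub> f) X) (c g X \<bullet> c f (FO (pull g) X))"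
    by (simp add: Phi_P_def)
  have k: "cart (c (g \<cdot>\<^bsub>B\<^esub> f) X)" by simp
  note v [simp] = vert_fact_props[OF k, of "c g X \<bullet> c f (FO (pull g) X)", folded e]
  show "ipc Phi f g X \<in> Ar E" "PA (ipc Phi f g X) = iB (Dom B f)"
    "Dom E (ipc Phi f g X) = FO (pull f) (FO (pull g) X)"
    "Cod E (ipc Phi f g X) = FO (pull (g \<cdot>\<^bsub>B\<^esub> f)) X"
    "c (g \<cdot>\<^bsub>B\<^esub> f) X \<bullet> ipc Phi f g X = c g X \<bullet> c f (FO (pull g) X)"
    by simp_all
  show "c (g \<cdot>\<^bsub>B\<^esub> f) X \<bullet> (ipc Phi f g X \<bullet> x) = c g X \<bullet> (c f (FO (pull g) X) \<bullet> x)"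
    if [simp]: "x \<in> Ar E" "Cod E x = FO (pull f) (FO (pull g) X)"
  proof -
    have "c (g \<cdot>\<^bsub>B\<^esub> f) X \<bullet> (ipc Phi f g X \<bullet> x) = (c (g \<cdot>\<^bsub>B\<^esub> f) X \<bullet> ipc Phi f g X) \<bullet> x"
      by (simp del: v(5))
    also have "\<dots> = c g X \<bullet> (c f (FO (pull g) X) \<bullet> x)" by simp
    finally show ?thesis .
  qed
qed

lemma comparison_id:
  assumes [simp]: "A \<in> Ob B" "X \<in> Ob E" "P X = A"
  shows "ipi Phi A X \<in> Ar E" and "PA (ipi Phi A X) = iB A"
    and "Dom E (ipi Phi A X) = X" and "Cod E (ipi Phi A X) = FO (pull (iB A)) X"
    and "c (iB A) X \<bullet> ipi Phi A X = iE X"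
    and "x \<in> Ar E \<Longrightarrow> Cod E x = X \<Longrightarrow> c (iB A) X \<bullet> (ipi Phi A X \<bullet> x) = x"
proof -
  note [simp] = inverse_imageD[OF pull_inverse_image[of "iB A"]]
  have e: "ipi Phi A X = vert_fact F (c (iB A) X) (iE X)"
    by (simp add: Phi_P_def)
  have k: "cart (c (iB A) X)" by simp
  note v [simp] = vert_fact_props[OF k, of "iE X", folded e]
  show "ipi Phi A X \<in> Ar E" "PA (ipi Phi A X) = iB A"
    "Dom E (ipi Phi A X) = X" "Cod E (ipi Phi A X) = FO (pull (iB A)) X"
    "c (iB A) X \<bullet> ipi Phi A X = iE X"
    by simp_all
  show "c (iB A) X \<bullet> (ipi Phi A X \<bullet> x) = x" if [simp]: "x \<in> Ar E" "Cod E x = X"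
  proof -
    have "c (iB A) X \<bullet> (ipi Phi A X \<bullet> x) = (c (iB A) X \<bullet> ipi Phi A X) \<bullet> x" by (simp del: v(5))
    also have "\<dots> = x" by simp
    finally show ?thesis .
  qed
qed

text \<open>Both kinds of structural isomorphisms compare two choices of lifts of one arrow: composites of the
  chosen lifts with the chosen lift of the composite, and an identity with the chosen lift of an identity.\<close>

lemma comparison_transformations:
  shows "f \<in> Ar B \<Longrightarrow> g \<in> Ar B \<Longrightarrow> Cod B f = Dom B g \<Longrightarrow>
      monoidal_transformation (fibre F (Cod B g)) (fibre F (Dom B f))
        (comp_lax (fibre F (Dom B f)) (pull f) (pull g)) (pull (g \<cdot>\<^bsub>B\<^esub> f)) (ipc Phi f g)"
    and "f \<in> Ar B \<Longrightarrow> g \<in> Ar B \<Longrightarrow> Cod B f = Dom B g \<Longrightarrow>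
      nat_iso (fibre F (Cod B g)) (fibre F (Dom B f))
        (comp_func (pull f) (pull g)) (pull (g \<cdot>\<^bsub>B\<^esub> f)) (ipc Phi f g)"
    and "A \<in> Ob B \<Longrightarrow> monoidal_transformation (fibre F A) (fibre F A) (id_lax (fibre F A)) (pull (iB A)) (ipi Phi A)"
    and "A \<in> Ob B \<Longrightarrow> nat_iso (fibre F A) (fibre F A) id_func (pull (iB A)) (ipi Phi A)"
proof -
  {
    assume fg [simp]: "f \<in> Ar B" "g \<in> Ar B" "Cod B f = Dom B g"
    have 1: "inverse_image (g \<cdot>\<^bsub>B\<^esub> f) (\<lambda>X. c g X \<bullet> c f (FO (pull g) X)) (comp_lax (fibre F (Dom B f)) (pull f) (pull g))"
      and 2: "inverse_image (g \<cdot>\<^bsub>B\<^esub> f) (c (g \<cdot>\<^bsub>B\<^esub> f)) (pull (g \<cdot>\<^bsub>B\<^esub> f))"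
      by (simp_all add: inverse_image_comp pull_inverse_image)
    note 3 = inverse_image_comparison[OF 1 2, of "ipc Phi f g"]
    show "monoidal_transformation (fibre F (Cod B g)) (fibre F (Dom B f))
        (comp_lax (fibre F (Dom B f)) (pull f) (pull g)) (pull (g \<cdot>\<^bsub>B\<^esub> f)) (ipc Phi f g)"
      using 3(1) comparison_comp[OF fg] by (simp add: comp_lax_def)
    have "nat_iso (fibre F (Cod B g)) (fibre F (Dom B f))
        (comp_lax (fibre F (Dom B f)) (pull f) (pull g)) (pull (g \<cdot>\<^bsub>B\<^esub> f)) (ipc Phi f g)"
      using 3(2) comparison_comp[OF fg] by (simp add: comp_lax_def)
    then show "nat_iso (fibre F (Cod B g)) (fibre F (Dom B f))
        (comp_func (pull f) (pull g)) (pull (g \<cdot>\<^bsub>B\<^esub> f)) (ipc Phi f g)"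
      by (subst nat_iso_cong[where G' = "comp_lax (fibre F (Dom B f)) (pull f) (pull g)"])
         (simp_all add: comp_lax_def comp_func_def)
  }
  assume A [simp]: "A \<in> Ob B"
  have 2: "inverse_image (iB A) (c (iB A)) (pull (iB A))" by (simp add: pull_inverse_image)
  note 3 = inverse_image_comparison[OF inverse_image_id[OF A] 2, of "ipi Phi A"]
  show "monoidal_transformation (fibre F A) (fibre F A) (id_lax (fibre F A)) (pull (iB A)) (ipi Phi A)"
    using 3(1) comparison_id[OF A] by (simp add: id_lax_def)
  have "nat_iso (fibre F A) (fibre F A) (id_lax (fibre F A)) (pull (iB A)) (ipi Phi A)"
    using 3(2) comparison_id[OF A] by (simp add: id_lax_def)
  then show "nat_iso (fibre F A) (fibre F A) id_func (pull (iB A)) (ipi Phi A)"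
    by (subst nat_iso_cong[where G' = "id_lax (fibre F A)"]) (simp_all add: id_lax_def id_func_def)
qed

lemma monoidal_indexed_category_Phi: "monoidal_indexed_category B Phi"
proof -
  have lax: "lax_monoidal_functor (fibre F (Cod B f)) (fibre F (Dom B f)) (pull f)" if "f \<in> Ar B" for f
    using inverse_image_lax_monoidal[OF pull_inverse_image[OF that]] .
  have assoc: "ipc Phi f (h \<cdot>\<^bsub>B\<^esub> g) X \<bullet> FA (pull f) (ipc Phi g h X) =
      ipc Phi (g \<cdot>\<^bsub>B\<^esub> f) h X \<bullet> ipc Phi f g (FO (pull h) X)"
    if [simp]: "f \<in> Ar B" "g \<in> Ar B" "h \<in> Ar B" "Cod B f = Dom B g" "Cod B g = Dom B h"
      "X \<in> Ob E" "P X = Cod B h" for f g h X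
  proof -
    note [simp] = inverse_imageD[OF pull_inverse_image[of f]] inverse_imageD[OF pull_inverse_image[of g]] inverse_imageD[OF pull_inverse_image[of h]]
      inverse_imageD[OF pull_inverse_image[of "h \<cdot>\<^bsub>B\<^esub> g"]] inverse_imageD[OF pull_inverse_image[of "g \<cdot>\<^bsub>B\<^esub> f"]]
      inverse_imageD[OF pull_inverse_image[of "h \<cdot>\<^bsub>B\<^esub> (g \<cdot>\<^bsub>B\<^esub> f)"]]
    have k: "cart (c (h \<cdot>\<^bsub>B\<^esub> (g \<cdot>\<^bsub>B\<^esub> f)) X)" by simp
    note a = comparison_comp[of f "h \<cdot>\<^bsub>B\<^esub> g" X] comparison_comp[of "g \<cdot>\<^bsub>B\<^esub> f" h X]
      comparison_comp[of g h X] comparison_comp[of f g "FO (pull h) X"]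
    note [simp] = a[simplified]
    show ?thesis
      by (rule cart_cancel[OF k]) simp_all
  qed
  have unit: "ipc Phi (iB (Dom B f)) f X \<bullet> ipi Phi (Dom B f) (FO (pull f) X) = iE (FO (pull f) X)"
      "ipc Phi f (iB (Cod B f)) X \<bullet> FA (pull f) (ipi Phi (Cod B f) X) = iE (FO (pull f) X)"
    if [simp]: "f \<in> Ar B" "X \<in> Ob E" "P X = Cod B f" for f X
  proof -
    note [simp] = inverse_imageD[OF pull_inverse_image[of f]] inverse_imageD[OF pull_inverse_image[of "iB (Cod B f)"]]
      inverse_imageD[OF pull_inverse_image[of "iB (Dom B f)"]]
    have k: "cart (c f X)" by simp
    note a = comparison_comp[of "iB (Dom B f)" f X] comparison_comp[of f "iB (Cod B f)" X]
      comparison_id[of "Dom B f" "FO (pull f) X"] comparison_id[of "Cod B f" X]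
    note [simp] = a[simplified]
    show "ipc Phi (iB (Dom B f)) f X \<bullet> ipi Phi (Dom B f) (FO (pull f) X) = iE (FO (pull f) X)"
      by (rule cart_cancel[OF k]) simp_all
    show "ipc Phi f (iB (Cod B f)) X \<bullet> FA (pull f) (ipi Phi (Cod B f) X) = iE (FO (pull f) X)"
      by (rule cart_cancel[OF k]) simp_all
  qed
  have "indexed_category B Phi"
    unfolding indexed_category_def
    using lax comparison_transformations assoc unit
    by (auto simp: lax_monoidal_functor_def)
  then show ?thesis
    unfolding monoidal_indexed_category_def
    using lax comparison_transformations by auto
qed

section \<open>Comparison with the Grothendieck constructions\<close>

abbreviation mon_pull where
  "mon_pull f \<equiv> mon_ob (fibre F (Dom B f)) (pull f)"
abbreviation mod_pull where
  "mod_pull f \<equiv> mod_ob (fibre F (Dom B f)) (pull f)"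

lemma fst_mon_pull: "fst (mon_pull f S) = FO (pull f) (fst S)"
  by (simp add: mon_ob_def case_prod_unfold)

lemma mod_pull_components: "mod_pull f (S, N) = (mon_pull f S, snd (mod_pull f (S, N)))"
  "fst (snd (mod_pull f (S, N))) = FO (pull f) (fst N)"
  by (simp_all add: mod_ob_def case_prod_unfold)

lemma vert_fact_lift:
  assumes [simp]: "f \<in> Ar B" "X \<in> Ob E" "P X = Cod B f"
    "h \<in> Ar E" "PA h = iB (Dom B f)" "Cod E h = FO (pull f) X"
  shows "vert_fact F (c f X) (c f X \<bullet> h) = h"
proof -
  note [simp] = inverse_imageD[OF pull_inverse_image[of f]]
  show ?thesis
    by (rule vert_fact_eqI) (use vertical(1)[of h "Dom B f"] in simp_all)
qed

text \<open>The heart of the compatibility with composition: the second component of a composite in the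
  Grothendieck construction is the vertical part of the corresponding composite in \<open>E\<close>.\<close>

lemma vert_fact_lift_comp:
  assumes [simp]: "f \<in> Ar B" "g \<in> Ar B" "Cod B f = Dom B g" "Z \<in> Ob E" "P Z = Cod B g"
    "h \<in> Ar E" "PA h = iB (Dom B f)" "Cod E h = FO (pull f) Y"
    "l \<in> Ar E" "PA l = iB (Dom B g)" "Dom E l = Y" "Cod E l = FO (pull g) Z"
  shows "vert_fact F (c (g \<cdot>\<^bsub>B\<^esub> f) Z) ((c g Z \<bullet> l) \<bullet> (c f Y \<bullet> h)) =
    (ipc Phi f g Z \<bullet> FA (pull f) l) \<bullet> h"
proof -
  note [simp] = inverse_imageD[OF pull_inverse_image[of f]] inverse_imageD[OF pull_inverse_image[of g]]
    inverse_imageD[OF pull_inverse_image[of "g \<cdot>\<^bsub>B\<^esub> f"]] inverse_image_assoc[OF pull_inverse_image[of f]]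
  note [simp] = comparison_comp[of f g Z, simplified]
  have Y [simp]: "P Y = Dom B g" "Y \<in> Ob E" using vertical(1)[of l "Dom B g"] category_simps(1)[of E l] by auto
  show ?thesis
    by (rule vert_fact_eqI) (use vertical(1)[of h "Dom B f"] in simp_all)
qed

lemma Mon_Phi_simps:
  "Ob (Mon_Phi B Phi) = {(A, R). A \<in> Ob B \<and> R \<in> Ob (MonE F) \<and> P (fst R) = A}"
  "Dom (Mon_Phi B Phi) = fst" "Cod (Mon_Phi B Phi) x = snd (snd x)"
  "Idn (Mon_Phi B Phi) (A, R) =
    ((A, R), (iB A, (R, ipi Phi A (fst R), mon_ob (fibre F A) (pull (iB A)) R)), (A, R))"
  "((A1, S1), (g, (S2, l, T1)), (C, T)) \<cdot>\<^bsub>Mon_Phi B Phi\<^esub> ((A, R), (f, (R1, h, S')), (A', S)) =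
    ((A, R), (g \<cdot>\<^bsub>B\<^esub> f, (R1, (ipc Phi f g (fst T) \<bullet> FA (pull f) l) \<bullet> h,
      mon_ob (fibre F (Dom B f)) (pull (g \<cdot>\<^bsub>B\<^esub> f)) T)), (C, T))"
  by (auto simp: Mon_Phi_def grothendieck_def hom_cat_simps Mon_idx_def mon_func_def Mon_cat_def monoids_fibre_iff Phi_simps)

text \<open>An arrow of monoids is recorded with its source and target, so the source \<open>R\<close> and the inverse
  image of the target \<open>S\<close> occur a second time in the data.\<close>

lemma Mon_Phi_Ar:
  "((A, R), (f, (R1, h, S1)), (A', S)) \<in> Ar (Mon_Phi B Phi) \<longleftrightarrow>
    f \<in> Ar B \<and> A = Dom B f \<and> A' = Cod B f \<and> R1 = R \<and> S1 = mon_pull f S \<and> S \<in> Ob (MonE F) \<and> P (fst S) = A' \<and>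
    (R, h, mon_pull f S) \<in> Ar (MonE F) \<and> PA h = iB A"
proof -
  have dc: "Dom (Mon_cat V) (X, h, Y) = X" "Cod (Mon_cat V) (X, h, Y) = Y" for V X h Y
    by (simp_all add: Mon_cat_def hom_cat_def)
  have ob: "Ob (Mon_cat V) = monoids V" for V by (simp add: Mon_cat_def hom_cat_def)
  have "((A, R), (f, (R1, h, S1)), (A', S)) \<in> Ar (Mon_Phi B Phi) \<longleftrightarrow>
    A \<in> Ob B \<and> R \<in> monoids (fibre F A) \<and> A' \<in> Ob B \<and> S \<in> monoids (fibre F A') \<and> f \<in> hom B A A' \<and>
    (R1, h, S1) \<in> hom (Mon_cat (fibre F A)) R (mon_pull f S)"
    by (simp add: Mon_Phi_def grothendieck_def hom_cat_simps Mon_idx_def mon_func_def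
        Phi_simps ob)
  also have "\<dots> \<longleftrightarrow> f \<in> Ar B \<and> A = Dom B f \<and> A' = Cod B f \<and> R1 = R \<and> S1 = mon_pull f S \<and>
    S \<in> Ob (MonE F) \<and> P (fst S) = A' \<and> (R, h, mon_pull f S) \<in> Ar (MonE F) \<and> PA h = iB A"
    using MonE_over(1)[of R h "mon_pull f S" "iB A"] MonE_ArD(1)[of R h "mon_pull f S"]
    by (auto simp: hom_def dc MonE_Ar_fibre monoids_fibre_iff)
  finally show ?thesis .
qed

text \<open>The comparison forgets how an arrow of \<open>E\<close> splits into a vertical arrow and a chosen lift; the
  splitting can be recovered, because the lifts are Cartesian.\<close>

definition Mon_comparison :: "('b \<times> ('o, 'm) mon, ('b \<times> ('o, 'm) mon) \<times> ('f \<times> ('o, 'm) mon_ar) \<times> ('b \<times> ('o, 'm) mon),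
    ('o, 'm) mon, ('o, 'm) mon_ar) func" where
  "Mon_comparison = \<lparr>FO = snd, FA = (\<lambda>((A, R), (f, (R', h, S')), (A', S)). (R, c f (fst S) \<bullet> h, S))\<rparr>"

lemma Mon_comparison_iso:
  "cat_isomorphism (Mon_Phi B Phi) (MonE F) Mon_comparison"
proof -
  let ?C = "Mon_Phi B Phi"
  \<comment> \<open>The inverse splits a morphism of monoids into its vertical part and the chosen lift.\<close>
  define GO where "GO R = (P (fst R), R)" for R :: "('o, 'm) mon"
  define GA where "GA = (\<lambda>(R :: ('o, 'm) mon, h, S). ((P (fst R), R),
    (PA h, (R, vert_fact F (c (PA h) (fst S)) h, mon_pull (PA h) S)), (P (fst S), S)))"
  have KO: "FO Mon_comparison X \<in> Ob (MonE F) \<and> GO (FO Mon_comparison X) = X" if "X \<in> Ob ?C" for X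
    using that by (auto simp: Mon_Phi_simps Mon_comparison_def GO_def)
  have GO: "GO Y \<in> Ob ?C \<and> FO Mon_comparison (GO Y) = Y" if "Y \<in> Ob (MonE F)" for Y
    using that MonE_Ob_simps[OF that] by (auto simp: Mon_Phi_simps Mon_comparison_def GO_def)
  have ArE: "\<exists>A R f h A' S. x = ((A, R), (f, (R, h, mon_pull f S)), (A', S)) \<and> f \<in> Ar B \<and> A = Dom B f \<and> A' = Cod B f \<and>
      S \<in> Ob (MonE F) \<and> P (fst S) = A' \<and> (R, h, mon_pull f S) \<in> Ar (MonE F) \<and> PA h = iB A \<and>
      h \<in> Ar E \<and> Dom E h = fst R \<and> Cod E h = FO (pull f) (fst S) \<and> fst S \<in> Ob E \<and> P (fst R) = A \<and>
      R \<in> Ob (MonE F) \<and> (mon_pull f S, c f (fst S), S) \<in> Ar (MonE F)"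
    if "x \<in> Ar ?C" for x
  proof -
    obtain A R f R1 h S1 A' S where x: "x = ((A, R), (f, (R1, h, S1)), (A', S))"
      by (metis surj_pair)
    note a = that[unfolded x Mon_Phi_Ar]
    have h: "(R, h, mon_pull f S) \<in> Ar (MonE F)" and v: "PA h = iB A" "A \<in> Ob B" using a by auto
    show ?thesis
      unfolding x
      using a MonE_ArD[OF h] MonE_over(1)[OF h v(1)] v(2) MonE_Ob_simps[of S] mon_ob_arrow[OF pull_inverse_image[of f], of S]
      by (intro exI[of _ A] exI[of _ R] exI[of _ f] exI[of _ h] exI[of _ A'] exI[of _ S]) (simp add: fst_mon_pull)
  qed
  have KA: "Dom ?C x \<in> Ob ?C \<and> Cod ?C x \<in> Ob ?C \<and>
      FA Mon_comparison x \<in> hom (MonE F) (FO Mon_comparison (Dom ?C x)) (FO Mon_comparison (Cod ?C x)) \<and>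
      GA (FA Mon_comparison x) = x" if xC: "x \<in> Ar ?C" for x
  proof -
    obtain A R f h A' S where x: "x = ((A, R), (f, (R, h, mon_pull f S)), (A', S))"
      and f [simp]: "f \<in> Ar B" and A: "A = Dom B f" "A' = Cod B f"
      and S [simp]: "S \<in> Ob (MonE F)" "P (fst S) = A'" and h: "(R, h, mon_pull f S) \<in> Ar (MonE F)" 
      and h' [simp]: "PA h = iB A" "h \<in> Ar E" "Dom E h = fst R" "Cod E h = FO (pull f) (fst S)" "fst S \<in> Ob E"
        "P (fst R) = A" "R \<in> Ob (MonE F)"
      and k: "(mon_pull f S, c f (fst S), S) \<in> Ar (MonE F)"
      using ArE[OF xC] by blast
    note [simp] = A inverse_imageD[OF pull_inverse_image[of f]]
    have "(R, c f (fst S) \<bullet> h, S) \<in> Ar (MonE F)" by (rule MonE_comp[OF h k])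
    moreover have "vert_fact F (c f (fst S)) (c f (fst S) \<bullet> h) = h"
      by (rule vert_fact_lift) simp_all
    ultimately show ?thesis
      by (simp add: x Mon_Phi_simps Mon_comparison_def GA_def hom_def)
  qed
  have GA: "GA y \<in> Ar ?C \<and> FA Mon_comparison (GA y) = y" if "y \<in> Ar (MonE F)" for y
  proof (rule MonE_cases[OF that])
    fix R h S assume y: "y = (R, h, S)" and h: "(R, h, S) \<in> Ar (MonE F)"
    obtain f where f [simp]: "PA h = f" by simp
    note hD [simp] = MonE_ArD[OF h] MonE_over[OF h f]
    have fB [simp]: "f \<in> Ar B" using proj_simps(4)[OF hD(3)] by simp
    have S [simp]: "fst S \<in> Ob E" by (simp add: MonE_Ob_simps)
    note [simp] = inverse_imageD[OF pull_inverse_image[of f]]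
    have k: "cart (c f (fst S))" by simp
    note v [simp] = vert_fact_props[OF k hD(3), simplified]
    have kA: "(mon_pull f S, c f (fst S), S) \<in> Ar (MonE F)" by (rule mon_ob_arrow[OF pull_inverse_image]) simp_all
    have "(R, vert_fact F (c f (fst S)) h, mon_pull f S) \<in> Ar (MonE F)"
      by (rule mon_factor[OF kA k]) (use h in \<open>simp_all add: fst_mon_pull\<close>)
    then show ?thesis
      by (simp add: y GA_def Mon_comparison_def Mon_Phi_Ar)
  qed
  have Id: "Idn ?C X = GA (Idn (MonE F) (FO Mon_comparison X))" if X: "X \<in> Ob ?C" for X
  proof -
    obtain A R where X': "X = (A, R)" by (cases X)
    have R: "R \<in> Ob (MonE F)" "P (fst R) = A" "A \<in> Ob B" using X X' by (auto simp: Mon_Phi_simps)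
    then show ?thesis
      using MonE_Ob_simps[OF R(1)]
      by (simp add: X' Mon_comparison_def Mon_Phi_simps GA_def) (simp add: Phi_P_def)
  qed
  have Co: "y \<cdot>\<^bsub>?C\<^esub> x = GA (FA Mon_comparison y \<cdot>\<^bsub>MonE F\<^esub> FA Mon_comparison x)"
    if x: "x \<in> Ar ?C" and y: "y \<in> Ar ?C" and xy: "Cod ?C x = Dom ?C y" for x y
  proof -
    obtain A R f h A' S where x': "x = ((A, R), (f, (R, h, mon_pull f S)), (A', S))"
      and f [simp]: "f \<in> Ar B" and A: "A = Dom B f" "A' = Cod B f"
      and S [simp]: "S \<in> Ob (MonE F)" "P (fst S) = A'"
      and h' [simp]: "PA h = iB A" "h \<in> Ar E" "Dom E h = fst R" "Cod E h = FO (pull f) (fst S)" "fst S \<in> Ob E"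
        "P (fst R) = A" "R \<in> Ob (MonE F)"
      using ArE[OF x] by blast
    obtain A1 S1 g l C T where y1: "y = ((A1, S1), (g, (S1, l, mon_pull g T)), (C, T))"
      and g [simp]: "g \<in> Ar B" and A1: "A1 = Dom B g" "C = Cod B g"
      and T [simp]: "T \<in> Ob (MonE F)" "P (fst T) = C"
      and l' [simp]: "PA l = iB A1" "l \<in> Ar E" "Dom E l = fst S1" "Cod E l = FO (pull g) (fst T)" "fst T \<in> Ob E"
      using ArE[OF y] by blast
    have e: "A1 = A'" "S1 = S" using xy by (auto simp: x' y1 Mon_Phi_simps)
    have y': "y = ((A', S), (g, (S, l, mon_pull g T)), (C, T))" using y1 e by simp
    have fg [simp]: "Cod B f = Dom B g" using A A1 e by simp
    note [simp] = A A1(2) inverse_imageD[OF pull_inverse_image[of f]] inverse_imageD[OF pull_inverse_image[of g]]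
    have l2: "PA l = iB (Dom B g)" "Dom E l = fst S" using A1 e l' by auto
    have vf: "vert_fact F (c (g \<cdot>\<^bsub>B\<^esub> f) (fst T)) ((c g (fst T) \<bullet> l) \<bullet> (c f (fst S) \<bullet> h)) =
        (ipc Phi f g (fst T) \<bullet> FA (pull f) l) \<bullet> h"
      by (rule vert_fact_lift_comp) (use l2 in simp_all)
    have pa: "PA ((c g (fst T) \<bullet> l) \<bullet> (c f (fst S) \<bullet> h)) = g \<cdot>\<^bsub>B\<^esub> f"
      using l2 by simp
    show ?thesis
      unfolding x' y' Mon_Phi_simps Mon_comparison_def GA_def
      using vf pa by (simp del: category_simps(11))
  qed
  show "cat_isomorphism ?C (MonE F) Mon_comparison"
    by (rule cat_isomorphismI[where GO = GO and GA = GA, OF category_MonE KO GO KA GA Id Co])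
qed

lemma Ob_Mod_cat: "A \<in> Ob B \<Longrightarrow> X \<in> Ob (Mod_cat (fibre F A)) \<longleftrightarrow> X \<in> Ob (ModE F) \<and> P (fst (fst X)) = A"
  using modules_fibre_iff[of A "fst X" "snd X"] by (auto simp: Mod_cat_def hom_cat_simps)

lemma Mod_Phi_simps:
  "Ob (Mod_Phi B Phi) = {(A, X). A \<in> Ob B \<and> X \<in> Ob (ModE F) \<and> P (fst (fst X)) = A}"
  "Dom (Mod_Phi B Phi) = fst" "Cod (Mod_Phi B Phi) x = snd (snd x)"
  "Idn (Mod_Phi B Phi) (A, X) =
    ((A, X), (iB A, (X, (ipi Phi A (fst (fst X)), ipi Phi A (fst (snd X))),
      mod_ob (fibre F A) (pull (iB A)) X)), (A, X))"
  "((A1, Y1), (g, (Y2, (l, b), Z1)), (C, Z)) \<cdot>\<^bsub>Mod_Phi B Phi\<^esub> ((A, X), (f, (X1, (h, a), Y')), (A', Y)) =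
    ((A, X), (g \<cdot>\<^bsub>B\<^esub> f, (X1, ((ipc Phi f g (fst (fst Z)) \<bullet> FA (pull f) l) \<bullet> h,
        (ipc Phi f g (fst (snd Z)) \<bullet> FA (pull f) b) \<bullet> a),
      mod_ob (fibre F (Dom B f)) (pull (g \<cdot>\<^bsub>B\<^esub> f)) Z)), (C, Z))"
  by (auto simp: Mod_Phi_def grothendieck_def hom_cat_simps Mod_idx_def mod_func_def Ob_Mod_cat Phi_simps)
     (simp_all add: Mod_cat_def hom_cat_simps)

lemma Mod_Phi_Ar:
  "((A, (R, M)), (f, (X1, (h, a), Y1)), (A', (S, N))) \<in> Ar (Mod_Phi B Phi) \<longleftrightarrow>
    f \<in> Ar B \<and> A = Dom B f \<and> A' = Cod B f \<and> X1 = (R, M) \<and> Y1 = mod_pull f (S, N) \<and>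
    (S, N) \<in> Ob (ModE F) \<and> P (fst S) = A' \<and>
    ((R, M), (h, a), mod_pull f (S, N)) \<in> Ar (ModE F) \<and> PA h = iB A"
proof -
  have dc: "Dom (Mod_cat V) (X, x, Y) = X" "Cod (Mod_cat V) (X, x, Y) = Y" for V X x Y
    by (simp_all add: Mod_cat_def hom_cat_def)
  have ob: "X \<in> Ob (Mod_cat (fibre F A)) \<longleftrightarrow> X \<in> Ob (ModE F) \<and> P (fst (fst X)) = A" if "A \<in> Ob B" for X A
    using modules_fibre_iff[OF that, of "fst X" "snd X"] by (auto simp: Mod_cat_def hom_cat_def)
  have "((A, (R, M)), (f, (X1, (h, a), Y1)), (A', (S, N))) \<in> Ar (Mod_Phi B Phi) \<longleftrightarrow>
    A \<in> Ob B \<and> (R, M) \<in> Ob (Mod_cat (fibre F A)) \<and> A' \<in> Ob B \<and> (S, N) \<in> Ob (Mod_cat (fibre F A')) \<and> f \<in> hom B A A' \<and>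
    (X1, (h, a), Y1) \<in> hom (Mod_cat (fibre F A)) (R, M) (mod_pull f (S, N))"
    by (simp add: Mod_Phi_def grothendieck_def hom_cat_simps Mod_idx_def mod_func_def
        Phi_simps)
  also have "\<dots> \<longleftrightarrow> f \<in> Ar B \<and> A = Dom B f \<and> A' = Cod B f \<and> X1 = (R, M) \<and> Y1 = mod_pull f (S, N) \<and>
    (S, N) \<in> Ob (ModE F) \<and> P (fst S) = A' \<and>
    ((R, M), (h, a), mod_pull f (S, N)) \<in> Ar (ModE F) \<and> PA h = iB A"
  proof -
    obtain S' N' where m: "mod_pull f (S, N) = (S', N')" by (cases "mod_pull f (S, N)")
    have "(R, M) \<in> Ob (ModE F) \<and> P (fst R) = A"
      if a: "((R, M), (h, a), (S', N')) \<in> Ar (ModE F)" and v: "PA h = iB A" "A \<in> Ob B"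
      using ModE_ArD(1)[OF a] MonE_over(1)[OF ModE_ArD(3)[OF a] v(1)] v(2) by simp
    then show ?thesis
      unfolding m by (auto simp: hom_def dc ModE_Ar_fibre ob)
  qed
  finally show ?thesis .
qed

definition Mod_comparison :: "('b \<times> ('o, 'm) modl, ('b \<times> ('o, 'm) modl) \<times> ('f \<times> ('o, 'm) modl_ar) \<times> ('b \<times> ('o, 'm) modl),
    ('o, 'm) modl, ('o, 'm) modl_ar) func" where
  "Mod_comparison = \<lparr>FO = snd, FA = (\<lambda>((A, X), (f, (X', (h, a), Y')), (A', Y)).
    (X, (c f (fst (fst Y)) \<bullet> h, c f (fst (snd Y)) \<bullet> a), Y))\<rparr>"

text \<open>The argument for monoids, applied to both components of a morphism of modules.\<close>

lemma Mod_comparison_iso: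
  "cat_isomorphism (Mod_Phi B Phi) (ModE F) Mod_comparison"
proof -
  let ?C = "Mod_Phi B Phi"
  \<comment> \<open>As for monoids, with both components split over the same arrow of the base.\<close>
  define GO where "GO X = (P (fst (fst X)), X)" for X :: "('o, 'm) modl"
  define GA where "GA = (\<lambda>(X :: ('o, 'm) modl, (h, a), Y). ((P (fst (fst X)), X),
    (PA h, (X, (vert_fact F (c (PA h) (fst (fst Y))) h, vert_fact F (c (PA h) (fst (snd Y))) a), mod_pull (PA h) Y)),
    (P (fst (fst Y)), Y)))"
  have KO: "FO Mod_comparison X \<in> Ob (ModE F) \<and> GO (FO Mod_comparison X) = X" if "X \<in> Ob ?C" for X
    using that by (auto simp: Mod_Phi_simps Mod_comparison_def GO_def)
  have GO: "GO Y \<in> Ob ?C \<and> FO Mod_comparison (GO Y) = Y" if "Y \<in> Ob (ModE F)" for Y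
    using that ModE_ObD(1)[of "fst Y" "fst (snd Y)" "snd (snd Y)"] MonE_Ob_simps[of "fst Y"]
    by (auto simp: Mod_Phi_simps Mod_comparison_def GO_def)
  have ArE: "\<exists>A R M f h a A' S N. x = ((A, (R, M)), (f, ((R, M), (h, a), mod_pull f (S, N))), (A', (S, N))) \<and>
      f \<in> Ar B \<and> A = Dom B f \<and> A' = Cod B f \<and>
      (S, N) \<in> Ob (ModE F) \<and> P (fst S) = A' \<and> ((R, M), (h, a), mod_pull f (S, N)) \<in> Ar (ModE F) \<and> PA h = iB A \<and>
      h \<in> Ar E \<and> Dom E h = fst R \<and> Cod E h = FO (pull f) (fst S) \<and> fst S \<in> Ob E \<and> P (fst R) = A \<and>
      PA a = iB A \<and> a \<in> Ar E \<and> Dom E a = fst M \<and> Cod E a = FO (pull f) (fst N) \<and> fst N \<in> Ob E \<and> P (fst N) = A' \<and>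
      (R, M) \<in> Ob (ModE F) \<and> (mod_pull f (S, N), (c f (fst S), c f (fst N)), (S, N)) \<in> Ar (ModE F)"
    if "x \<in> Ar ?C" for x
  proof -
    obtain A R M f X1 h a Y1 A' S N where x: "x = ((A, (R, M)), (f, (X1, (h, a), Y1)), (A', (S, N)))"
      by (metis surj_pair)
    note b = that[unfolded x Mod_Phi_Ar]
    have h: "((R, M), (h, a), (mon_pull f S, snd (mod_pull f (S, N)))) \<in> Ar (ModE F)"
      using b mod_pull_components(1)[of f S N] by simp
    have v: "PA h = iB A" "A \<in> Ob B" using b by auto
    note hD = ModE_ArD[OF h]
    have N: "fst N \<in> Ob E" "P (fst N) = P (fst S)" "fst S \<in> Ob E"
      using b ModE_ObD(1-3)[of S "fst N" "snd N"] MonE_Ob_simps[of S] by simp_all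
    show ?thesis
      unfolding x
      using b hD(1,4-7) MonE_ArD[OF hD(3)] MonE_over(1)[OF hD(3) v(1)] v(2) N mod_ob_arrow[OF pull_inverse_image[of f], of S N]
      by (intro exI[of _ A] exI[of _ R] exI[of _ M] exI[of _ f] exI[of _ h] exI[of _ a] exI[of _ A'] exI[of _ S] exI[of _ N])
         (simp add: fst_mon_pull mod_pull_components(2))
  qed
  have KA: "Dom ?C x \<in> Ob ?C \<and> Cod ?C x \<in> Ob ?C \<and>
      FA Mod_comparison x \<in> hom (ModE F) (FO Mod_comparison (Dom ?C x)) (FO Mod_comparison (Cod ?C x)) \<and>
      GA (FA Mod_comparison x) = x" if xC: "x \<in> Ar ?C" for x
  proof -
    obtain A R M f h a A' S N where x: "x = ((A, (R, M)), (f, ((R, M), (h, a), mod_pull f (S, N))), (A', (S, N)))"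
      and f [simp]: "f \<in> Ar B" and A: "A = Dom B f" "A' = Cod B f"
      and S [simp]: "(S, N) \<in> Ob (ModE F)" "P (fst S) = A'"
      and h: "((R, M), (h, a), mod_pull f (S, N)) \<in> Ar (ModE F)"
      and h' [simp]: "PA h = iB A" "h \<in> Ar E" "Dom E h = fst R" "Cod E h = FO (pull f) (fst S)" "fst S \<in> Ob E"
        "P (fst R) = A"
      and a' [simp]: "PA a = iB A" "a \<in> Ar E" "Dom E a = fst M" "Cod E a = FO (pull f) (fst N)" "fst N \<in> Ob E"
        "P (fst N) = A'" "(R, M) \<in> Ob (ModE F)"
      and k: "(mod_pull f (S, N), (c f (fst S), c f (fst N)), (S, N)) \<in> Ar (ModE F)"
      using ArE[OF xC] by blast
    note [simp] = A inverse_imageD[OF pull_inverse_image[of f]]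
    have "((R, M), (c f (fst S) \<bullet> h, c f (fst N) \<bullet> a), (S, N)) \<in> Ar (ModE F)"
      using ModE_comp h k mod_pull_components(1)[of f S N] by metis
    moreover have "vert_fact F (c f (fst S)) (c f (fst S) \<bullet> h) = h" "vert_fact F (c f (fst N)) (c f (fst N) \<bullet> a) = a"
      by (rule vert_fact_lift; simp)+
    ultimately show ?thesis
      by (simp add: x Mod_Phi_simps Mod_comparison_def GA_def hom_def)
  qed
  have GA: "GA y \<in> Ar ?C \<and> FA Mod_comparison (GA y) = y" if "y \<in> Ar (ModE F)" for y
  proof (rule ModE_cases[OF that])
    fix R M h a S N assume y: "y = ((R, M), (h, a), (S, N))" and ha: "((R, M), (h, a), (S, N)) \<in> Ar (ModE F)"
    note aD = ModE_ArD[OF ha]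
    note h = aD(3)
    obtain f where f [simp]: "PA h = f" by simp
    note hD [simp] = MonE_ArD[OF h] MonE_over[OF h f]
    have a [simp]: "a \<in> Ar E" "Dom E a = fst M" "Cod E a = fst N" "PA a = f" using aD by simp_all
    have fB [simp]: "f \<in> Ar B" using proj_simps(4)[OF hD(3)] by simp
    have S [simp]: "fst S \<in> Ob E" by (simp add: MonE_Ob_simps)
    have N [simp]: "fst N \<in> Ob E" "P (fst N) = Cod B f" "P (fst M) = Dom B f"
      using ModE_ObD(2,3)[of S "fst N" "snd N"] ModE_ObD(3)[of R "fst M" "snd M"] aD(1,2) by simp_all
    note [simp] = inverse_imageD[OF pull_inverse_image[of f]]
    have k: "cart (c f (fst S))" and k': "cart (c f (fst N))" by simp_all
    note v [simp] = vert_fact_props[OF k hD(3), simplified] vert_fact_props[OF k' a(1), simplified]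
    have kA: "(mon_pull f S, c f (fst S), S) \<in> Ar (MonE F)" by (rule mon_ob_arrow[OF pull_inverse_image]) simp_all
    have vA: "(R, vert_fact F (c f (fst S)) h, mon_pull f S) \<in> Ar (MonE F)"
      by (rule mon_factor[OF kA k]) (use h in \<open>simp_all add: fst_mon_pull\<close>)
    have kM: "((mon_pull f S, snd (mod_pull f (S, N))), (c f (fst S), c f (fst N)), (S, N)) \<in> Ar (ModE F)"
      using mod_ob_arrow[OF pull_inverse_image[OF fB] aD(2)] mod_pull_components(1)[of f S N] by simp
    have "((R, M), (vert_fact F (c f (fst S)) h, vert_fact F (c f (fst N)) a), (mon_pull f S, snd (mod_pull f (S, N)))) \<in> Ar (ModE F)"
      by (rule mod_factor[OF kM k']) (use ha vA in \<open>simp_all add: mod_pull_components(2)\<close>)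
    then have "((R, M), (vert_fact F (c f (fst S)) h, vert_fact F (c f (fst N)) a), mod_pull f (S, N)) \<in> Ar (ModE F)"
      using mod_pull_components(1)[of f S N] by simp
    then show ?thesis
      using aD(2) by (simp add: y GA_def Mod_comparison_def Mod_Phi_Ar)
  qed
  have Id: "Idn ?C X = GA (Idn (ModE F) (FO Mod_comparison X))" if X: "X \<in> Ob ?C" for X
  proof -
    obtain A R M where X': "X = (A, (R, M))" by (metis surj_pair)
    have R: "(R, M) \<in> Ob (ModE F)" "P (fst R) = A" "A \<in> Ob B" using X X' by (auto simp: Mod_Phi_simps)
    then show ?thesis
      using ModE_ObD(1-3)[of R "fst M" "snd M"] MonE_Ob_simps[of R]
      by (simp add: X' Mod_comparison_def Mod_Phi_simps GA_def) (simp add: Phi_P_def)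
  qed
  have Co: "y \<cdot>\<^bsub>?C\<^esub> x = GA (FA Mod_comparison y \<cdot>\<^bsub>ModE F\<^esub> FA Mod_comparison x)"
    if x: "x \<in> Ar ?C" and y: "y \<in> Ar ?C" and xy: "Cod ?C x = Dom ?C y" for x y
  proof -
    obtain A R M f h a A' S N where x': "x = ((A, (R, M)), (f, ((R, M), (h, a), mod_pull f (S, N))), (A', (S, N)))"
      and f [simp]: "f \<in> Ar B" and A: "A = Dom B f" "A' = Cod B f"
      and S [simp]: "(S, N) \<in> Ob (ModE F)" "P (fst S) = A'"
      and h' [simp]: "PA h = iB A" "h \<in> Ar E" "Dom E h = fst R" "Cod E h = FO (pull f) (fst S)" "fst S \<in> Ob E"
        "P (fst R) = A"
      and a' [simp]: "PA a = iB A" "a \<in> Ar E" "Dom E a = fst M" "Cod E a = FO (pull f) (fst N)" "fst N \<in> Ob E"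
        "P (fst N) = A'"
      using ArE[OF x] by blast
    obtain A1 S1 N1 g l b C T L where y1: "y = ((A1, (S1, N1)), (g, ((S1, N1), (l, b), mod_pull g (T, L))), (C, (T, L)))"
      and g [simp]: "g \<in> Ar B" and A1: "A1 = Dom B g" "C = Cod B g"
      and T [simp]: "(T, L) \<in> Ob (ModE F)" "P (fst T) = C"
      and l' [simp]: "PA l = iB A1" "l \<in> Ar E" "Dom E l = fst S1" "Cod E l = FO (pull g) (fst T)" "fst T \<in> Ob E"
      and b' [simp]: "PA b = iB A1" "b \<in> Ar E" "Dom E b = fst N1" "Cod E b = FO (pull g) (fst L)" "fst L \<in> Ob E"
        "P (fst L) = C"
      using ArE[OF y] by blast
    have e: "A1 = A'" "S1 = S" "N1 = N" using xy by (auto simp: x' y1 Mod_Phi_simps)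
    have y': "y = ((A', (S, N)), (g, ((S, N), (l, b), mod_pull g (T, L))), (C, (T, L)))" using y1 e by simp
    have fg [simp]: "Cod B f = Dom B g" using A A1 e by simp
    note [simp] = A A1(2) inverse_imageD[OF pull_inverse_image[of f]] inverse_imageD[OF pull_inverse_image[of g]]
    have l2: "PA l = iB (Dom B g)" "Dom E l = fst S" "PA b = iB (Dom B g)" "Dom E b = fst N"
      using A1 e l' b' by auto
    have vf: "vert_fact F (c (g \<cdot>\<^bsub>B\<^esub> f) (fst T)) ((c g (fst T) \<bullet> l) \<bullet> (c f (fst S) \<bullet> h)) =
        (ipc Phi f g (fst T) \<bullet> FA (pull f) l) \<bullet> h"
      by (rule vert_fact_lift_comp) (use l2 in simp_all)
    have vf': "vert_fact F (c (g \<cdot>\<^bsub>B\<^esub> f) (fst L)) ((c g (fst L) \<bullet> b) \<bullet> (c f (fst N) \<bullet> a)) =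
        (ipc Phi f g (fst L) \<bullet> FA (pull f) b) \<bullet> a"
      by (rule vert_fact_lift_comp) (use l2 in simp_all)
    have pa: "PA ((c g (fst T) \<bullet> l) \<bullet> (c f (fst S) \<bullet> h)) = g \<cdot>\<^bsub>B\<^esub> f"
      using l2 by simp
    show ?thesis
      unfolding x' y' Mod_Phi_simps Mod_comparison_def GA_def
      using vf vf' pa by (simp del: category_simps(11))
  qed
  show "cat_isomorphism ?C (ModE F) Mod_comparison"
    by (rule cat_isomorphismI[where GO = GO and GA = GA, OF category_ModE KO GO KA GA Id Co])
qed

lemma Mod_Phi_cases:
  assumes "x \<in> Ar (Mod_Phi B Phi)"
  obtains f R M h a S N where
    "x = ((Dom B f, (R, M)), (f, ((R, M), (h, a), mod_pull f (S, N))), (Cod B f, (S, N)))"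
    "((Dom B f, R), (f, (R, h, mon_pull f S)), (Cod B f, S)) \<in> Ar (Mon_Phi B Phi)"
proof -
  obtain A R M f X1 h a Y1 A' S N where x: "x = ((A, (R, M)), (f, (X1, (h, a), Y1)), (A', (S, N)))"
    by (metis surj_pair)
  note b = assms[unfolded x Mod_Phi_Ar]
  have h: "((R, M), (h, a), (mon_pull f S, snd (mod_pull f (S, N)))) \<in> Ar (ModE F)"
    using b mod_pull_components(1)[of f S N] by simp
  have "S \<in> Ob (MonE F)" using b ModE_ObD(1)[of S "fst N" "snd N"] by simp
  then have "((Dom B f, R), (f, (R, h, mon_pull f S)), (Cod B f, S)) \<in> Ar (Mon_Phi B Phi)"
    using b ModE_ArD(3)[OF h] by (simp add: Mon_Phi_Ar)
  then show ?thesis using that b x by blast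
qed

lemma comparison_square:
  "func_eq (Mod_Phi B Phi) (comp_func Mod_proj Mod_comparison) (comp_func Mon_comparison Mod_Phi_proj)"
proof -
  have "FA (comp_func Mod_proj Mod_comparison) x = FA (comp_func Mon_comparison Mod_Phi_proj) x"
    if "x \<in> Ar (Mod_Phi B Phi)" for x
    by (rule Mod_Phi_cases[OF that])
       (simp add: comp_func_def Mod_proj_def Mod_comparison_def Mon_comparison_def Mod_Phi_proj_def
          grothendieck_map_def case_prod_unfold)
  then show ?thesis
    by (simp add: func_eq_def comp_func_def Mod_proj_def Mod_comparison_def Mon_comparison_def Mod_Phi_proj_def
          grothendieck_map_def case_prod_unfold)
qed

lemma comparison_over_base:
  "func_eq (Mon_Phi B Phi) (comp_func (MonE_proj F) Mon_comparison) grothendieck_proj"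
  unfolding func_eq_def
proof (intro conjI ballI)
  show "FO (comp_func (MonE_proj F) Mon_comparison) X = FO grothendieck_proj X" if "X \<in> Ob (Mon_Phi B Phi)" for X
    using that by (auto simp: Mon_Phi_simps comp_func_def MonE_proj_def Mon_comparison_def grothendieck_proj_def)
  fix x assume x: "x \<in> Ar (Mon_Phi B Phi)"
  obtain A R f R1 h S1 A' S where x': "x = ((A, R), (f, (R1, h, S1)), (A', S))" by (metis surj_pair)
  note b = x[unfolded x' Mon_Phi_Ar]
  have h: "(R, h, mon_pull f S) \<in> Ar (MonE F)" using b by blast
  note [simp] = MonE_ArD[OF h] inverse_imageD[OF pull_inverse_image[of f]]
  show "FA (comp_func (MonE_proj F) Mon_comparison) x = FA grothendieck_proj x"
    using b by (simp add: x' comp_func_def MonE_proj_def Mon_comparison_def grothendieck_proj_def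
        fst_mon_pull MonE_Ob_simps)
qed

text \<open>The Grothendieck constructions are fibrations because their isomorphic images are.\<close>

lemma isomorphic_over_base:
  "isomorphic_fibrations_over B (Mod_Phi B Phi) (Mon_Phi B Phi) Mod_Phi_proj grothendieck_proj
    (ModE F) (MonE F) Mod_proj (MonE_proj F)"
proof -
  have o: "FO Mod_Phi_proj X \<in> Ob (Mon_Phi B Phi)" if "X \<in> Ob (Mod_Phi B Phi)" for X
    using that ModE_ObD(1) by (fastforce simp: Mod_Phi_simps Mon_Phi_simps Mod_Phi_proj_def grothendieck_map_def Mod_proj_def)
  have a: "FA Mod_Phi_proj x \<in> Ar (Mon_Phi B Phi)" if "x \<in> Ar (Mod_Phi B Phi)" for x
    by (rule Mod_Phi_cases[OF that])
       (simp add: Mod_Phi_proj_def grothendieck_map_def Mod_proj_def mod_ob_def case_prod_unfold)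
  have o': "FO grothendieck_proj X \<in> Ob B" if "X \<in> Ob (Mon_Phi B Phi)" for X
    using that by (auto simp: Mon_Phi_simps grothendieck_proj_def)
  have a': "FA grothendieck_proj x \<in> Ar B" if "x \<in> Ar (Mon_Phi B Phi)" for x
  proof -
    obtain A R f R1 h S1 A' S where x': "x = ((A, R), (f, (R1, h, S1)), (A', S))" by (metis surj_pair)
    show ?thesis using that unfolding x' Mon_Phi_Ar by (simp add: grothendieck_proj_def)
  qed
  have sq: "func_eq (Mon_Phi B Phi) (comp_func (MonE_proj F) Mon_comparison) (comp_func id_func grothendieck_proj)"
    using comparison_over_base by (simp add: func_eq_def comp_func_def id_func_def)
  have "fibration (Mod_Phi B Phi) (Mon_Phi B Phi) Mod_Phi_proj"
    by (rule fibration_transport[OF Mod_comparison_iso Mon_comparison_iso comparison_square o a fibration_ModE])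
  moreover have "fibration (Mon_Phi B Phi) B grothendieck_proj"
    by (rule fibration_transport[OF Mon_comparison_iso cat_isomorphism_id sq o' a' fibration_MonE]) simp_all
  ultimately show ?thesis
    unfolding isomorphic_fibrations_over_def
    using fibration_ModE fibration_MonE Mod_comparison_iso Mon_comparison_iso comparison_square comparison_over_base
    by blast
qed

end

end

theorem proposition4p3p25:
  fixes F :: "('b, 'f, 'o, 'm) monfib"
  assumes "monoidal_fibred_category F"
  shows
    "fibration (ModE F) (MonE F) Mod_proj \<and>
     (\<forall>R \<phi> S N fS fN.
        (R, \<phi>, S) \<in> Ar (MonE F) \<longrightarrow> (S, N) \<in> Ob (ModE F) \<longrightarrow>
        cartesian_lift (tot F) (base F) (proj F) (FA (proj F) \<phi>) (fst S) fS \<longrightarrow>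
        cartesian_lift (tot F) (base F) (proj F) (FA (proj F) \<phi>) (fst N) fN \<longrightarrow>
        (let A = FO (proj F) (fst R);
             S' = induced_monoid F fS S;
             N' = induced_module F fS fN S N;
             \<phi>' = vert_fact F fS \<phi>;
             N'' = restrict_scalars (fibre F A) \<phi>' N';
             v = ((R, N''), (\<phi>', Idn (tot F) (fst N')), (S', N'));
             h = ((S', N'), (fS, fN), (S, N))
         in cartesian_lift (ModE F) (MonE F) Mod_proj (R, \<phi>', S') (S', N') v \<and>
            FA (ModE_proj F) v = Idn (base F) A \<and>
            cartesian_lift (ModE F) (MonE F) Mod_proj (S', fS, S) (S, N) h \<and>
            cartesian_lift (ModE F) (base F) (ModE_proj F) (FA (proj F) \<phi>) (S, N) h \<and>
            cartesian_lift (ModE F) (MonE F) Mod_proj (R, \<phi>, S) (S, N) (h \<cdot>\<^bsub>ModE F\<^esub> v) \<and>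
            Dom (ModE F) (h \<cdot>\<^bsub>ModE F\<^esub> v) = (R, N''))) \<and>
     (\<forall>A \<in> Ob (base F).
        isomorphic_fibrations
          (fibre_cat (ModE F) (base F) (ModE_proj F) A) (fibre_cat (MonE F) (base F) (MonE_proj F) A) Mod_proj
          (Mod_cat (fibre F A)) (Mon_cat (fibre F A)) Mod_proj) \<and>
     (\<forall>c. cleavage (tot F) (base F) (proj F) c \<longrightarrow>
        monoidal_indexed_category (base F) (Phi_P F c) \<and>
        isomorphic_fibrations_over (base F)
          (Mod_Phi (base F) (Phi_P F c)) (Mon_Phi (base F) (Phi_P F c)) Mod_Phi_proj grothendieck_proj
          (ModE F) (MonE F) Mod_proj (MonE_proj F))"
proof -
  interpret monoidal_fibration F by unfold_locales (rule assms)
  show ?thesis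
    unfolding Let_def
    by (intro conjI allI impI ballI fibration_ModE composite_cartesian_lift fibres_isomorphic
        monoidal_indexed_category_Phi isomorphic_over_base)
qed

end
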